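(* Let $A,B$ be index sets and let $$G=\left( *_{\alpha\in A}\mathbb Z\right)*\left( *_{\beta\in B}\mathbb Z_2\right)$$ be the free product of copies of $\mathbb Z$ indexed by $A$ and copies of $\mathbb Z_2$ indexed by $B$. Let $|g|$ be the associated reduced word length on $G$, and let $L$ be the generator of the semigroup $P_t(\lambda_g)=e^{-t|g|}\lambda_g$, i.e. $L\lambda_g=|g|\lambda_g$. Then for every positive $x\in\mathbb C[G]$, $$\operatorname{Ent}(x^2)\le 2\,\tau(xLx).$$
   Context: The word length is taken with respect to the generating set consisting of a generator of each copy of $\mathbb Z$ and its inverse, and the nontrivial element of each copy of $\mathbb Z_2$; the corresponding Cayley graph of $G$ is a tree. $\lambda$ is the left regular representation of $G$ on $\ell_2(G)$, $\mathbb C[G]=\operatorname{span}\{\lambda_g:g\in G\}$ is viewed inside the group von Neumann algebra generated by $\{\lambda_g\}$, and $\tau$ is the canonical tracial state, $\tau(\lambda_g)=\delta_{g,e}$. "Positive" means positive as an operator. For a positive operator $a$ in this algebra, $\operatorname{Ent}(a)=\tau(a\log a)-\tau(a)\log\tau(a)$, with the convention $0\log0=0$. *)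

theory Defs
  imports "HOL-Analysis.Analysis" "HOL-Algebra.Elementary_Groups"
    "HOL-Computational_Algebra.Polynomial" "HOL-Library.Nonpos_Ints"
begin

section \<open>Free products of groups\<close>

text \<open>
  Elements of the free product are reduced words: lists of pairs of an index and a nontrivial
  element of the corresponding factor, with consecutive indices distinct.
\<close>

definition reduced_words :: "'i set \<Rightarrow> ('i \<Rightarrow> 'b monoid) \<Rightarrow> ('i \<times> 'b) list set" where
  "reduced_words I H =
     {w. (\<forall>(i, h)\<in>set w. i \<in> I \<and> h \<in> carrier (H i) \<and> h \<noteq> \<one>\<^bsub>H i\<^esub>)
         \<and> successively (\<lambda>p q. fst p \<noteq> fst q) w}"

text \<open>Left multiplication of a reduced word by one element of one factor.\<close>

fun syllable_mult :: "('i \<Rightarrow> 'b monoid) \<Rightarrow> 'i \<times> 'b \<Rightarrow> ('i \<times> 'b) list \<Rightarrow> ('i \<times> 'b) list" where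
  "syllable_mult H (i, g) [] = (if g = \<one>\<^bsub>H i\<^esub> then [] else [(i, g)])"
| "syllable_mult H (i, g) ((j, h) # w) =
     (if g = \<one>\<^bsub>H i\<^esub> then (j, h) # w
      else if i = j then
        (if g \<otimes>\<^bsub>H i\<^esub> h = \<one>\<^bsub>H i\<^esub> then w else (i, g \<otimes>\<^bsub>H i\<^esub> h) # w)
      else (i, g) # (j, h) # w)"

definition free_product :: "'i set \<Rightarrow> ('i \<Rightarrow> 'b monoid) \<Rightarrow> ('i \<times> 'b) list monoid" where
  "free_product I H =
     \<lparr>carrier = reduced_words I H,
      monoid.mult = (\<lambda>u w. foldr (syllable_mult H) u w),
      one = []\<rparr>"

lemma free_product_simps [simp]:
  "carrier (free_product I H) = reduced_words I H"
  "u \<otimes>\<^bsub>free_product I H\<^esub> w = foldr (syllable_mult H) u w"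
  "\<one>\<^bsub>free_product I H\<^esub> = []"
  by (simp_all add: free_product_def)

lemma Nil_reduced [simp]: "[] \<in> reduced_words I H"
  by (simp add: reduced_words_def)

lemma reduced_words_Cons:
  "(i, h) # w \<in> reduced_words I H \<longleftrightarrow>
     i \<in> I \<and> h \<in> carrier (H i) \<and> h \<noteq> \<one>\<^bsub>H i\<^esub> \<and> w \<in> reduced_words I H \<and>
     (w = [] \<or> fst (hd w) \<noteq> i)"
  by (auto simp: reduced_words_def successively_Cons)

context
  fixes I :: "'i set" and H :: "'i \<Rightarrow> 'b monoid"
  assumes factors: "\<And>i. i \<in> I \<Longrightarrow> group (H i)"
begin

lemma syllable_mult_closed:
  assumes "i \<in> I" "g \<in> carrier (H i)" "w \<in> reduced_words I H"
  shows "syllable_mult H (i, g) w \<in> reduced_words I H"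
proof -
  interpret group "H i" by (rule factors) fact
  show ?thesis
    using assms by (cases w) (auto simp: reduced_words_Cons)
qed

lemma syllable_mult_mult:
  assumes "i \<in> I" "g \<in> carrier (H i)" "h \<in> carrier (H i)" "w \<in> reduced_words I H"
  shows "syllable_mult H (i, g) (syllable_mult H (i, h) w) =
         syllable_mult H (i, g \<otimes>\<^bsub>H i\<^esub> h) w"
proof -
  interpret group "H i" by (rule factors) fact
  show ?thesis
  proof (cases w)
    case Nil
    then show ?thesis using assms by auto
  next
    case (Cons p v)
    obtain j k where p: "p = (j, k)" by (cases p)
    show ?thesis
    proof (cases "i = j")
      case False
      then show ?thesis using assms by (auto simp: Cons p)
    next
      case True
      have w: "w = (i, k) # v"
        using True by (simp add: Cons p)
      have k: "k \<in> carrier (H i)" "k \<noteq> \<one>\<^bsub>H i\<^esub>"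
        and v: "v = [] \<or> fst (hd v) \<noteq> i"
        using assms by (auto simp: w reduced_words_Cons)
      have v': "syllable_mult H (i, g) v = (if g = \<one>\<^bsub>H i\<^esub> then v else (i, g) # v)"
        using v by (cases v) auto
      have assoc: "g \<otimes>\<^bsub>H i\<^esub> (h \<otimes>\<^bsub>H i\<^esub> k) = g \<otimes>\<^bsub>H i\<^esub> h \<otimes>\<^bsub>H i\<^esub> k"
        using assms k by (simp add: m_assoc)
      show ?thesis
      proof (cases "h \<otimes>\<^bsub>H i\<^esub> k = \<one>\<^bsub>H i\<^esub>")
        case hk: True
        have g: "g \<otimes>\<^bsub>H i\<^esub> h \<otimes>\<^bsub>H i\<^esub> k = g"
          using assoc assms hk by simp
        have h: "h \<noteq> \<one>\<^bsub>H i\<^esub>"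
          using hk k by auto
        have gk: "g = k" if "g \<otimes>\<^bsub>H i\<^esub> h = \<one>\<^bsub>H i\<^esub>"
          using that g k by simp
        show ?thesis
          using assms(2,3) hk h g gk k(1) by (simp add: w v')
      next
        case hk: False
        show ?thesis
        proof (cases "g = \<one>\<^bsub>H i\<^esub> \<or> h = \<one>\<^bsub>H i\<^esub>")
          case True
          then show ?thesis using assms(2,3) k hk by (auto simp: w)
        next
          case False
          have "g \<otimes>\<^bsub>H i\<^esub> (h \<otimes>\<^bsub>H i\<^esub> k) = k" if "g \<otimes>\<^bsub>H i\<^esub> h = \<one>\<^bsub>H i\<^esub>"
            using that assoc k by simp
          then show ?thesis
            using False assms(2,3) k hk assoc by (simp add: w)
        qed
      qed
    qed
  qed
qed

lemma syllable_mult_one: "w \<in> reduced_words I H \<Longrightarrow> syllable_mult H (i, \<one>\<^bsub>H i\<^esub>) w = w"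
  by (cases w) auto

lemma free_product_mult_closed:
  assumes "u \<in> reduced_words I H" "w \<in> reduced_words I H"
  shows "foldr (syllable_mult H) u w \<in> reduced_words I H"
  using assms by (induction u) (auto simp: reduced_words_Cons syllable_mult_closed)

lemma foldr_syllable_mult:
  assumes "i \<in> I" "g \<in> carrier (H i)" "v \<in> reduced_words I H" "w \<in> reduced_words I H"
  shows "foldr (syllable_mult H) (syllable_mult H (i, g) v) w =
         syllable_mult H (i, g) (foldr (syllable_mult H) v w)"
proof (cases v)
  case Nil
  then show ?thesis using assms by (auto simp: syllable_mult_one)
next
  case (Cons p u)
  obtain j k where p: "p = (j, k)" by (cases p)
  have k: "j \<in> I" "k \<in> carrier (H j)" "u \<in> reduced_words I H"
    using assms by (auto simp: Cons p reduced_words_Cons)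
  have r: "foldr (syllable_mult H) u w \<in> reduced_words I H"
    using k assms by (simp add: free_product_mult_closed)
  show ?thesis
    using assms k r
    by (auto simp: Cons p syllable_mult_mult syllable_mult_one syllable_mult_closed)
qed

lemma free_product_assoc:
  assumes "u \<in> reduced_words I H" "v \<in> reduced_words I H" "w \<in> reduced_words I H"
  shows "foldr (syllable_mult H) (foldr (syllable_mult H) u v) w =
         foldr (syllable_mult H) u (foldr (syllable_mult H) v w)"
  using assms
  by (induction u) (auto simp: reduced_words_Cons foldr_syllable_mult free_product_mult_closed)

lemma free_product_l_inv:
  assumes "w \<in> reduced_words I H"
  shows "\<exists>v\<in>reduced_words I H. foldr (syllable_mult H) v w = []"
  using assms
proof (induction w)
  case Nil
  show ?case by (rule bexI[of _ "[]"]) auto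
next
  case (Cons p w)
  obtain i g where p: "p = (i, g)" by (cases p)
  have w: "i \<in> I" "g \<in> carrier (H i)" "g \<noteq> \<one>\<^bsub>H i\<^esub>" "w \<in> reduced_words I H"
    using Cons.prems by (auto simp: p reduced_words_Cons)
  interpret group "H i" by (rule factors) fact
  obtain v where v: "v \<in> reduced_words I H" "foldr (syllable_mult H) v w = []"
    using Cons.IH w by blast
  have s: "[(i, inv\<^bsub>H i\<^esub> g)] \<in> reduced_words I H"
    using w by (auto simp: reduced_words_Cons)
  have "foldr (syllable_mult H) (foldr (syllable_mult H) v [(i, inv\<^bsub>H i\<^esub> g)]) (p # w) =
        foldr (syllable_mult H) v w"
    using w v s Cons.prems by (subst free_product_assoc) (auto simp: p)
  then show ?case
    using v s by (intro bexI[OF _ free_product_mult_closed[OF v(1) s]]) simp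
qed

lemma group_free_product: "group (free_product I H)"
  by (rule groupI)
     (auto simp: free_product_mult_closed free_product_assoc free_product_l_inv)

end

text \<open>
  The free product of copies of \<open>\<int>\<close> indexed by \<open>A\<close> and copies of \<open>\<int>\<^sub>2\<close> indexed by \<open>B\<close>.
\<close>

definition free_product_Z_Z2 :: "'a set \<Rightarrow> 'b set \<Rightarrow> (('a + 'b) \<times> int) list monoid" where
  "free_product_Z_Z2 A B =
     free_product (A <+> B) (case_sum (\<lambda>_. integer_group) (\<lambda>_. integer_mod_group 2))"

definition generators_Z_Z2 :: "'a set \<Rightarrow> 'b set \<Rightarrow> (('a + 'b) \<times> int) list set" where
  "generators_Z_Z2 A B =
     (\<Union>a\<in>A. {[(Inl a, 1)], [(Inl a, -1)]}) \<union> (\<Union>b\<in>B. {[(Inr b, 1)]})"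

lemma group_free_product_Z_Z2: "group (free_product_Z_Z2 A B)"
  unfolding free_product_Z_Z2_def by (rule group_free_product) (auto split: sum.splits)

text \<open>Word length of a group element with respect to a generating set.\<close>

definition word_length :: "('g, 'm) monoid_scheme \<Rightarrow> 'g set \<Rightarrow> 'g \<Rightarrow> nat" where
  "word_length G S g =
     (LEAST n. \<exists>ws. set ws \<subseteq> S \<and> length ws = n \<and> foldr (\<otimes>\<^bsub>G\<^esub>) ws \<one>\<^bsub>G\<^esub> = g)"


section \<open>Bounded operators on \<open>\<ell>\<^sub>2\<close>\<close>

definition ell2 :: "'x set \<Rightarrow> ('x \<Rightarrow> complex) set" where
  "ell2 X = {f. (\<forall>x. x \<notin> X \<longrightarrow> f x = 0) \<and> (\<lambda>x. (cmod (f x))\<^sup>2) summable_on X}"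

definition ell2_inner :: "'x set \<Rightarrow> ('x \<Rightarrow> complex) \<Rightarrow> ('x \<Rightarrow> complex) \<Rightarrow> complex" where
  "ell2_inner X f h = (\<Sum>\<^sub>\<infinity>x\<in>X. cnj (f x) * h x)"

definition ell2_norm :: "'x set \<Rightarrow> ('x \<Rightarrow> complex) \<Rightarrow> real" where
  "ell2_norm X f = sqrt (\<Sum>\<^sub>\<infinity>x\<in>X. (cmod (f x))\<^sup>2)"

type_synonym 'x op = "('x \<Rightarrow> complex) \<Rightarrow> ('x \<Rightarrow> complex)"

text \<open>
  Operators on \<open>\<ell>\<^sub>2(X)\<close> are functions that vanish outside \<open>ell2 X\<close>, so that equality of
  operators is equality of functions and the product of operators is composition.
\<close>

definition bounded_ops :: "'x set \<Rightarrow> 'x op set" where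
  "bounded_ops X = {T.
     (\<forall>f\<in>ell2 X. T f \<in> ell2 X) \<and> (\<forall>f. f \<notin> ell2 X \<longrightarrow> T f = (\<lambda>x. 0)) \<and>
     (\<forall>f\<in>ell2 X. \<forall>h\<in>ell2 X. T (\<lambda>x. f x + h x) = (\<lambda>x. T f x + T h x)) \<and>
     (\<forall>c. \<forall>f\<in>ell2 X. T (\<lambda>x. c * f x) = (\<lambda>x. c * T f x)) \<and>
     (\<exists>C. \<forall>f\<in>ell2 X. ell2_norm X (T f) \<le> C * ell2_norm X f)}"

definition op_norm :: "'x set \<Rightarrow> 'x op \<Rightarrow> real" where
  "op_norm X T = (SUP f\<in>{f \<in> ell2 X. ell2_norm X f \<le> 1}. ell2_norm X (T f))"

definition positive_op :: "'x set \<Rightarrow> 'x op \<Rightarrow> bool" where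
  "positive_op X T \<longleftrightarrow> T \<in> bounded_ops X \<and> (\<forall>f\<in>ell2 X. ell2_inner X f (T f) \<in> \<real>\<^sub>\<ge>\<^sub>0)"

definition op_spectrum :: "'x set \<Rightarrow> 'x op \<Rightarrow> complex set" where
  "op_spectrum X T = {z. \<not> (\<exists>S\<in>bounded_ops X. \<forall>f\<in>ell2 X.
     S (\<lambda>x. T f x - z * f x) = f \<and> (\<lambda>x. T (S f) x - z * S f x) = f)}"

definition op_poly :: "'x set \<Rightarrow> real poly \<Rightarrow> 'x op \<Rightarrow> 'x op" where
  "op_poly X p T = (\<lambda>f x. if f \<in> ell2 X
     then (\<Sum>i\<le>degree p. complex_of_real (coeff p i) * (T ^^ i) f x) else 0)"

text \<open>
  Continuous functional calculus of a self-adjoint operator \<open>T\<close>: \<open>\<phi>(T)\<close> is the norm limit of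
  \<open>p\<^sub>n(T)\<close> for all real polynomials \<open>p\<^sub>n\<close> converging to \<open>\<phi>\<close> uniformly on the (real) spectrum.
\<close>

definition op_fun :: "'x set \<Rightarrow> (real \<Rightarrow> real) \<Rightarrow> 'x op \<Rightarrow> 'x op" where
  "op_fun X \<phi> T = (THE S. S \<in> bounded_ops X \<and>
     (\<forall>p. uniform_limit {t. complex_of_real t \<in> op_spectrum X T} (\<lambda>n. poly (p n)) \<phi> sequentially
        \<longrightarrow> (\<lambda>n. op_norm X (\<lambda>f x. op_poly X (p n) T f x - S f x)) \<longlonglongrightarrow> 0))"


section \<open>The group algebra inside the group von Neumann algebra\<close>

definition left_regular :: "('g, 'm) monoid_scheme \<Rightarrow> 'g \<Rightarrow> 'g op" where
  "left_regular G g = (\<lambda>f h. if f \<in> ell2 (carrier G) \<and> h \<in> carrier G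
     then f (inv\<^bsub>G\<^esub> g \<otimes>\<^bsub>G\<^esub> h) else 0)"

definition lin_comb :: "('g, 'm) monoid_scheme \<Rightarrow> 'g set \<Rightarrow> ('g \<Rightarrow> complex) \<Rightarrow> 'g op" where
  "lin_comb G F c = (\<lambda>f h. \<Sum>g\<in>F. c g * left_regular G g f h)"

definition group_algebra :: "('g, 'm) monoid_scheme \<Rightarrow> 'g op set" where
  "group_algebra G = {lin_comb G F c | F c. finite F \<and> F \<subseteq> carrier G}"

definition delta :: "'g \<Rightarrow> 'g \<Rightarrow> complex" where
  "delta g = (\<lambda>h. if h = g then 1 else 0)"

definition canonical_trace :: "('g, 'm) monoid_scheme \<Rightarrow> 'g op \<Rightarrow> complex" where
  "canonical_trace G T = ell2_inner (carrier G) (delta \<one>\<^bsub>G\<^esub>) (T (delta \<one>\<^bsub>G\<^esub>))"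

text \<open>
  The coefficient of \<open>\<lambda>\<^sub>g\<close> in an element \<open>x\<close> of the group algebra is \<open>(x \<delta>\<^sub>e)(g)\<close>; the linear
  map below sends \<open>\<lambda>\<^sub>g\<close> to \<open>\<psi>(g) \<lambda>\<^sub>g\<close>. It is meaningful on the group algebra only.
\<close>

definition multiplier ::
    "('g, 'm) monoid_scheme \<Rightarrow> ('g \<Rightarrow> complex) \<Rightarrow> 'g op \<Rightarrow> 'g op" where
  "multiplier G \<psi> x =
     (let c = x (delta \<one>\<^bsub>G\<^esub>)
      in lin_comb G {g \<in> carrier G. c g \<noteq> 0} (\<lambda>g. \<psi> g * c g))"

definition length_generator :: "('g, 'm) monoid_scheme \<Rightarrow> 'g set \<Rightarrow> 'g op \<Rightarrow> 'g op" where
  "length_generator G S = multiplier G (\<lambda>g. of_nat (word_length G S g))"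

text \<open>
  \<open>\<tau>\<close> is real on self-adjoint operators, so taking real parts only changes the type. The value
  at \<open>t = 0\<close> of \<open>t * ln t\<close> is \<open>0\<close>, which is the convention \<open>0 log 0 = 0\<close>.
\<close>

definition Ent :: "('g, 'm) monoid_scheme \<Rightarrow> 'g op \<Rightarrow> real" where
  "Ent G a =
     Re (canonical_trace G (op_fun (carrier G) (\<lambda>t. t * ln t) a)) -
     Re (canonical_trace G a) * ln (Re (canonical_trace G a))"

end

theory Submission
  imports Defs "HOL-Computational_Algebra.Fundamental_Theorem_Algebra"
    "HOL-Real_Asymp.Real_Asymp"
begin

text \<open>
  Let \<open>c\<^sub>g\<close> be the coefficients of \<open>x\<close>, and put \<open>m = c\<^sub>e\<close>, \<open>a = \<Sum>\<^bsub>g\<noteq>e\<^esub> |c\<^sub>g|\<^sup>2\<close> and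
  \<open>D = \<Sum>\<^bsub>g\<noteq>e\<^esub> (|g| - 1) |c\<^sub>g|\<^sup>2\<close>, so that \<open>\<tau>(x\<^sup>2) = m\<^sup>2 + a\<close> and \<open>\<tau>(x L x) = a + D\<close>.
  The third-order Taylor polynomial of \<open>s\<^sup>2 ln s\<^sup>2\<close> at any \<open>c > 0\<close> majorises this function on the half
  line, which bounds \<open>\<tau>(x\<^sup>2 ln x\<^sup>2)\<close> by a combination of \<open>\<tau>(x)\<close>, \<open>\<tau>(x\<^sup>2)\<close> and \<open>\<tau>(x\<^sup>3)\<close>.
  In a tree each pair \<open>g, h\<close> spans a tripod, and the Cauchy--Schwarz inequality yields
  \<open>\<tau>(x\<^sup>3) \<le> m\<^sup>3 + 3 m a + 3 a \<surd>D + \<surd>D\<^sup>3\<close>. With \<open>c = m + \<surd>D\<close> and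
  \<open>ln (c\<^sup>2 / \<tau>(x\<^sup>2)) \<le> c\<^sup>2 / \<tau>(x\<^sup>2) - 1\<close> everything collapses to \<open>2 (a + D)\<close>.
\<close>

section \<open>The real Hilbert space of square-summable functions\<close>

text \<open>Degree three is what both sides allow. The fourth derivative of s^2 ln s^2 is -4 / s^2,
  so the Taylor polynomial of odd order three is a global majorant; and the third moment is the
  lowest one in which the cancellation of words matters. The bound for the third moment has m + sqrt
  D as a factor, which is why dividing it by c = m + sqrt D in the cubic Taylor term leaves a
  quadratic expression. The analytic obstacle is that \<open>op_fun\<close> is a definite
  description. Before anything can be compared with it, polynomials that converge uniformly on the
  spectrum must be shown to converge in operator norm, with a limit independent of their choice.
  This rests on bounding the norm of p(T) by the supremum of |p| on the spectrum, and that bound is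
  obtained without spectral measures: all polynomials are real, so a real Hilbert space and the
  factorisation of real polynomials into linear and quadratic factors suffice. The majorant contains
  odd powers, so the comparison takes place in terms of x and not of its square.\<close>

lemma summable_cnj_mult:
  fixes f g :: "'x \<Rightarrow> complex"
  assumes "(\<lambda>x. (cmod (f x))\<^sup>2) summable_on X" "(\<lambda>x. (cmod (g x))\<^sup>2) summable_on X"
  shows "(\<lambda>x. cnj (f x) * g x) summable_on X"
proof -
  have "(\<lambda>x. (cmod (f x))\<^sup>2 + (cmod (g x))\<^sup>2) summable_on X"
    by (intro summable_on_add assms)
  then have "(\<lambda>x. norm (cnj (f x) * g x)) summable_on X"
  proof (rule summable_on_comparison_test)
    fix x
    show "norm (cnj (f x) * g x) \<le> (cmod (f x))\<^sup>2 + (cmod (g x))\<^sup>2"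
      using sum_squares_bound[of "cmod (f x)" "cmod (g x)"]
        mult_nonneg_nonneg[OF norm_ge_zero[of "f x"] norm_ge_zero[of "g x"]]
      unfolding norm_mult complex_mod_cnj by linarith
  qed auto
  then show ?thesis by (rule abs_summable_summable)
qed

lemma summable_norm_add_sq:
  fixes f g :: "'x \<Rightarrow> complex"
  assumes "(\<lambda>x. (cmod (f x))\<^sup>2) summable_on X" "(\<lambda>x. (cmod (g x))\<^sup>2) summable_on X"
  shows "(\<lambda>x. (cmod (f x + g x))\<^sup>2) summable_on X"
proof -
  have "(\<lambda>x. 2 * (cmod (f x))\<^sup>2 + 2 * (cmod (g x))\<^sup>2) summable_on X"
    by (intro summable_on_add summable_on_cmult_right assms)
  then show ?thesis
  proof (rule summable_on_comparison_test)
    fix x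
    have "(cmod (f x + g x))\<^sup>2 \<le> (cmod (f x) + cmod (g x))\<^sup>2"
      by (intro power_mono norm_triangle_ineq) auto
    also have "\<dots> \<le> 2 * (cmod (f x))\<^sup>2 + 2 * (cmod (g x))\<^sup>2"
      using sum_squares_bound[of "cmod (f x)" "cmod (g x)"] by (simp add: power2_sum)
    finally show "(cmod (f x + g x))\<^sup>2 \<le> 2 * (cmod (f x))\<^sup>2 + 2 * (cmod (g x))\<^sup>2" .
  qed auto
qed

text \<open>The index set is the whole type, so that the classes \<open>real_inner\<close> and
  \<open>complete_space\<close> become available; \<open>ell2 X\<close> will reappear as the closed
  subspace \<open>l2_on X\<close>. The inner product below is the real part of the complex one, and
  multiplication by complex scalars is kept as the separate map \<open>cscale\<close>.\<close>

typedef 'x l2 = "{f :: 'x \<Rightarrow> complex. (\<lambda>x. (cmod (f x))\<^sup>2) summable_on UNIV}"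
  morphisms fun_l2 Abs_l2
  by (rule exI[of _ "\<lambda>_. 0"]) simp

setup_lifting type_definition_l2

lemma summable_fun_l2: "(\<lambda>x. (cmod (fun_l2 f x))\<^sup>2) summable_on UNIV"
  using fun_l2[of f] by simp

lemma fun_l2_eqI: "(\<And>x. fun_l2 f x = fun_l2 g x) \<Longrightarrow> f = g"
  by (metis ext fun_l2_inject)

lift_definition cscale :: "complex \<Rightarrow> 'x l2 \<Rightarrow> 'x l2" is "\<lambda>c f x. c * f x"
  by (simp add: norm_mult power_mult_distrib summable_on_cmult_right)

instantiation l2 :: (type) real_vector
begin

lift_definition zero_l2 :: "'a l2" is "\<lambda>_. 0" by simp
lift_definition plus_l2 :: "'a l2 \<Rightarrow> 'a l2 \<Rightarrow> 'a l2" is "\<lambda>f g x. f x + g x"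
  by (rule summable_norm_add_sq)
lift_definition uminus_l2 :: "'a l2 \<Rightarrow> 'a l2" is "\<lambda>f x. - f x" by simp
definition minus_l2 :: "'a l2 \<Rightarrow> 'a l2 \<Rightarrow> 'a l2" where "minus_l2 f g = f + - g"
definition scaleR_l2 :: "real \<Rightarrow> 'a l2 \<Rightarrow> 'a l2" where "scaleR_l2 r f = cscale (of_real r) f"

instance
proof
  fix f g h :: "'a l2" and r s :: real
  note rep = minus_l2_def scaleR_l2_def plus_l2.rep_eq zero_l2.rep_eq uminus_l2.rep_eq cscale.rep_eq
  show "f + g + h = f + (g + h)" "f + g = g + f" "0 + f = f" "- f + f = 0" "f - g = f + - g"
    "r *\<^sub>R (f + g) = r *\<^sub>R f + r *\<^sub>R g" "(r + s) *\<^sub>R f = r *\<^sub>R f + s *\<^sub>R f"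
    "r *\<^sub>R s *\<^sub>R f = (r * s) *\<^sub>R f" "1 *\<^sub>R f = f"
    by (rule fun_l2_eqI, simp add: rep ring_distribs)+
qed

end

lemma fun_l2_simps [simp]:
  "fun_l2 0 x = 0" "fun_l2 (f + g) x = fun_l2 f x + fun_l2 g x"
  "fun_l2 (- f) x = - fun_l2 f x" "fun_l2 (f - g) x = fun_l2 f x - fun_l2 g x"
  "fun_l2 (r *\<^sub>R f) x = of_real r * fun_l2 f x" "fun_l2 (cscale c f) x = c * fun_l2 f x"
  unfolding minus_l2_def scaleR_l2_def plus_l2.rep_eq zero_l2.rep_eq uminus_l2.rep_eq cscale.rep_eq
  by simp_all

lemma summable_inner_l2:
  "(\<lambda>x. Re (cnj (fun_l2 f x) * fun_l2 g x)) summable_on UNIV"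
  by (intro summable_on_Re summable_cnj_mult summable_fun_l2)

lemma Re_cnj_mult_self: "Re (cnj z * z) = (cmod z)\<^sup>2"
  by (simp only: cmod_power2) (simp add: power2_eq_square)

instantiation l2 :: (type) real_inner
begin

definition inner_l2 :: "'a l2 \<Rightarrow> 'a l2 \<Rightarrow> real" where
  "inner_l2 f g = (\<Sum>\<^sub>\<infinity>x. Re (cnj (fun_l2 f x) * fun_l2 g x))"
definition norm_l2 :: "'a l2 \<Rightarrow> real" where "norm_l2 f = sqrt (inner f f)"
definition sgn_l2 :: "'a l2 \<Rightarrow> 'a l2" where "sgn_l2 f = f /\<^sub>R norm f"
definition dist_l2 :: "'a l2 \<Rightarrow> 'a l2 \<Rightarrow> real" where "dist_l2 f g = norm (f - g)"
definition uniformity_l2 :: "('a l2 \<times> 'a l2) filter" where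
  "uniformity_l2 = (INF e\<in>{0<..}. principal {(f, g). dist f g < e})"
definition open_l2 :: "'a l2 set \<Rightarrow> bool" where
  "open_l2 U \<longleftrightarrow> (\<forall>f\<in>U. eventually (\<lambda>(f', g). f' = f \<longrightarrow> g \<in> U) uniformity)"

instance
proof
  fix f g h :: "'a l2" and r :: real
  show "inner f g = inner g f"
    by (simp add: inner_l2_def mult.commute)
  show "inner (f + g) h = inner f h + inner g h"
    unfolding inner_l2_def
    unfolding infsum_add[OF summable_inner_l2 summable_inner_l2, symmetric]
    by (rule infsum_cong) (simp add: algebra_simps)
  show "inner (r *\<^sub>R f) g = r * inner f g"
    unfolding inner_l2_def
    by (subst infsum_cmult_right'[symmetric]) (auto intro!: infsum_cong simp: algebra_simps)
  show "0 \<le> inner f f"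
    unfolding inner_l2_def Re_cnj_mult_self by (rule infsum_nonneg) auto
  show "inner f f = 0 \<longleftrightarrow> f = 0"
  proof
    assume 0: "inner f f = 0"
    have "(cmod (fun_l2 f x))\<^sup>2 = 0" for x
      by (rule nonneg_infsum_le_0D[where A = UNIV])
        (use 0 in \<open>auto simp: inner_l2_def Re_cnj_mult_self summable_fun_l2 simp del: complex_cnj_mult times_complex.sel\<close>)
    then show "f = 0" by (auto intro: fun_l2_eqI)
  qed (simp add: inner_l2_def)
qed (simp_all add: norm_l2_def sgn_l2_def dist_l2_def uniformity_l2_def open_l2_def)

end

lemma norm_l2_sq: "(norm f)\<^sup>2 = (\<Sum>\<^sub>\<infinity>x. (cmod (fun_l2 f x))\<^sup>2)"
  unfolding dot_square_norm[of f, symmetric] inner_l2_def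
  by (simp only: Re_cnj_mult_self)

lemma sum_le_norm_l2_sq: "finite F \<Longrightarrow> (\<Sum>x\<in>F. (cmod (fun_l2 f x))\<^sup>2) \<le> (norm f)\<^sup>2"
  unfolding norm_l2_sq by (rule finite_sum_le_infsum[OF summable_fun_l2]) auto

lemma cmod_fun_l2_le: "cmod (fun_l2 f x) \<le> norm f"
  using sum_le_norm_l2_sq[of "{x}" f] by (simp add: power2_le_iff_abs_le)

lemma norm_l2_le:
  assumes "0 \<le> c" "\<And>F. finite F \<Longrightarrow> (\<Sum>x\<in>F. (cmod (fun_l2 f x))\<^sup>2) \<le> c\<^sup>2"
  shows "norm f \<le> c"
proof -
  have "(norm f)\<^sup>2 \<le> c\<^sup>2"
    unfolding norm_l2_sq by (rule infsum_le_finite_sums[OF summable_fun_l2]) (use assms in auto)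
  then show ?thesis using assms(1) by (rule power2_le_imp_le)
qed

instance l2 :: (type) complete_space
proof
  fix X :: "nat \<Rightarrow> 'a l2" assume X: "Cauchy X"
  have C: "Cauchy (\<lambda>n. fun_l2 (X n) x)" for x
  proof (rule CauchyI)
    fix e :: real assume "0 < e"
    then obtain M where M: "\<And>m n. m \<ge> M \<Longrightarrow> n \<ge> M \<Longrightarrow> norm (X m - X n) < e"
      using CauchyD[OF X] by blast
    show "\<exists>M. \<forall>m\<ge>M. \<forall>n\<ge>M. norm (fun_l2 (X m) x - fun_l2 (X n) x) < e"
      using M cmod_fun_l2_le[of "X _ - X _" x] by (metis fun_l2_simps(4) le_less_trans)
  qed
  define g where "g x = lim (\<lambda>n. fun_l2 (X n) x)" for x
  have g: "(\<lambda>n. fun_l2 (X n) x) \<longlonglongrightarrow> g x" for x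
    unfolding g_def using C[of x] by (simp add: Cauchy_convergent_iff convergent_LIMSEQ_iff)
  \<comment> \<open>A bound on finite partial sums passes to the pointwise limit. Being uniform in
    \<open>F\<close>, it gives both the square-summability of \<open>g\<close> and the convergence
    in norm.\<close>
  have lim: "(\<Sum>x\<in>F. (cmod (fun_l2 h x - g x))\<^sup>2) \<le> e\<^sup>2"
    if "finite F" "\<And>n. n \<ge> M \<Longrightarrow> norm (h - X n) \<le> e" for F h e M
  proof (rule LIMSEQ_le_const2)
    show "(\<lambda>n. \<Sum>x\<in>F. (cmod (fun_l2 h x - fun_l2 (X n) x))\<^sup>2) \<longlonglongrightarrow> (\<Sum>x\<in>F. (cmod (fun_l2 h x - g x))\<^sup>2)"
      by (intro tendsto_intros g)
    have "(\<Sum>x\<in>F. (cmod (fun_l2 h x - fun_l2 (X n) x))\<^sup>2) \<le> e\<^sup>2" if "n \<ge> M" for n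
    proof -
      have "(norm (h - X n))\<^sup>2 \<le> e\<^sup>2"
        using \<open>\<And>n. n \<ge> M \<Longrightarrow> norm (h - X n) \<le> e\<close>[OF that] by (simp add: power_mono)
      then show ?thesis using sum_le_norm_l2_sq[OF \<open>finite F\<close>, of "h - X n"] by simp
    qed
    then show "\<exists>N. \<forall>n\<ge>N. (\<Sum>x\<in>F. (cmod (fun_l2 h x - fun_l2 (X n) x))\<^sup>2) \<le> e\<^sup>2" by blast
  qed
  obtain M where M: "\<And>m n. m \<ge> M \<Longrightarrow> n \<ge> M \<Longrightarrow> norm (X m - X n) < 1"
    using CauchyD[OF X, of 1] by auto
  have "(\<lambda>x. (cmod (fun_l2 (X M) x - g x))\<^sup>2) summable_on UNIV"
  proof (rule nonneg_bdd_above_summable_on)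
    show "bdd_above (sum (\<lambda>x. (cmod (fun_l2 (X M) x - g x))\<^sup>2) ` {F. F \<subseteq> UNIV \<and> finite F})"
    proof (rule bdd_aboveI2)
      fix F :: "'a set" assume "F \<in> {F. F \<subseteq> UNIV \<and> finite F}"
      then show "(\<Sum>x\<in>F. (cmod (fun_l2 (X M) x - g x))\<^sup>2) \<le> 1\<^sup>2"
        using less_imp_le[OF M[of M]] by (intro lim[of _ M]) auto
    qed
  qed auto
  then have "(\<lambda>x. (cmod (fun_l2 (X M) x + - (fun_l2 (X M) x - g x)))\<^sup>2) summable_on UNIV"
    by (intro summable_norm_add_sq summable_fun_l2) (simp add: norm_minus_commute)
  then have sg: "(\<lambda>x. (cmod (g x))\<^sup>2) summable_on UNIV" by simp
  then have rg: "fun_l2 (Abs_l2 g) = g" by (simp add: Abs_l2_inverse)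
  have "X \<longlonglongrightarrow> Abs_l2 g"
  proof (rule metric_LIMSEQ_I)
    fix e :: real assume "0 < e"
    then obtain M where M: "\<And>m n. m \<ge> M \<Longrightarrow> n \<ge> M \<Longrightarrow> norm (X m - X n) < e / 2"
      using CauchyD[OF X, of "e / 2"] by auto
    have "norm (X n - Abs_l2 g) \<le> e / 2" if "n \<ge> M" for n
    proof (rule norm_l2_le)
      fix F :: "'a set" assume "finite F"
      then show "(\<Sum>x\<in>F. (cmod (fun_l2 (X n - Abs_l2 g) x))\<^sup>2) \<le> (e / 2)\<^sup>2"
        using lim[of F M "X n" "e / 2"] less_imp_le[OF M[OF that]] by (simp add: rg)
    qed (use \<open>0 < e\<close> in simp)
    moreover have "e / 2 < e" using \<open>0 < e\<close> by simp
    ultimately have "\<forall>n\<ge>M. dist (X n) (Abs_l2 g) < e"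
      unfolding dist_norm by (meson le_less_trans)
    then show "\<exists>no. \<forall>n\<ge>no. dist (X n) (Abs_l2 g) < e" by blast
  qed
  then show "convergent X" by (rule convergentI)
qed

section \<open>Self-adjoint operators and their approximate spectrum\<close>

definition papp :: "real poly \<Rightarrow> ('h \<Rightarrow> 'h) \<Rightarrow> 'h \<Rightarrow> 'h::real_vector" where
  "papp p T f = (\<Sum>i\<le>degree p. coeff p i *\<^sub>R (T ^^ i) f)"

lemma papp_altdef:
  assumes "degree p \<le> n"
  shows "papp p T f = (\<Sum>i\<le>n. coeff p i *\<^sub>R (T ^^ i) f)"
  unfolding papp_def using assms
  by (intro sum.mono_neutral_left) (auto simp: coeff_eq_0)

lemma papp_0 [simp]: "papp 0 T f = 0"
  by (simp add: papp_def)

lemma papp_add: "papp (p + q) T f = papp p T f + papp q T f"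
  using papp_altdef[of p "max (degree p) (degree q)" T f]
    papp_altdef[of q "max (degree p) (degree q)" T f]
    papp_altdef[of "p + q" "max (degree p) (degree q)" T f] degree_add_le_max[of p q]
  by (simp add: scaleR_add_left sum.distrib)

lemma papp_smult: "papp (smult c p) T f = c *\<^sub>R papp p T f"
  using papp_altdef[of "smult c p" "degree p" T f] degree_smult_le[of c p]
  by (simp add: papp_def scaleR_sum_right)

lemma papp_minus: "papp (p - q) T f = papp p T f - papp q T f"
proof -
  have "p - q = p + smult (-1) q" by simp
  then show ?thesis by (simp only: papp_add papp_smult) simp
qed

lemma papp_pCons:
  assumes "linear T"
  shows "papp (pCons a p) T f = a *\<^sub>R f + T (papp p T f)"
proof -
  interpret linear T by fact
  have "papp (pCons a p) T f = (\<Sum>i\<le>Suc (degree p). coeff (pCons a p) i *\<^sub>R (T ^^ i) f)"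
    by (rule papp_altdef) (simp add: degree_pCons_le)
  also have "\<dots> = a *\<^sub>R f + T (papp p T f)"
    by (subst sum.atMost_Suc_shift) (simp add: papp_def sum scaleR)
  finally show ?thesis .
qed

lemma papp_const [simp]: "papp [:c:] T f = c *\<^sub>R f"
  by (simp add: papp_def)

lemma linear_papp:
  assumes "linear T"
  shows "linear (papp p T)"
proof (induction p)
  case 0
  show ?case by (auto intro: linearI)
next
  case (pCons a p)
  interpret T: linear T by fact
  interpret P: linear "papp p T" by fact
  show ?case
    by (auto intro!: linearI simp: papp_pCons[OF assms] algebra_simps T.add T.scaleR P.add P.scaleR)
qed

lemma papp_mult:
  assumes "linear T"
  shows "papp (p * q) T f = papp p T (papp q T f)"
  by (induction p) (simp_all add: papp_pCons[OF assms] papp_add papp_smult)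

lemma papp_pcompose_square:
  assumes "linear T"
  shows "papp (pcompose p [:0, 0, 1:]) T f = papp p (\<lambda>f. T (T f)) f"
proof (induction p)
  case (pCons a p)
  have "linear (\<lambda>f. T (T f))"
    using linear_compose[OF assms assms] by (simp add: o_def)
  then show ?case
    using pCons assms by (simp add: pcompose_pCons papp_add papp_mult papp_pCons linear_0)
qed simp

text \<open>A complex root z = a + ib cannot be real, and the quadratic is its minimal polynomial
  over the reals. The remainder of the division has degree below two and vanishes at the non-real z,
  hence it is zero.\<close>

lemma real_poly_quadratic_factor:
  fixes p :: "real poly"
  assumes "degree p > 0" "\<And>t. poly p t \<noteq> 0"
  obtains a b q where "b \<noteq> 0" "p = [:a\<^sup>2 + b\<^sup>2, -2 * a, 1:] * q"
proof -
  let ?P = "map_poly complex_of_real p"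
  have ev: "poly (map_poly complex_of_real r) (complex_of_real t) = of_real (poly r t)" for r t
    by (induction r) (simp_all add: map_poly_pCons)
  have "degree ?P = degree p" by (simp add: degree_map_poly)
  then have "\<not> constant (poly ?P)"
    using assms(1) by (simp add: constant_degree)
  then obtain z where z: "poly ?P z = 0"
    using fundamental_theorem_of_algebra by blast
  define a b where "a = Re z" and "b = Im z"
  have b: "b \<noteq> 0"
  proof
    assume "b = 0"
    then have "z = of_real a" by (simp add: a_def b_def complex_eq_iff)
    then show False using z ev assms(2) by simp
  qed
  let ?Q = "[:a\<^sup>2 + b\<^sup>2, -2 * a, 1:]"
  have map_add: "map_poly complex_of_real (r + s) = map_poly of_real r + map_poly of_real s" for r s
    by (rule poly_eqI) (simp add: coeff_map_poly)
  have map_mult: "map_poly complex_of_real (r * s) = map_poly of_real r * map_poly of_real s" for r s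
    by (rule poly_eqI) (simp add: coeff_map_poly coeff_mult)
  have Qz: "poly (map_poly complex_of_real ?Q) z = 0"
    by (simp add: map_poly_pCons complex_eq_iff a_def b_def power2_eq_square algebra_simps)
  define r where "r = p mod ?Q"
  have "poly (map_poly complex_of_real (p div ?Q * ?Q + r)) z = 0"
    unfolding r_def div_mult_mod_eq by (rule z)
  then have rz: "poly (map_poly complex_of_real r) z = 0"
    by (simp only: map_add map_mult poly_add poly_mult Qz) simp
  have "r = 0 \<or> degree r < degree ?Q"
    unfolding r_def by (rule degree_mod_less) simp
  then have "degree r < 2" by auto
  then have "r = [:coeff r 0, coeff r 1:]"
    by (intro poly_eqI) (simp add: coeff_pCons coeff_eq_0 split: nat.split)
  then obtain c d where r: "r = [:c, d:]" by blast
  have "r = 0"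
    using rz b by (auto simp: r map_poly_pCons complex_eq_iff a_def b_def)
  then have "p = ?Q * (p div ?Q)"
    using div_mult_mod_eq[of p ?Q] by (simp add: r_def mult.commute)
  then show thesis using that b by blast
qed

text \<open>The negation says that there are approximate null vectors of \<open>S\<close> in
  \<open>V\<close>. The notion stands in for invertibility and, unlike it, asks for no inverse to be
  constructed.\<close>

definition bdd_below_on :: "'h::real_normed_vector set \<Rightarrow> ('h \<Rightarrow> 'h) \<Rightarrow> bool" where
  "bdd_below_on V S \<longleftrightarrow> (\<exists>\<epsilon>>0. \<forall>f\<in>V. \<epsilon> * norm f \<le> norm (S f))"

lemma bdd_below_on_compose:
  assumes "bdd_below_on V R" "bdd_below_on V S" "\<And>f. f \<in> V \<Longrightarrow> S f \<in> V"
  shows "bdd_below_on V (\<lambda>f. R (S f))"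
proof -
  obtain d e where de: "d > 0" "e > 0" "\<And>f. f \<in> V \<Longrightarrow> d * norm f \<le> norm (R f)"
    "\<And>f. f \<in> V \<Longrightarrow> e * norm f \<le> norm (S f)"
    using assms(1,2) unfolding bdd_below_on_def by blast
  have "d * e * norm f \<le> norm (R (S f))" if "f \<in> V" for f
  proof -
    have "d * (e * norm f) \<le> d * norm (S f)"
      using de that by (intro mult_left_mono) auto
    also have "\<dots> \<le> norm (R (S f))" using de assms(3) that by blast
    finally show ?thesis by (simp add: mult.assoc)
  qed
  then show ?thesis
    unfolding bdd_below_on_def using de by (intro exI[of _ "d * e"]) auto
qed

lemma bdd_below_on_coercive:
  fixes S :: "'h::real_inner \<Rightarrow> 'h"
  assumes "\<epsilon> > 0" "\<And>f. f \<in> V \<Longrightarrow> \<epsilon> * (norm f)\<^sup>2 \<le> inner f (S f)"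
  shows "bdd_below_on V S"
  unfolding bdd_below_on_def
proof (intro exI conjI ballI)
  fix f assume f: "f \<in> V"
  show "\<epsilon> * norm f \<le> norm (S f)"
  proof (cases "f = 0")
    case False
    have "norm f * (\<epsilon> * norm f) \<le> norm f * norm (S f)"
      using assms(2)[OF f] norm_cauchy_schwarz[of f "S f"] by (simp add: power2_eq_square algebra_simps)
    then show ?thesis using False by simp
  qed simp
qed fact

text \<open>The Lax--Milgram argument: for large \<open>M\<close> the map \<open>f \<mapsto> f - (R f - g) / M\<close> is a contraction.\<close>

lemma coercive_surj:
  fixes R :: "'h::{real_inner, complete_space} \<Rightarrow> 'h"
  assumes V: "subspace V" "closed V" and R: "bounded_linear R" "\<And>f. f \<in> V \<Longrightarrow> R f \<in> V"
    and "\<epsilon> > 0" and coercive: "\<And>f. f \<in> V \<Longrightarrow> \<epsilon> * (norm f)\<^sup>2 \<le> inner f (R f)"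
    and g: "g \<in> V"
  shows "\<exists>f\<in>V. R f = g"
proof -
  interpret R: bounded_linear R by fact
  obtain K where K: "K > 0" "\<And>f. norm (R f) \<le> norm f * K"
    using R.pos_bounded by blast
  \<comment> \<open>The first bound makes the quadratic term s^2 |R f|^2 use up at most half of the
    gain 2 s \<epsilon> |f|^2; the second keeps 1 - s \<epsilon> positive, so that its square root
    is a contraction constant.\<close>
  define s where "s = min (\<epsilon> / K\<^sup>2) (1 / (2 * \<epsilon>))"
  have s: "s > 0" "s * K\<^sup>2 \<le> \<epsilon>" "s * \<epsilon> < 1"
  proof -
    show "s > 0" using K \<open>\<epsilon> > 0\<close> by (simp add: s_def)
    have "s \<le> \<epsilon> / K\<^sup>2" by (simp add: s_def)
    then show "s * K\<^sup>2 \<le> \<epsilon>" using K by (simp add: field_simps)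
    have "s \<le> 1 / (2 * \<epsilon>)" by (simp add: s_def)
    then have "s * \<epsilon> \<le> 1 / 2" using \<open>\<epsilon> > 0\<close> by (simp add: field_simps)
    then show "s * \<epsilon> < 1" by simp
  qed
  have contr: "norm (f - s *\<^sub>R R f) \<le> sqrt (1 - s * \<epsilon>) * norm f" if f: "f \<in> V" for f
  proof (rule power2_le_imp_le)
    have "(norm (R f))\<^sup>2 \<le> (norm f * K)\<^sup>2"
      using K by (intro power_mono) auto
    then have "s * s * (norm (R f))\<^sup>2 \<le> s * (s * K\<^sup>2) * (norm f)\<^sup>2"
      using s(1) by (simp add: power_mult_distrib algebra_simps)
    also have "\<dots> \<le> s * \<epsilon> * (norm f)\<^sup>2"
      using s by (intro mult_right_mono mult_left_mono) auto
    finally have 1: "s * s * (norm (R f))\<^sup>2 \<le> s * \<epsilon> * (norm f)\<^sup>2" .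
    have 2: "s * (\<epsilon> * (norm f)\<^sup>2) \<le> s * inner f (R f)"
      using s coercive[OF f] by (intro mult_left_mono) auto
    have "(norm (f - s *\<^sub>R R f))\<^sup>2 = (norm f)\<^sup>2 - 2 * s * inner f (R f) + s * s * (norm (R f))\<^sup>2"
      by (simp add: power2_norm_eq_inner algebra_simps inner_commute)
    also have "\<dots> \<le> (1 - s * \<epsilon>) * (norm f)\<^sup>2"
      using 1 2 by (simp add: algebra_simps)
    finally show "(norm (f - s *\<^sub>R R f))\<^sup>2 \<le> (sqrt (1 - s * \<epsilon>) * norm f)\<^sup>2"
      using s by (simp add: power_mult_distrib)
  qed (use s in auto)
  have "\<exists>!f\<in>V. f - s *\<^sub>R (R f - g) = f"
  proof (rule Banach_fix)
    show "complete V" using V by (simp add: complete_eq_closed)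
    show "V \<noteq> {}" using g by auto
    show "sqrt (1 - s * \<epsilon>) < 1" using s \<open>\<epsilon> > 0\<close> by simp
    show "(\<lambda>f. f - s *\<^sub>R (R f - g)) ` V \<subseteq> V"
      using V R g by (auto intro!: subspace_diff subspace_scale)
    fix f h assume fh: "f \<in> V" "h \<in> V"
    have "(f - s *\<^sub>R (R f - g)) - (h - s *\<^sub>R (R h - g)) = (f - h) - s *\<^sub>R R (f - h)"
      by (simp add: R.diff algebra_simps)
    then have "norm ((f - s *\<^sub>R (R f - g)) - (h - s *\<^sub>R (R h - g))) \<le> sqrt (1 - s * \<epsilon>) * norm (f - h)"
      using contr[of "f - h"] fh V by (simp only: subspace_diff)
    then show "dist (f - s *\<^sub>R (R f - g)) (h - s *\<^sub>R (R h - g)) \<le> sqrt (1 - s * \<epsilon>) * dist f h"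
      by (simp only: dist_norm)
  qed (use s in simp)
  then obtain f where "f \<in> V" "f - s *\<^sub>R (R f - g) = f" by blast
  moreover from this(2) have "R f = g" using s(1) by simp
  ultimately show ?thesis by blast
qed

lemma norm_diff_scaleR_sq:
  "(norm (g - a *\<^sub>R f))\<^sup>2 = inner g g - 2 * a * inner f g + a\<^sup>2 * inner f f"
  unfolding power2_norm_eq_inner
  by (simp add: inner_diff_left inner_diff_right inner_commute[of g f] power2_eq_square
      right_diff_distrib)

text \<open>Invariance and symmetry are asked on \<open>V\<close> only, as the space of interest is
  a subspace of the type. \<open>nontrivial\<close> provides unit vectors, and through them a
  non-empty spectrum.\<close>

locale selfadjoint_op =
  fixes V :: "'h::{real_inner, complete_space} set" and T :: "'h \<Rightarrow> 'h"
  assumes subspace_V: "subspace V" and closed_V: "closed V" and nontrivial: "V \<noteq> {0}"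
    and bounded_linear: "bounded_linear T"
    and invariant: "f \<in> V \<Longrightarrow> T f \<in> V"
    and selfadjoint: "f \<in> V \<Longrightarrow> g \<in> V \<Longrightarrow> inner f (T g) = inner (T f) g"
begin

sublocale T: bounded_linear T by (rule bounded_linear)

lemma linear: "linear T" by (rule T.linear_axioms)

text \<open>The real approximate point spectrum of the restriction to \<open>V\<close>.\<close>

definition approx_spectrum :: "real set" where
  "approx_spectrum = {t. \<not> bdd_below_on V (\<lambda>f. T f - t *\<^sub>R f)}"

lemma papp_in: "f \<in> V \<Longrightarrow> papp p T f \<in> V"
  by (induction p)
    (auto simp: papp_pCons[OF linear] subspace_V subspace_0 intro!: subspace_add subspace_scale invariant)

lemma papp_selfadjoint:
  "f \<in> V \<Longrightarrow> g \<in> V \<Longrightarrow> inner f (papp p T g) = inner (papp p T f) g"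
proof (induction p arbitrary: f)
  case (pCons a p)
  have "inner f (T (papp p T g)) = inner (papp p T (T f)) g"
    using pCons.IH[of "T f"] pCons.prems by (simp add: selfadjoint papp_in invariant)
  also have "papp p T (T f) = T (papp p T f)"
    using papp_mult[OF linear, of p "[:0, 1:]" f] papp_mult[OF linear, of "[:0, 1:]" p f]
    by (simp add: mult.commute papp_pCons[OF linear] T.zero)
  finally show ?case
    using pCons.IH[of f] pCons.prems
    by (simp add: papp_pCons[OF linear] inner_right_distrib inner_left_distrib)
qed simp

lemma papp_bounded: "\<exists>K\<ge>0. \<forall>f. norm (papp p T f) \<le> K * norm f"
proof (induction p)
  case (pCons a p)
  then obtain K where K: "K \<ge> 0" "\<And>f. norm (papp p T f) \<le> K * norm f" by blast
  obtain M where M: "M > 0" "\<And>f. norm (T f) \<le> norm f * M" using T.pos_bounded by blast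
  have "norm (papp (pCons a p) T f) \<le> (\<bar>a\<bar> + K * M) * norm f" for f
  proof -
    have "norm (papp (pCons a p) T f) \<le> norm (a *\<^sub>R f) + norm (T (papp p T f))"
      unfolding papp_pCons[OF linear] by (rule norm_triangle_ineq)
    also have "norm (T (papp p T f)) \<le> norm (papp p T f) * M" by (rule M)
    also have "\<dots> \<le> K * norm f * M" using K M by (intro mult_right_mono) auto
    finally show ?thesis by (simp add: algebra_simps)
  qed
  then show ?case using K M by (intro exI[of _ "\<bar>a\<bar> + K * M"]) auto
qed (auto intro: exI[of _ 0])

text \<open>One half of the spectral mapping theorem, by splitting off factors of \<open>p\<close>.
  A linear factor with root t is bounded below because t is not in the approximate spectrum. For a
  quadratic factor with roots a + ib and a - ib, the quadratic form is |(T - a) f|^2 + b^2 |f|^2 by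
  self-adjointness, hence coercive.\<close>

lemma papp_bdd_below:
  assumes "p \<noteq> 0" "\<And>t. poly p t = 0 \<Longrightarrow> t \<notin> approx_spectrum"
  shows "bdd_below_on V (papp p T)"
  using assms
proof (induction "degree p" arbitrary: p rule: less_induct)
  case less
  show ?case
  proof (cases "degree p = 0")
    case True
    then obtain c where p: "p = [:c:]" by (rule degree_eq_zeroE)
    then show ?thesis using less.prems(1) unfolding bdd_below_on_def
      by (intro exI[of _ "\<bar>c\<bar>"]) auto
  next
    case False
    obtain r q where rq: "p = r * q" "degree q < degree p" "bdd_below_on V (papp r T)"
    proof (cases "\<exists>t. poly p t = 0")
      case True
      then obtain t where t: "poly p t = 0" by blast
      then obtain q where q: "p = [:-t, 1:] * q"
        unfolding poly_eq_0_iff_dvd by (rule dvdE)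
      have "degree q < degree p"
        using less.prems(1) unfolding q by (subst degree_mult_eq) auto
      moreover have "papp [:-t, 1:] T = (\<lambda>f. T f - t *\<^sub>R f)"
        by (auto simp: papp_pCons[OF linear] T.zero)
      then have "bdd_below_on V (papp [:-t, 1:] T)"
        using less.prems(2)[OF t] by (simp add: approx_spectrum_def)
      ultimately show ?thesis using that q by blast
    next
      case False
      then obtain a b q where q: "b \<noteq> 0" "p = [:a\<^sup>2 + b\<^sup>2, -2 * a, 1:] * q"
        using real_poly_quadratic_factor[of p] \<open>degree p \<noteq> 0\<close> by blast
      have "degree q < degree p"
        using less.prems(1) unfolding q(2) by (subst degree_mult_eq) auto
      moreover have "bdd_below_on V (papp [:a\<^sup>2 + b\<^sup>2, -2 * a, 1:] T)"
      proof (rule bdd_below_on_coercive[of "b\<^sup>2"])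
        fix f assume f: "f \<in> V"
        have P: "papp [:a\<^sup>2 + b\<^sup>2, -2 * a, 1:] T f = (a\<^sup>2 + b\<^sup>2) *\<^sub>R f - (2 * a) *\<^sub>R T f + T (T f)"
          by (simp add: papp_pCons[OF linear] T.zero T.add T.scaleR T.diff)
        have "inner f (papp [:a\<^sup>2 + b\<^sup>2, -2 * a, 1:] T f) =
            (a\<^sup>2 + b\<^sup>2) * inner f f - 2 * a * inner f (T f) + inner (T f) (T f)"
          by (simp only: P inner_add_right inner_diff_right inner_scaleR_right
              selfadjoint[OF f invariant[OF f]])
        also have "\<dots> = (norm (T f - a *\<^sub>R f))\<^sup>2 + b\<^sup>2 * (norm f)\<^sup>2"
          unfolding norm_diff_scaleR_sq dot_square_norm[of f] by (simp add: distrib_right)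
        finally have "inner f (papp [:a\<^sup>2 + b\<^sup>2, -2 * a, 1:] T f) =
            (norm (T f - a *\<^sub>R f))\<^sup>2 + b\<^sup>2 * (norm f)\<^sup>2" .
        then show "b\<^sup>2 * (norm f)\<^sup>2 \<le> inner f (papp [:a\<^sup>2 + b\<^sup>2, -2 * a, 1:] T f)" by simp
      qed (use q in simp)
      ultimately show ?thesis using that q by blast
    qed
    have "bdd_below_on V (papp q T)"
      using less.prems rq by (intro less.hyps) auto
    then have "bdd_below_on V (\<lambda>f. papp r T (papp q T f))"
      using bdd_below_on_compose[OF rq(3), of "papp q T"] papp_in by blast
    moreover have "papp p T = (\<lambda>f. papp r T (papp q T f))"
      by (rule ext) (simp add: rq(1) papp_mult[OF linear])
    ultimately show ?thesis by simp
  qed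
qed

text \<open>
  If \<open>\<mu>\<close> is the norm of the self-adjoint operator \<open>S = p(T)\<close>, then \<open>\<mu>\<^sup>2 - S\<^sup>2\<close> is not bounded
  below, since \<open>\<parallel>(\<mu>\<^sup>2 - S\<^sup>2) f\<parallel>\<^sup>2 \<le> \<mu>\<^sup>2 (\<mu>\<^sup>2 - \<parallel>S f\<parallel>\<^sup>2)\<close> for unit vectors \<open>f\<close>.
\<close>

lemma papp_norm_attained:
  obtains \<mu> where "\<mu> \<ge> 0" "\<And>f. f \<in> V \<Longrightarrow> norm (papp p T f) \<le> \<mu> * norm f"
    "\<not> bdd_below_on V (papp ([:\<mu>\<^sup>2:] - p * p) T)"
proof -
  let ?S = "papp p T"
  interpret S: linear ?S by (rule linear_papp[OF linear])
  define U where "U = {f \<in> V. norm f = 1}"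
  obtain f0 where f0: "f0 \<in> V" "f0 \<noteq> 0" using nontrivial subspace_0[OF subspace_V] by blast
  then have "(1 / norm f0) *\<^sub>R f0 \<in> U"
    by (simp add: U_def subspace_scale[OF subspace_V])
  then have U: "U \<noteq> {}" by blast
  obtain K where K: "\<And>f. norm (?S f) \<le> K * norm f" using papp_bounded by blast
  define \<mu> where "\<mu> = (SUP f\<in>U. norm (?S f))"
  have bdd: "bdd_above ((\<lambda>f. norm (?S f)) ` U)"
  proof (rule bdd_aboveI2)
    show "norm (?S f) \<le> K" if "f \<in> U" for f
      using K[of f] that by (simp add: U_def)
  qed
  have le: "norm (?S f) \<le> \<mu>" if "f \<in> U" for f
    unfolding \<mu>_def by (rule cSUP_upper[OF that bdd])
  have \<mu>0: "\<mu> \<ge> 0" using order_trans[OF norm_ge_zero le[OF \<open>_ \<in> U\<close>]] .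
  have bound: "norm (?S f) \<le> \<mu> * norm f" if "f \<in> V" for f
  proof (cases "f = 0")
    case False
    then have "(1 / norm f) *\<^sub>R f \<in> U"
      using that by (simp add: U_def subspace_scale[OF subspace_V])
    from le[OF this] show ?thesis using False by (simp add: S.scaleR field_simps)
  qed (simp add: S.zero)
  have "\<not> bdd_below_on V (papp ([:\<mu>\<^sup>2:] - p * p) T)"
  proof
    assume "bdd_below_on V (papp ([:\<mu>\<^sup>2:] - p * p) T)"
    then obtain e where e: "e > 0" "\<And>f. f \<in> V \<Longrightarrow> e * norm f \<le> norm (papp ([:\<mu>\<^sup>2:] - p * p) T f)"
      unfolding bdd_below_on_def by blast
    have key: "e\<^sup>2 \<le> \<mu>\<^sup>2 * (\<mu>\<^sup>2 - (norm (?S f))\<^sup>2)" if "f \<in> U" for f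
    proof -
      have f: "f \<in> V" "norm f = 1" using that by (auto simp: U_def)
      have "e\<^sup>2 \<le> (norm (\<mu>\<^sup>2 *\<^sub>R f - ?S (?S f)))\<^sup>2"
        using e(2)[OF f(1)] f(2) e(1)
        by (intro power_mono) (auto simp: papp_minus papp_mult[OF linear])
      also have "\<dots> = (norm (?S (?S f) - \<mu>\<^sup>2 *\<^sub>R f))\<^sup>2" by (simp only: norm_minus_commute)
      also have "\<dots> = \<mu>\<^sup>2 * \<mu>\<^sup>2 - 2 * \<mu>\<^sup>2 * inner f (?S (?S f)) + (norm (?S (?S f)))\<^sup>2"
        by (simp only: norm_diff_scaleR_sq dot_square_norm f(2)) (simp add: power2_eq_square)
      also have "inner f (?S (?S f)) = (norm (?S f))\<^sup>2"
        by (simp add: papp_selfadjoint[OF f(1) papp_in[OF f(1)]] power2_norm_eq_inner)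
      also have "(norm (?S (?S f)))\<^sup>2 \<le> (\<mu> * norm (?S f))\<^sup>2"
        by (intro power_mono bound papp_in f) auto
      finally show ?thesis by (simp add: power_mult_distrib algebra_simps)
    qed
    have "\<mu> \<noteq> 0"
      using key[OF \<open>_ \<in> U\<close>] e(1) by auto
    then have "\<mu> > 0" using \<mu>0 by simp
    \<comment> \<open>A gap below \<open>\<mu>\<close> that is the same for all unit vectors
      contradicts the choice of \<open>\<mu>\<close> as their supremum.\<close>
    have "norm (?S f) \<le> sqrt (\<mu>\<^sup>2 - e\<^sup>2 / \<mu>\<^sup>2)" if "f \<in> U" for f
    proof (rule real_le_rsqrt)
      have "e\<^sup>2 / \<mu>\<^sup>2 \<le> \<mu>\<^sup>2 - (norm (?S f))\<^sup>2"
        using key[OF that] \<open>\<mu> > 0\<close> by (subst pos_divide_le_eq) (auto simp: mult.commute)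
      then show "(norm (?S f))\<^sup>2 \<le> \<mu>\<^sup>2 - e\<^sup>2 / \<mu>\<^sup>2" by simp
    qed
    then have "\<mu> \<le> sqrt (\<mu>\<^sup>2 - e\<^sup>2 / \<mu>\<^sup>2)"
      by (subst (1) \<mu>_def) (rule cSUP_least[OF U])
    also have "\<dots> < sqrt (\<mu>\<^sup>2)"
      using e(1) \<open>\<mu> > 0\<close> by (intro real_sqrt_less_mono) simp
    finally show False using \<mu>0 by simp
  qed
  with \<mu>0 bound that show thesis by blast
qed

text \<open>For p = X the polynomial \<open>\<mu>\<^sup>2\<close> - X^2 is never zero, so it must
  have a root in the approximate spectrum. Non-emptiness is what covers constant polynomials in the
  norm bound below.\<close>

lemma approx_spectrum_nonempty: "approx_spectrum \<noteq> {}"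
proof
  assume empty: "approx_spectrum = {}"
  obtain \<mu> where "\<not> bdd_below_on V (papp ([:\<mu>\<^sup>2:] - [:0, 1:] * [:0, 1:]) T)"
    using papp_norm_attained[of "[:0, 1:]"] by blast
  moreover have "[:\<mu>\<^sup>2:] - [:0, 1:] * [:0, 1:] \<noteq> (0 :: real poly)" by simp
  ultimately show False using papp_bdd_below empty by blast
qed

text \<open>With \<open>\<mu>\<close> the norm of p(T) on \<open>V\<close>, the polynomial
  \<open>\<mu>\<^sup>2\<close> - p^2 is not bounded below at T, so it vanishes somewhere on the
  approximate spectrum: at one of its roots, or at any point if it is the zero polynomial. There
  |p(t)| equals \<open>\<mu>\<close>.\<close>

theorem papp_norm_le:
  assumes "\<And>t. t \<in> approx_spectrum \<Longrightarrow> \<bar>poly p t\<bar> \<le> M" "f \<in> V"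
  shows "norm (papp p T f) \<le> M * norm f"
proof -
  obtain \<mu> where \<mu>: "\<mu> \<ge> 0" "\<And>f. f \<in> V \<Longrightarrow> norm (papp p T f) \<le> \<mu> * norm f"
    "\<not> bdd_below_on V (papp ([:\<mu>\<^sup>2:] - p * p) T)"
    using papp_norm_attained by blast
  have "\<exists>t\<in>approx_spectrum. poly ([:\<mu>\<^sup>2:] - p * p) t = 0"
    using papp_bdd_below[of "[:\<mu>\<^sup>2:] - p * p"] \<mu>(3) approx_spectrum_nonempty by (metis equals0I poly_0)
  then obtain t where t: "t \<in> approx_spectrum" "(poly p t)\<^sup>2 = \<mu>\<^sup>2"
    by (auto simp: power2_eq_square)
  then have "\<mu> \<le> M" using assms(1)[OF t(1)] \<mu>(1) by (auto simp: power2_eq_iff)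
  then show ?thesis
    using \<mu>(2)[OF assms(2)] by (meson mult_right_mono norm_ge_zero order_trans)
qed

lemma approx_spectrum_subset:
  assumes "\<And>f. f \<in> V \<Longrightarrow> norm (T f) \<le> K * norm f"
  shows "approx_spectrum \<subseteq> {-K..K}"
proof (rule ccontr)
  assume "\<not> ?thesis"
  then obtain t where t: "t \<in> approx_spectrum" "\<bar>t\<bar> > K" by fastforce
  have "(\<bar>t\<bar> - K) * norm f \<le> norm (T f - t *\<^sub>R f)" if "f \<in> V" for f
    using assms[OF that] norm_triangle_ineq2[of "t *\<^sub>R f" "T f"]
    by (simp add: algebra_simps norm_minus_commute)
  then have "bdd_below_on V (\<lambda>f. T f - t *\<^sub>R f)"
    unfolding bdd_below_on_def using t by (intro exI[of _ "\<bar>t\<bar> - K"]) auto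
  then show False using t by (simp add: approx_spectrum_def)
qed

text \<open>If 0 \<le> p \<le> M on the approximate spectrum, then |M - p| \<le> M there, so M -
  p(T) has norm at most M; by Cauchy-Schwarz its quadratic form is at most M |f|^2, which leaves a
  non-negative form for p(T).\<close>

theorem papp_nonneg:
  assumes "\<And>t. t \<in> approx_spectrum \<Longrightarrow> poly p t \<ge> 0" "f \<in> V"
  shows "inner f (papp p T f) \<ge> 0"
proof -
  obtain K where K: "\<And>f. norm (T f) \<le> K * norm f"
    using T.bounded by (metis mult.commute)
  have "compact (poly p ` {-K..K})"
    by (intro compact_continuous_image continuous_intros) auto
  then obtain M where "\<forall>y\<in>poly p ` {-K..K}. \<bar>y\<bar> \<le> M"
    using compact_imp_bounded[of "poly p ` {-K..K}"] unfolding bounded_iff real_norm_def by blast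
  then have M: "\<bar>poly p t\<bar> \<le> M" if "t \<in> approx_spectrum" for t
    using approx_spectrum_subset[OF K] that by blast
  have "norm (papp ([:M:] - p) T f) \<le> M * norm f"
    using assms M by (intro papp_norm_le) fastforce+
  then have "norm f * norm (M *\<^sub>R f - papp p T f) \<le> norm f * (M * norm f)"
    by (intro mult_left_mono) (auto simp: papp_minus)
  then have "inner f (M *\<^sub>R f - papp p T f) \<le> M * (norm f)\<^sup>2"
    using norm_cauchy_schwarz[of f "M *\<^sub>R f - papp p T f"] by (simp add: power2_eq_square mult_ac)
  then show ?thesis by (simp add: inner_diff_right power2_norm_eq_inner)
qed

end

section \<open>Groups acting on trees\<close>

text \<open>
  The axioms say that the Cayley graph is a tree, seen from the identity: every edge changes the
  distance to the identity by one, and every vertex but the identity has exactly one neighbour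
  that is closer. (Left multiplication is used, so the neighbours of \<open>w\<close> are the elements \<open>s w\<close>.)
\<close>

locale tree_group = group G for G (structure) +
  fixes S :: "'a set" and len :: "'a \<Rightarrow> nat"
  assumes S_carrier: "s \<in> S \<Longrightarrow> s \<in> carrier G"
    and S_inv: "s \<in> S \<Longrightarrow> inv s \<in> S"
    and len_one: "len \<one> = 0"
    and len_step: "s \<in> S \<Longrightarrow> w \<in> carrier G \<Longrightarrow>
      len (s \<otimes> w) = Suc (len w) \<or> Suc (len (s \<otimes> w)) = len w"
    and first_ex: "w \<in> carrier G \<Longrightarrow> w \<noteq> \<one> \<Longrightarrow> \<exists>s\<in>S. Suc (len (inv s \<otimes> w)) = len w"
    and first_unique: "w \<in> carrier G \<Longrightarrow> s \<in> S \<Longrightarrow> t \<in> S \<Longrightarrow>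
      Suc (len (inv s \<otimes> w)) = len w \<Longrightarrow> Suc (len (inv t \<otimes> w)) = len w \<Longrightarrow> s = t"
begin

definition first :: "'a \<Rightarrow> 'a \<Rightarrow> bool" where
  "first s w \<longleftrightarrow> s \<in> S \<and> Suc (len (inv s \<otimes> w)) = len w"

lemma not_firstD: "s \<in> S \<Longrightarrow> w \<in> carrier G \<Longrightarrow> \<not> first s w \<Longrightarrow> len (inv s \<otimes> w) = Suc (len w)"
  using len_step[OF S_inv] by (auto simp: first_def)

lemma len_eq_0_iff: "w \<in> carrier G \<Longrightarrow> len w = 0 \<longleftrightarrow> w = \<one>"
  using first_ex[of w] len_one by (cases "w = \<one>") auto

lemma mult_inv_mult [simp]:
  assumes "x \<in> carrier G" "y \<in> carrier G"
  shows "x \<otimes> (inv x \<otimes> y) = y" "inv x \<otimes> (x \<otimes> y) = y"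
  using assms by (simp_all flip: m_assoc)

text \<open>No cancellation occurs between the inverse of \<open>p\<close> and \<open>h\<close>. The
  induction moves the first letter s of \<open>p\<close> across: p' = s^-1 p and h' = s^-1 h have
  the same quotient, and h' starts with s^-1. If p' started with s^-1 as well, p = s p' would be
  shorter than p'.\<close>

lemma len_inv_mult:
  assumes "p \<in> carrier G" "h \<in> carrier G" "\<And>s. first s p \<Longrightarrow> \<not> first s h"
  shows "len (inv p \<otimes> h) = len p + len h"
  using assms
proof (induction "len p" arbitrary: p h)
  case 0
  then show ?case by (metis len_eq_0_iff inv_one l_one len_one add_0)
next
  case (Suc n)
  then have "p \<noteq> \<one>" by (auto simp: len_one)
  then obtain s where s: "first s p" using first_ex Suc.prems by (auto simp: first_def)
  then have sS: "s \<in> S" "s \<in> carrier G" by (auto simp: first_def S_carrier)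
  define p' h' where "p' = inv s \<otimes> p" and "h' = inv s \<otimes> h"
  have c: "p' \<in> carrier G" "h' \<in> carrier G" using Suc.prems sS by (auto simp: p'_def h'_def)
  have lp: "len p = Suc (len p')" using s by (simp add: first_def p'_def)
  have lh: "len h' = Suc (len h)" using not_firstD[OF sS(1)] Suc.prems s by (simp add: h'_def)
  have back_steps: "s \<otimes> p' = p" "s \<otimes> h' = h"
    using sS Suc.prems by (simp_all add: p'_def h'_def)
  have "len (inv p' \<otimes> h') = len p' + len h'"
  proof (rule Suc.hyps)
    fix t assume t: "first t p'"
    show "\<not> first t h'"
    proof
      assume "first t h'"
      moreover have "first (inv s) h'" using sS back_steps lh S_inv by (simp add: first_def)
      ultimately have "t = inv s" using first_unique[of h'] c by (auto simp: first_def)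
      then show False using t sS back_steps lp by (simp add: first_def)
    qed
  qed (use Suc.hyps lp c in auto)
  moreover have "inv p' \<otimes> h' = inv p \<otimes> h"
    using sS Suc.prems c back_steps(2) by (simp add: p'_def inv_mult_group m_assoc)
  ultimately show ?case using lp lh by simp
qed

lemma len_inv: "p \<in> carrier G \<Longrightarrow> len (inv p) = len p"
  using len_inv_mult[of p \<one>] by (simp add: first_def len_one)

lemma len_mult_le:
  assumes "g \<in> carrier G" "h \<in> carrier G"
  shows "len (g \<otimes> h) \<le> len g + len h"
  using assms
proof (induction "len g" arbitrary: g)
  case 0
  then show ?case by (metis len_eq_0_iff l_one le_add2)
next
  case (Suc n)
  then have "g \<noteq> \<one>" by (auto simp: len_one)
  then obtain s where s: "s \<in> S" "Suc (len (inv s \<otimes> g)) = len g" using first_ex Suc.prems by blast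
  let ?g = "inv s \<otimes> g"
  have c: "s \<in> carrier G" "?g \<in> carrier G" using s S_carrier Suc.prems by auto
  have "len (?g \<otimes> h) \<le> len ?g + len h" using Suc s c by auto
  moreover have "g \<otimes> h = s \<otimes> (?g \<otimes> h)" using c Suc.prems by (simp add: m_assoc)
  then have "len (g \<otimes> h) \<le> Suc (len (?g \<otimes> h))"
    using len_step[of s "?g \<otimes> h"] s c Suc.prems by auto
  ultimately show ?case using s by simp
qed

text \<open>The part that cancels in the product g h is \<open>v\<close>. Each common letter s of
  the end of \<open>g\<close> and the beginning of \<open>h\<close> is removed from both and put in
  front of \<open>v\<close>; once there is none left, \<open>v\<close> is the identity and the
  lengths add.\<close>

lemma tripod:
  assumes "g \<in> carrier G" "h \<in> carrier G"
  shows "\<exists>u\<in>carrier G. \<exists>v\<in>carrier G. \<exists>w\<in>carrier G. g = u \<otimes> inv v \<and> h = v \<otimes> inv w \<and>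
    len g = len u + len v \<and> len h = len v + len w \<and> len (g \<otimes> h) = len u + len w"
  using assms
proof (induction "len h" arbitrary: g h rule: less_induct)
  case less
  show ?case
  proof (cases "\<exists>s. first s (inv g) \<and> first s h")
    case True
    then obtain s where s: "first s (inv g)" "first s h" by blast
    then have sS: "s \<in> S" "s \<in> carrier G" by (auto simp: first_def S_carrier)
    define g' h' where "g' = g \<otimes> s" and "h' = inv s \<otimes> h"
    have c: "g' \<in> carrier G" "h' \<in> carrier G" using less.prems sS by (auto simp: g'_def h'_def)
    have lh: "len h = Suc (len h')" using s by (simp add: first_def h'_def)
    have "inv g' = inv s \<otimes> inv g" using less.prems sS by (simp add: g'_def inv_mult_group)
    then have lg: "len g = Suc (len g')"
      using s len_inv[of g] len_inv[of g'] less.prems c by (simp add: first_def)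
    have gh: "g' \<otimes> h' = g \<otimes> h"
      using less.prems sS by (simp add: g'_def h'_def m_assoc)
    obtain u v w where uvw: "u \<in> carrier G" "v \<in> carrier G" "w \<in> carrier G"
      "g' = u \<otimes> inv v" "h' = v \<otimes> inv w" "len g' = len u + len v" "len h' = len v + len w"
      "len (g' \<otimes> h') = len u + len w"
      using less.hyps[of h' g'] lh c by auto
    have "g' \<otimes> inv s = g" using less.prems sS by (simp add: g'_def m_assoc)
    then have g: "g = u \<otimes> inv (s \<otimes> v)" using uvw sS by (simp add: inv_mult_group m_assoc)
    have "s \<otimes> h' = h" using less.prems sS by (simp add: h'_def)
    then have h: "h = (s \<otimes> v) \<otimes> inv w" using uvw sS by (simp add: m_assoc)
    \<comment> \<open>The triangle inequality excludes the shorter alternative: a step changes the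
      length by exactly one, and \<open>len g\<close> is one more than
      \<open>len u + len v\<close>.\<close>
    have "len g \<le> len u + len (s \<otimes> v)"
      using len_mult_le[of u "inv (s \<otimes> v)"] len_inv[of "s \<otimes> v"] g uvw sS by simp
    then have "len (s \<otimes> v) = Suc (len v)"
      using len_step[OF sS(1) uvw(2)] lg uvw by auto
    then show ?thesis
      using uvw sS g h lg lh gh by (intro bexI[of _ u] bexI[of _ "s \<otimes> v"] bexI[of _ w]) auto
  next
    case False
    then have "len (g \<otimes> h) = len g + len h"
      using len_inv_mult[of "inv g" h] less.prems len_inv by auto
    then show ?thesis
      using less.prems by (intro bexI[of _ g] bexI[of _ \<one>] bexI[of _ "inv h"])
        (auto simp: len_one len_inv)
  qed
qed

text \<open>Both \<open>u\<close> and \<open>v\<close> lie on geodesics from the identity to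
  \<open>k\<close>, at the same distance. Each of them starts with the first letter of
  \<open>k\<close>, which is unique; stripping it from all three elements is the induction
  step.\<close>

lemma geodesic_unique:
  assumes "u \<in> carrier G" "v \<in> carrier G" "k \<in> carrier G" "len u = len v"
    "len k = len u + len (inv u \<otimes> k)" "len k = len v + len (inv v \<otimes> k)"
  shows "u = v"
  using assms
proof (induction "len u" arbitrary: u v k)
  case 0
  then show ?case by (metis len_eq_0_iff)
next
  case (Suc n)
  \<comment> \<open>A prefix \<open>w\<close> of \<open>k\<close> passes its first letter s on to
    \<open>k\<close>: the triangle inequality through \<open>w\<close> shows that s^-1 k is shorter
    than \<open>k\<close>.\<close>
  have first: "\<exists>s. first s w \<and> first s k \<and> len w = Suc (len (inv s \<otimes> w)) \<and>
      inv (inv s \<otimes> w) \<otimes> (inv s \<otimes> k) = inv w \<otimes> k"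
    if w: "w \<in> carrier G" "w \<noteq> \<one>" "len k = len w + len (inv w \<otimes> k)" for w
  proof -
    obtain s where s: "first s w" using first_ex w by (auto simp: first_def)
    then have sS: "s \<in> S" "s \<in> carrier G" by (auto simp: first_def S_carrier)
    have eq: "inv (inv s \<otimes> w) \<otimes> (inv s \<otimes> k) = inv w \<otimes> k"
      using sS w Suc.prems by (simp add: inv_mult_group m_assoc)
    have "inv s \<otimes> k = (inv s \<otimes> w) \<otimes> (inv w \<otimes> k)"
      using sS w Suc.prems by (simp add: m_assoc)
    then have "len (inv s \<otimes> k) \<le> len (inv s \<otimes> w) + len (inv w \<otimes> k)"
      using len_mult_le[of "inv s \<otimes> w" "inv w \<otimes> k"] sS w Suc.prems by simp
    then have "len (inv s \<otimes> k) < len k" using s w(3) by (simp add: first_def)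
    then have "first s k"
      using not_firstD[OF sS(1), of k] Suc.prems by fastforce
    then show ?thesis using s eq by (auto simp: first_def)
  qed
  have "u \<noteq> \<one>" "v \<noteq> \<one>" using Suc.hyps(2) Suc.prems(4) by (auto simp: len_one)
  then obtain s t where st: "first s u" "first s k" "len u = Suc (len (inv s \<otimes> u))"
    "inv (inv s \<otimes> u) \<otimes> (inv s \<otimes> k) = inv u \<otimes> k"
    "first t v" "first t k" "len v = Suc (len (inv t \<otimes> v))"
    "inv (inv t \<otimes> v) \<otimes> (inv t \<otimes> k) = inv v \<otimes> k"
    using first[of u] first[of v] Suc.prems by metis
  then have t: "t = s" using first_unique[of k] Suc.prems by (auto simp: first_def)
  have sS: "s \<in> carrier G" "Suc (len (inv s \<otimes> k)) = len k" using st S_carrier by (auto simp: first_def)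
  have "inv s \<otimes> u = inv s \<otimes> v"
    using Suc st sS unfolding t by (intro Suc.hyps(1)[of _ _ "inv s \<otimes> k"]) auto
  then show ?case using sS Suc.prems by simp
qed

end

section \<open>Hilbert-Schmidt estimates for finite matrices\<close>

text \<open>The operator norm is at most the Hilbert-Schmidt norm; Cauchy-Schwarz over pairs of
  indices.\<close>

lemma sum_quadratic_form_le:
  fixes x :: "'i \<Rightarrow> real"
  shows "(\<Sum>u\<in>I. \<Sum>v\<in>I. x u * x v * M u v) \<le> (\<Sum>u\<in>I. (x u)\<^sup>2) * sqrt (\<Sum>u\<in>I. \<Sum>v\<in>I. (M u v)\<^sup>2)"
proof -
  have "(\<Sum>p\<in>I\<times>I. (x (fst p) * x (snd p)) * M (fst p) (snd p))\<^sup>2 \<le>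
      (\<Sum>p\<in>I\<times>I. (x (fst p) * x (snd p))\<^sup>2) * (\<Sum>p\<in>I\<times>I. (M (fst p) (snd p))\<^sup>2)"
    by (rule Cauchy_Schwarz_ineq_sum)
  also have "(\<Sum>p\<in>I\<times>I. (x (fst p) * x (snd p))\<^sup>2) = (\<Sum>u\<in>I. (x u)\<^sup>2)\<^sup>2"
    by (simp add: power2_eq_square[of "sum _ _"] sum_product sum.cartesian_product power_mult_distrib
        case_prod_unfold)
  finally have "(\<Sum>u\<in>I. \<Sum>v\<in>I. x u * x v * M u v)\<^sup>2 \<le>
      (\<Sum>u\<in>I. (x u)\<^sup>2)\<^sup>2 * (\<Sum>u\<in>I. \<Sum>v\<in>I. (M u v)\<^sup>2)"
    by (simp add: sum.cartesian_product case_prod_unfold)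
  from real_le_rsqrt[OF this] show ?thesis
    by (simp add: real_sqrt_mult sum_nonneg)
qed

text \<open>The left-hand side is the Hilbert-Schmidt pairing of M M with M, and the norm of M M is
  at most the square of the norm of M.\<close>

lemma sum_triangle_le:
  fixes M :: "'i \<Rightarrow> 'i \<Rightarrow> real"
  shows "(\<Sum>u\<in>I. \<Sum>v\<in>I. \<Sum>w\<in>I. M u v * M v w * M u w) \<le> sqrt (\<Sum>u\<in>I. \<Sum>v\<in>I. (M u v)\<^sup>2) ^ 3"
proof -
  define Q where "Q = (\<Sum>u\<in>I. \<Sum>v\<in>I. (M u v)\<^sup>2)"
  define N where "N u w = (\<Sum>v\<in>I. M u v * M v w)" for u w
  have Q0: "Q \<ge> 0" by (simp add: Q_def sum_nonneg)
  have "(\<Sum>u\<in>I. \<Sum>w\<in>I. (N u w)\<^sup>2) \<le> (\<Sum>u\<in>I. \<Sum>w\<in>I. (\<Sum>v\<in>I. (M u v)\<^sup>2) * (\<Sum>v\<in>I. (M v w)\<^sup>2))"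
    unfolding N_def by (intro sum_mono Cauchy_Schwarz_ineq_sum)
  also have "\<dots> = Q * Q"
    unfolding sum_product[symmetric] Q_def by (subst sum.swap) (simp add: mult.commute)
  finally have N: "(\<Sum>u\<in>I. \<Sum>w\<in>I. (N u w)\<^sup>2) \<le> Q * Q" .
  have "(\<Sum>p\<in>I\<times>I. N (fst p) (snd p) * M (fst p) (snd p))\<^sup>2 \<le>
      (\<Sum>p\<in>I\<times>I. (N (fst p) (snd p))\<^sup>2) * (\<Sum>p\<in>I\<times>I. (M (fst p) (snd p))\<^sup>2)"
    by (rule Cauchy_Schwarz_ineq_sum)
  then have "(\<Sum>u\<in>I. \<Sum>w\<in>I. N u w * M u w)\<^sup>2 \<le> (\<Sum>u\<in>I. \<Sum>w\<in>I. (N u w)\<^sup>2) * Q"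
    by (simp add: sum.cartesian_product case_prod_unfold Q_def)
  also have "\<dots> \<le> Q * Q * Q" using N Q0 by (intro mult_right_mono)
  also have "\<dots> = (sqrt Q ^ 3)\<^sup>2"
    using Q0 by (simp add: power2_eq_square power3_eq_cube)
  finally have "(\<Sum>u\<in>I. \<Sum>w\<in>I. N u w * M u w) \<le> sqrt Q ^ 3"
    by (rule power2_le_imp_le) (use Q0 in simp)
  moreover have "(\<Sum>u\<in>I. \<Sum>w\<in>I. N u w * M u w) = (\<Sum>u\<in>I. \<Sum>v\<in>I. \<Sum>w\<in>I. M u v * M v w * M u w)"
    unfolding N_def sum_distrib_right by (intro sum.cong refl sum.swap)
  ultimately show ?thesis by (simp add: Q_def)
qed

context tree_group
begin

text \<open>The vertices on the geodesic from the identity to \<open>k\<close>, that is, the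
  prefixes of \<open>k\<close>.\<close>

definition splits :: "'a \<Rightarrow> 'a set" where
  "splits k = {u \<in> carrier G. len k = len u + len (inv u \<otimes> k)}"

lemma inj_on_len_splits: "k \<in> carrier G \<Longrightarrow> inj_on len (splits k)"
  by (auto simp: splits_def inj_on_def intro: geodesic_unique)

lemma finite_splits: "k \<in> carrier G \<Longrightarrow> finite (splits k)"
  by (rule inj_on_finite[OF inj_on_len_splits, of _ "{..len k}"]) (auto simp: splits_def)

text \<open>
  Writing \<open>g = u v\<inverse>\<close>, \<open>h = v w\<inverse>\<close>, \<open>g h = u w\<inverse>\<close> without cancellation turns the left-hand side into
  a sum of \<open>M u v * M v w * M u w\<close> with \<open>M u v = b (u v\<inverse>)\<close>. Off the identity, the squared
  Hilbert--Schmidt norm of \<open>M\<close> is at most \<open>D\<close>, as \<open>k\<close> has \<open>len k - 1\<close> splittings into two nontrivial parts.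
\<close>

theorem sum_mult_le:
  fixes b :: "'a \<Rightarrow> real"
  defines "F \<equiv> {g \<in> carrier G. b g \<noteq> 0}"
  defines "m \<equiv> b \<one>"
  defines "a \<equiv> \<Sum>g\<in>F - {\<one>}. (b g)\<^sup>2"
  defines "D \<equiv> \<Sum>g\<in>F - {\<one>}. (real (len g) - 1) * (b g)\<^sup>2"
  assumes b: "\<And>g. b g \<ge> 0" "\<And>g. g \<in> carrier G \<Longrightarrow> b (inv g) = b g" and F: "finite F"
  shows "(\<Sum>g\<in>F. \<Sum>h\<in>F. b g * b h * b (g \<otimes> h)) \<le> m ^ 3 + 3 * m * a + 3 * a * sqrt D + sqrt D ^ 3"
proof -
  \<comment> \<open>All legs of tripods with sides in \<open>F\<close> lie in
    \<open>insert \<one> U\<close>. The identity is kept apart because its row and column of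
    \<open>M\<close> carry \<open>b\<close> itself and would make the Hilbert-Schmidt norm exceed
    \<open>D\<close>.\<close>
  define U where "U = (\<Union>k\<in>F. splits k) - {\<one>}"
  \<comment> \<open>Entries with cancellation are set to 0. Tripods never use them, and without them
    each \<open>k\<close> occurs only once for each of its splittings.\<close>
  define M where "M u v = (if len (u \<otimes> inv v) = len u + len v then b (u \<otimes> inv v) else 0)" for u v
  have FG: "F \<subseteq> carrier G" by (auto simp: F_def)
  have UG: "U \<subseteq> carrier G" by (auto simp: U_def splits_def)
  have finU: "finite U" using F FG finite_splits by (auto simp: U_def)
  have M0: "M u v \<ge> 0" for u v by (simp add: M_def b)
  have Fi: "inv g \<in> F" if "g \<in> F" for g using that b by (auto simp: F_def)
  have FU: "F - {\<one>} \<subseteq> U"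
  proof
    fix g assume "g \<in> F - {\<one>}"
    then show "g \<in> U"
      using FG unfolding U_def by (intro DiffI UN_I[of g]) (auto simp: splits_def len_one)
  qed
  have M_one: "M u \<one> = b u" "M \<one> u = b u" if "u \<in> carrier G" for u
    using that by (auto simp: M_def len_one len_inv b)
  have a: "a = (\<Sum>u\<in>U. (b u)\<^sup>2)"
    unfolding a_def using finU FU UG by (intro sum.mono_neutral_left) (auto simp: F_def U_def)

  define Q where "Q = (\<Sum>u\<in>U. \<Sum>v\<in>U. (M u v)\<^sup>2)"
  have "Q \<le> D"
  proof -
    define P where "P = {p \<in> U \<times> U. M (fst p) (snd p) \<noteq> 0}"
    let ?k = "\<lambda>p. fst p \<otimes> inv (snd p)"
    have finP: "finite P" using finU by (auto simp: P_def)
    have P: "fst p \<in> carrier G" "snd p \<in> carrier G" "len (fst p) > 0" "len (snd p) > 0"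
      "len (?k p) = len (fst p) + len (snd p)" "b (?k p) \<noteq> 0" "M (fst p) (snd p) = b (?k p)"
      "?k p \<in> F - {\<one>}" "inv (fst p) \<otimes> ?k p = inv (snd p)" if "p \<in> P" for p
    proof -
      show 1: "fst p \<in> carrier G" "snd p \<in> carrier G" using that UG by (auto simp: P_def)
      then show 2: "len (fst p) > 0" "len (snd p) > 0"
        using that len_eq_0_iff by (auto simp: P_def U_def intro!: gr0I)
      show 3: "len (?k p) = len (fst p) + len (snd p)" "b (?k p) \<noteq> 0" "M (fst p) (snd p) = b (?k p)"
        using that by (auto simp: P_def M_def split: if_splits)
      show "?k p \<in> F - {\<one>}" using 1 2 3 by (auto simp: F_def len_one)
      show "inv (fst p) \<otimes> ?k p = inv (snd p)" using 1 by simp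
    qed
    have "Q = (\<Sum>p\<in>U \<times> U. (M (fst p) (snd p))\<^sup>2)"
      by (simp add: Q_def sum.cartesian_product case_prod_unfold)
    also have "\<dots> = (\<Sum>p\<in>P. (b (?k p))\<^sup>2)"
    proof (rule sum.mono_neutral_cong_right)
      show "(M (fst p) (snd p))\<^sup>2 = (b (?k p))\<^sup>2" if "p \<in> P" for p
        by (simp only: P(7)[OF that])
    qed (use finU in \<open>auto simp: P_def\<close>)
    also have "\<dots> = (\<Sum>k\<in>F - {\<one>}. \<Sum>p\<in>{p \<in> P. ?k p = k}. (b (?k p))\<^sup>2)"
    proof (rule sum.group[symmetric])
      show "?k ` P \<subseteq> F - {\<one>}" by (rule image_subsetI) (rule P(8))
    qed (use finP F in auto)
    also have "\<dots> = (\<Sum>k\<in>F - {\<one>}. real (card {p \<in> P. ?k p = k}) * (b k)\<^sup>2)"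
      by (intro sum.cong refl) simp
    also have "\<dots> \<le> D"
      unfolding D_def
    proof (intro sum_mono mult_right_mono)
      fix k assume k: "k \<in> F - {\<one>}"
      then have kG: "k \<in> carrier G" using FG by auto
      \<comment> \<open>For a fixed product k, uniqueness of geodesics recovers u from its length,
        and then v. As u and v are both nontrivial, this length ranges over 1, ...,
        \<open>len k - 1\<close>, which is the weight in \<open>D\<close>.\<close>
      have "inj_on (len \<circ> fst) {p \<in> P. ?k p = k}"
      proof (rule inj_onI)
        fix p q assume pq: "p \<in> {p \<in> P. ?k p = k}" "q \<in> {p \<in> P. ?k p = k}" "(len \<circ> fst) p = (len \<circ> fst) q"
        have s: "fst r \<in> splits k" "snd r = inv (inv (fst r) \<otimes> k)" if "r \<in> {p \<in> P. ?k p = k}" for r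
          using P[of r] that by (auto simp: splits_def len_inv)
        have "fst p = fst q"
          using inj_onD[OF inj_on_len_splits[OF kG] _ s(1)[OF pq(1)] s(1)[OF pq(2)]] pq(3) by simp
        then show "p = q" using s(2)[OF pq(1)] s(2)[OF pq(2)] by (simp add: prod_eq_iff)
      qed
      moreover have "(len \<circ> fst) ` {p \<in> P. ?k p = k} \<subseteq> {1..<len k}"
      proof
        fix n assume "n \<in> (len \<circ> fst) ` {p \<in> P. ?k p = k}"
        then obtain p where "p \<in> P" "?k p = k" "n = len (fst p)" by auto
        then show "n \<in> {1..<len k}" using P(3-5)[of p] by auto
      qed
      ultimately have "card {p \<in> P. ?k p = k} \<le> card {1..<len k}"
        by (rule card_inj_on_le) simp
      moreover have "len k > 0" using k kG len_eq_0_iff by auto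
      ultimately show "real (card {p \<in> P. ?k p = k}) \<le> real (len k) - 1" by simp
    qed simp
    finally show ?thesis .
  qed
  then have Q: "sqrt Q \<le> sqrt D" "0 \<le> sqrt Q"
    by (auto simp: Q_def intro!: sum_nonneg)

  let ?t = "\<lambda>p (u, v, w). u \<in> carrier G \<and> v \<in> carrier G \<and> w \<in> carrier G \<and>
    fst p = u \<otimes> inv v \<and> snd p = v \<otimes> inv w \<and> len (fst p) = len u + len v \<and>
    len (snd p) = len v + len w \<and> len (fst p \<otimes> snd p) = len u + len w"
  have "\<forall>p\<in>F \<times> F. \<exists>t. ?t p t"
  proof
    fix p assume "p \<in> F \<times> F"
    then have "fst p \<in> carrier G" "snd p \<in> carrier G" using FG by auto
    from tripod[OF this] show "\<exists>t. ?t p t" by (simp only: split_paired_Ex prod.case) blast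
  qed
  from bchoice[OF this] obtain t where "\<forall>p\<in>F \<times> F. ?t p (t p)" ..
  then have t: "?t p (t p)" if "p \<in> F \<times> F" for p using that by (rule bspec)
  let ?f = "\<lambda>(u, v, w). M u v * M v w * M u w"
  have uw: "u \<otimes> inv w = (u \<otimes> inv v) \<otimes> (v \<otimes> inv w)"
    if "u \<in> carrier G" "v \<in> carrier G" "w \<in> carrier G" for u v w
    using that by (simp add: m_assoc)
  have "(\<Sum>g\<in>F. \<Sum>h\<in>F. b g * b h * b (g \<otimes> h)) = (\<Sum>p\<in>F \<times> F. b (fst p) * b (snd p) * b (fst p \<otimes> snd p))"
    by (simp add: sum.cartesian_product case_prod_unfold)
  also have "\<dots> = (\<Sum>p\<in>F \<times> F. ?f (t p))"
  proof (rule sum.cong)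
    fix p assume p: "p \<in> F \<times> F"
    obtain u v w where uvw: "t p = (u, v, w)" by (cases "t p")
    have T: "?t p (u, v, w)" using t[OF p] by (simp only: uvw)
    then have l: "len (fst p) = len u + len v" "len (snd p) = len v + len w"
      "len (fst p \<otimes> snd p) = len u + len w" unfolding prod.case by blast+
    from T have e: "u \<otimes> inv v = fst p" "v \<otimes> inv w = snd p" "u \<otimes> inv w = fst p \<otimes> snd p"
      using uw[of u v w] by simp_all
    have "M u v = b (fst p)" "M v w = b (snd p)" "M u w = b (fst p \<otimes> snd p)"
      unfolding M_def e using l by (simp_all only: if_True refl)
    then show "b (fst p) * b (snd p) * b (fst p \<otimes> snd p) = ?f (t p)"
      by (simp only: uvw prod.case)
  qed simp
  \<comment> \<open>The legs of a tripod determine \<open>g\<close> and \<open>h\<close>, so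
    distinct pairs yield distinct triples.\<close>
  also have "\<dots> = (\<Sum>x\<in>t ` (F \<times> F). ?f x)"
  proof (rule sum.reindex_cong[symmetric, where l = t])
    show "inj_on t (F \<times> F)"
    proof (rule inj_onI)
      fix p q assume pq: "p \<in> F \<times> F" "q \<in> F \<times> F" "t p = t q"
      obtain u v w where uvw: "t p = (u, v, w)" by (cases "t p")
      have "?t p (u, v, w)" "?t q (u, v, w)" using t[OF pq(1)] t[OF pq(2)] pq(3) by (simp_all only: uvw)
      then show "p = q" by (simp add: prod_eq_iff)
    qed
  qed auto
  \<comment> \<open>The additional triples contribute non-negative terms. That \<open>w\<close> lies
    in the index set uses the symmetry of \<open>F\<close>: it is a prefix of the inverse of
    \<open>h\<close>.\<close>
  also have "\<dots> \<le> (\<Sum>x\<in>insert \<one> U \<times> insert \<one> U \<times> insert \<one> U. ?f x)"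
  proof (rule sum_mono2)
    show "t ` (F \<times> F) \<subseteq> insert \<one> U \<times> insert \<one> U \<times> insert \<one> U"
    proof
      fix x assume "x \<in> t ` (F \<times> F)"
      then obtain p where p: "p \<in> F \<times> F" "x = t p" by blast
      obtain u v w where uvw: "t p = (u, v, w)" by (cases "t p")
      have T: "?t p (u, v, w)" using t[OF p(1)] by (simp only: uvw)
      have i: "inv u \<otimes> fst p = inv v" "inv v \<otimes> snd p = inv w" "inv w \<otimes> inv (snd p) = inv v"
        using T by (simp_all add: inv_mult_group m_assoc)
      have "u \<in> splits (fst p)" "v \<in> splits (snd p)" "w \<in> splits (inv (snd p))"
        using T i p FG by (auto simp: splits_def len_inv)
      moreover have "fst p \<in> F" "snd p \<in> F" "inv (snd p) \<in> F"
        using p(1) Fi[of "snd p"] by auto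
      ultimately show "x \<in> insert \<one> U \<times> insert \<one> U \<times> insert \<one> U"
        unfolding p uvw U_def by blast
    qed
  qed (use finU M0 in auto)
  also have "\<dots> = (\<Sum>u\<in>insert \<one> U. \<Sum>v\<in>insert \<one> U. \<Sum>w\<in>insert \<one> U. M u v * M v w * M u w)"
    by (simp add: sum.cartesian_product case_prod_unfold)
  \<comment> \<open>Sorted by how many of the three legs are trivial: three give m^3, two give m a
    in three ways, one gives the quadratic form of M at b in three ways, none gives the last
    sum.\<close>
  also have "\<dots> = m ^ 3 + 3 * m * a + 3 * (\<Sum>u\<in>U. \<Sum>v\<in>U. b u * b v * M u v) +
      (\<Sum>u\<in>U. \<Sum>v\<in>U. \<Sum>w\<in>U. M u v * M v w * M u w)"
  proof -
    have U1: "\<one> \<notin> U" by (simp add: U_def)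
    have M1: "M u \<one> = b u" "M \<one> u = b u" if "u \<in> U" for u using M_one that UG by auto
    have M11: "M \<one> \<one> = m" using M_one[of \<one>] by (simp add: m_def)
    show ?thesis
      using finU U1
      by (simp add: M1 M11 a sum.distrib sum_distrib_left power2_eq_square power3_eq_cube algebra_simps
          cong: sum.cong)
        (simp only: sum.distrib[symmetric], simp add: algebra_simps)
  qed
  also have "\<dots> \<le> m ^ 3 + 3 * m * a + 3 * (a * sqrt D) + sqrt D ^ 3"
  proof -
    have "a \<ge> 0" by (simp add: a sum_nonneg)
    have "(\<Sum>u\<in>U. \<Sum>v\<in>U. b u * b v * M u v) \<le> a * sqrt Q"
      unfolding a Q_def by (rule sum_quadratic_form_le)
    also have "\<dots> \<le> a * sqrt D" using Q \<open>a \<ge> 0\<close> by (intro mult_left_mono)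
    finally have 1: "(\<Sum>u\<in>U. \<Sum>v\<in>U. b u * b v * M u v) \<le> a * sqrt D" .
    have "(\<Sum>u\<in>U. \<Sum>v\<in>U. \<Sum>w\<in>U. M u v * M v w * M u w) \<le> sqrt Q ^ 3"
      unfolding Q_def by (rule sum_triangle_le)
    also have "\<dots> \<le> sqrt D ^ 3" using Q by (intro power_mono)
    finally show ?thesis using 1 by simp
  qed
  finally show ?thesis by simp
qed

end

section \<open>Comparison with the word length\<close>

context tree_group
begin

lemma foldr_S:
  assumes "set ws \<subseteq> S"
  shows "foldr (\<otimes>) ws \<one> \<in> carrier G" "len (foldr (\<otimes>) ws \<one>) \<le> length ws"
proof -
  have "foldr (\<otimes>) ws \<one> \<in> carrier G \<and> len (foldr (\<otimes>) ws \<one>) \<le> length ws"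
    using assms
  proof (induction ws)
    case (Cons s ws)
    then have *: "foldr (\<otimes>) ws \<one> \<in> carrier G" "len (foldr (\<otimes>) ws \<one>) \<le> length ws" "s \<in> S" by auto
    then show ?case using len_step[OF *(3,1)] S_carrier by auto
  qed (simp add: len_one)
  then show "foldr (\<otimes>) ws \<one> \<in> carrier G" "len (foldr (\<otimes>) ws \<one>) \<le> length ws" by auto
qed

lemma generated: "g \<in> carrier G \<Longrightarrow> \<exists>ws. set ws \<subseteq> S \<and> foldr (\<otimes>) ws \<one> = g"
proof (induction "len g" arbitrary: g)
  case 0
  then show ?case using len_eq_0_iff[of g] by (intro exI[of _ "[]"]) simp
next
  case (Suc n)
  then have "g \<noteq> \<one>" by (auto simp: len_one)
  then obtain s where s: "s \<in> S" "Suc (len (inv s \<otimes> g)) = len g" using first_ex Suc.prems by blast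
  then have sG: "s \<in> carrier G" by (simp add: S_carrier)
  obtain ws where "set ws \<subseteq> S" "foldr (\<otimes>) ws \<one> = inv s \<otimes> g"
    using Suc.hyps(1)[of "inv s \<otimes> g"] Suc.hyps(2) Suc.prems s sG by auto
  then show ?case using s sG Suc.prems by (intro exI[of _ "s # ws"]) simp
qed

text \<open>One letter lengthens by at most one. This direction is the one that serves the main
  inequality, where the word length occurs only in the larger side.\<close>

lemma len_le_word_length:
  assumes "g \<in> carrier G"
  shows "len g \<le> word_length G S g"
proof -
  have "\<exists>n ws. set ws \<subseteq> S \<and> length ws = n \<and> foldr (\<otimes>) ws \<one> = g"
    using generated[OF assms] by blast
  then have "\<exists>ws. set ws \<subseteq> S \<and> length ws = word_length G S g \<and> foldr (\<otimes>) ws \<one> = g"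
    unfolding word_length_def by (rule LeastI_ex)
  then obtain ws where "set ws \<subseteq> S" "length ws = word_length G S g" "foldr (\<otimes>) ws \<one> = g"
    by blast
  then show ?thesis using foldr_S(2)[of ws] by simp
qed

end

section \<open>The free product of copies of Z and Z_2 as a tree group\<close>

text \<open>A closed formula for the length of a reduced word. A syllable in a copy of Z_2 is stored
  as the integer 1, so one formula serves both kinds of factor.\<close>

definition syllables_len :: "('i \<times> int) list \<Rightarrow> nat" where
  "syllables_len w = (\<Sum>(i, n)\<leftarrow>w. nat \<bar>n\<bar>)"

lemma syllables_len_simps [simp]:
  "syllables_len [] = 0" "syllables_len ((i, n) # w) = nat \<bar>n\<bar> + syllables_len w"
  by (simp_all add: syllables_len_def)

lemma integer_mod_group_2 [simp]:
  "carrier (integer_mod_group 2) = {0, 1}" "\<one>\<^bsub>integer_mod_group 2\<^esub> = 0"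
  "x \<otimes>\<^bsub>integer_mod_group 2\<^esub> y = (x + y) mod 2"
  by (auto simp: integer_mod_group_def)

lemma free_product_Z_Z2_Cons:
  "p # w \<in> carrier (free_product_Z_Z2 A B) \<longleftrightarrow>
     ((\<exists>a\<in>A. \<exists>n. p = (Inl a, n) \<and> n \<noteq> 0) \<or> (\<exists>b\<in>B. p = (Inr b, 1))) \<and>
     w \<in> carrier (free_product_Z_Z2 A B) \<and> (w = [] \<or> fst (hd w) \<noteq> fst p)"
proof (cases p)
  case (Pair i n)
  then show ?thesis
    by (cases i) (auto simp: free_product_Z_Z2_def reduced_words_Cons integer_group_def)
qed

lemma generator_mult:
  "[(Inl a, n)] \<otimes>\<^bsub>free_product_Z_Z2 A B\<^esub> w = (if n = 0 then w else
     case w of [] \<Rightarrow> [(Inl a, n)] | (j, k) # v \<Rightarrow>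
       if j = Inl a then if n + k = 0 then v else (Inl a, n + k) # v else (Inl a, n) # w)"
  "[(Inr b, 1)] \<otimes>\<^bsub>free_product_Z_Z2 A B\<^esub> w =
     (case w of [] \<Rightarrow> [(Inr b, 1)] | (j, k) # v \<Rightarrow>
       if j = Inr b then if (1 + k) mod 2 = 0 then v else (Inr b, (1 + k) mod 2) # v else (Inr b, 1) # w)"
  by (auto simp: free_product_Z_Z2_def integer_group_def split: list.split)

lemma generators_cases:
  assumes "s \<in> generators_Z_Z2 A B"
  obtains a n where "a \<in> A" "n = 1 \<or> n = -1" "s = [(Inl a, n)]" | b where "b \<in> B" "s = [(Inr b, 1)]"
  using assms unfolding generators_Z_Z2_def by blast

lemma generators_closed: "generators_Z_Z2 A B \<subseteq> carrier (free_product_Z_Z2 A B)"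
  by (auto simp: generators_Z_Z2_def free_product_Z_Z2_Cons) (auto simp: free_product_Z_Z2_def)

lemma inv_generator:
  "a \<in> A \<Longrightarrow> n \<noteq> 0 \<Longrightarrow> inv\<^bsub>free_product_Z_Z2 A B\<^esub> [(Inl a, n)] = [(Inl a, -n)]"
  "b \<in> B \<Longrightarrow> inv\<^bsub>free_product_Z_Z2 A B\<^esub> [(Inr b, 1)] = [(Inr b, 1)]"
proof -
  have one: "\<one>\<^bsub>free_product_Z_Z2 A B\<^esub> = []" and nil: "[] \<in> carrier (free_product_Z_Z2 A B)"
    by (simp_all add: free_product_Z_Z2_def)
  show "inv\<^bsub>free_product_Z_Z2 A B\<^esub> [(Inl a, n)] = [(Inl a, -n)]" if "a \<in> A" "n \<noteq> 0"
    by (rule group.inv_equality[OF group_free_product_Z_Z2])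
      (use that nil in \<open>auto simp: one generator_mult free_product_Z_Z2_Cons\<close>)
  show "inv\<^bsub>free_product_Z_Z2 A B\<^esub> [(Inr b, 1)] = [(Inr b, 1)]" if "b \<in> B"
    by (rule group.inv_equality[OF group_free_product_Z_Z2])
      (use that nil in \<open>auto simp: one generator_mult free_product_Z_Z2_Cons\<close>)
qed

lemma tree_group_free_product:
  "tree_group (free_product_Z_Z2 A B) (generators_Z_Z2 A B) syllables_len"
proof -
  let ?G = "free_product_Z_Z2 A B" and ?S = "generators_Z_Z2 A B"
  interpret group ?G by (rule group_free_product_Z_Z2)
  have one: "\<one>\<^bsub>?G\<^esub> = []" by (simp add: free_product_Z_Z2_def)
  show ?thesis
  proof
    show "s \<in> carrier ?G" if "s \<in> ?S" for s using that generators_closed by blast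
    show "inv\<^bsub>?G\<^esub> s \<in> ?S" if "s \<in> ?S" for s
      using that by (cases rule: generators_cases) (auto simp: inv_generator generators_Z_Z2_def)
    show "syllables_len \<one>\<^bsub>?G\<^esub> = 0" by (simp add: one)
    show "syllables_len (s \<otimes>\<^bsub>?G\<^esub> w) = Suc (syllables_len w) \<or>
        Suc (syllables_len (s \<otimes>\<^bsub>?G\<^esub> w)) = syllables_len w" if s: "s \<in> ?S" and w: "w \<in> carrier ?G" for s w
      using s
    proof (cases rule: generators_cases)
      case (1 a n)
      then show ?thesis using w
        by (cases w) (auto simp: generator_mult free_product_Z_Z2_Cons nat_eq_iff)
    next
      case (2 b)
      then show ?thesis using w by (cases w) (auto simp: generator_mult free_product_Z_Z2_Cons)
    qed
    show "\<exists>s\<in>?S. Suc (syllables_len (inv\<^bsub>?G\<^esub> s \<otimes>\<^bsub>?G\<^esub> w)) = syllables_len w"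
      if w: "w \<in> carrier ?G" "w \<noteq> \<one>\<^bsub>?G\<^esub>" for w
    proof -
      obtain p v where pv: "w = p # v" using w by (cases w) (auto simp: one)
      have "(\<exists>a\<in>A. \<exists>n. p = (Inl a, n) \<and> n \<noteq> 0) \<or> (\<exists>b\<in>B. p = (Inr b, 1))"
        using w(1) unfolding pv by (rule free_product_Z_Z2_Cons[THEN iffD1, THEN conjunct1])
      then consider a n where "a \<in> A" "n \<noteq> 0" "p = (Inl a, n)" | b where "b \<in> B" "p = (Inr b, 1)"
        by blast
      then show ?thesis
      proof cases
        case (1 a n)
        \<comment> \<open>The generator with the sign of the leading exponent takes the exponent one
          step closer to 0.\<close>
        have "sgn n = 1 \<or> sgn n = -1" using 1(2) by (simp add: sgn_if)
        then have "[(Inl a, sgn n)] \<in> ?S" using 1(1) unfolding generators_Z_Z2_def by auto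
        moreover have "Suc (syllables_len (inv\<^bsub>?G\<^esub> [(Inl a, sgn n)] \<otimes>\<^bsub>?G\<^esub> w)) = syllables_len w"
          using 1 by (auto simp: inv_generator generator_mult pv sgn_if)
        ultimately show ?thesis by blast
      next
        case (2 b)
        have "[(Inr b, 1)] \<in> ?S" using 2 by (auto simp: generators_Z_Z2_def)
        moreover have "Suc (syllables_len (inv\<^bsub>?G\<^esub> [(Inr b, 1)] \<otimes>\<^bsub>?G\<^esub> w)) = syllables_len w"
          using 2 by (auto simp: inv_generator generator_mult pv)
        ultimately show ?thesis by blast
      qed
    qed
    show "s = t" if w: "w \<in> carrier ?G" and st: "s \<in> ?S" "t \<in> ?S"
      and sh: "Suc (syllables_len (inv\<^bsub>?G\<^esub> s \<otimes>\<^bsub>?G\<^esub> w)) = syllables_len w"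
        "Suc (syllables_len (inv\<^bsub>?G\<^esub> t \<otimes>\<^bsub>?G\<^esub> w)) = syllables_len w" for w s t
    proof (cases w)
      case Nil
      then show ?thesis using sh by simp
    next
      case (Cons p v)
      \<comment> \<open>A generator that shortens the word has to act on the leading syllable and
        decrease its absolute value, so it can be read off from that syllable. For Z_2 the exponent
        is 1 and equals its sign.\<close>
      have "r = [(fst p, sgn (snd p))]"
        if "r \<in> ?S" "Suc (syllables_len (inv\<^bsub>?G\<^esub> r \<otimes>\<^bsub>?G\<^esub> w)) = syllables_len w" for r
        using that(1)
      proof (cases rule: generators_cases)
        case (1 a n)
        then show ?thesis using that(2) w unfolding Cons
          by (cases p) (auto simp: inv_generator generator_mult free_product_Z_Z2_Cons sgn_if split: if_splits)
      next
        case (2 b)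
        then show ?thesis using that(2) w unfolding Cons
          by (cases p) (auto simp: inv_generator generator_mult free_product_Z_Z2_Cons split: if_splits)
      qed
      then show ?thesis using st sh by metis
    qed
  qed
qed

section \<open>Operators on the space of square-summable functions\<close>

lemma cscale_add: "cscale c (f + g) = cscale c f + cscale c g"
  by (rule fun_l2_eqI) (simp add: distrib_left)

lemma cscale_diff: "cscale c (f - g) = cscale c f - cscale c g"
  by (rule fun_l2_eqI) (simp add: right_diff_distrib)

lemma cscale_scaleR: "cscale c (r *\<^sub>R f) = r *\<^sub>R cscale c f"
  by (rule fun_l2_eqI) simp

lemma scaleR_conv_cscale: "r *\<^sub>R f = cscale (of_real r) f"
  by (rule fun_l2_eqI) simp

lemma cscale_zero [simp]: "cscale c 0 = 0"
  by (rule fun_l2_eqI) simp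

lemma norm_cscale: "norm (cscale c f) = cmod c * norm f"
proof -
  have "(norm (cscale c f))\<^sup>2 = (cmod c * norm f)\<^sup>2"
    unfolding norm_l2_sq power_mult_distrib by (simp add: norm_mult power_mult_distrib infsum_cmult_right')
  then show ?thesis by (simp add: power2_eq_iff_nonneg)
qed

lemma bounded_linear_cscale: "bounded_linear (cscale c)"
  by (rule bounded_linear_intro[where K = "cmod c"])
    (auto simp: cscale_add cscale_scaleR norm_cscale mult.commute)

lemma bounded_linear_fun_l2: "bounded_linear (\<lambda>f. fun_l2 f x)"
  by (rule bounded_linear_intro[where K = 1]) (auto simp: cmod_fun_l2_le scaleR_conv_of_real)

lemma inner_cscale_i: "inner (cscale \<i> f) (cscale \<i> g) = inner f g"
  by (simp add: inner_l2_def algebra_simps)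

definition l2_on :: "'x set \<Rightarrow> 'x l2 set" where
  "l2_on X = {f. \<forall>x. x \<notin> X \<longrightarrow> fun_l2 f x = 0}"

lemma subspace_l2_on: "subspace (l2_on X)"
  by (auto simp: subspace_def l2_on_def)

lemma cscale_l2_on: "f \<in> l2_on X \<Longrightarrow> cscale c f \<in> l2_on X"
  by (simp add: l2_on_def)

lemma closed_l2_on: "closed (l2_on X)"
proof -
  have "l2_on X = (\<Inter>x\<in>- X. (\<lambda>f. fun_l2 f x) -` {0})"
    by (auto simp: l2_on_def)
  moreover have "closed ((\<lambda>f. fun_l2 f x) -` {0})" for x :: 'x
    by (intro continuous_closed_vimage closed_singleton
        linear_continuous_at[OF bounded_linear_fun_l2])
  ultimately show ?thesis by (metis closed_INT)
qed

lemma ell2_iff: "f \<in> ell2 X \<longleftrightarrow> (\<forall>x. x \<notin> X \<longrightarrow> f x = 0) \<and> (\<lambda>x. (cmod (f x))\<^sup>2) summable_on UNIV"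
proof -
  have "(\<lambda>x. (cmod (f x))\<^sup>2) summable_on X \<longleftrightarrow> (\<lambda>x. (cmod (f x))\<^sup>2) summable_on UNIV"
    if "\<forall>x. x \<notin> X \<longrightarrow> f x = 0"
    by (rule summable_on_cong_neutral) (use that in auto)
  then show ?thesis by (auto simp: ell2_def)
qed

lemma fun_l2_Abs: "f \<in> ell2 X \<Longrightarrow> fun_l2 (Abs_l2 f) = f"
  by (simp add: ell2_iff Abs_l2_inverse)

lemma Abs_l2_in: "f \<in> ell2 X \<Longrightarrow> Abs_l2 f \<in> l2_on X"
  by (simp add: l2_on_def fun_l2_Abs) (simp add: ell2_iff)

lemma fun_l2_in: "f \<in> l2_on X \<Longrightarrow> fun_l2 f \<in> ell2 X"
  by (auto simp: l2_on_def ell2_iff summable_fun_l2)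

lemma Abs_fun_l2 [simp]: "Abs_l2 (fun_l2 f) = f"
  by (rule fun_l2_inverse)

lemma ell2_norm_fun_l2: "f \<in> l2_on X \<Longrightarrow> ell2_norm X (fun_l2 f) = norm f"
proof -
  assume "f \<in> l2_on X"
  then have "(\<Sum>\<^sub>\<infinity>x\<in>X. (cmod (fun_l2 f x))\<^sup>2) = (\<Sum>\<^sub>\<infinity>x. (cmod (fun_l2 f x))\<^sup>2)"
    by (intro infsum_cong_neutral) (auto simp: l2_on_def)
  then show ?thesis by (simp add: ell2_norm_def flip: norm_l2_sq)
qed

lemma ell2_inner_fun_l2:
  assumes "f \<in> l2_on X"
  shows "Re (ell2_inner X (fun_l2 f) (fun_l2 g)) = inner f g"
    and "Im (ell2_inner X (fun_l2 f) (fun_l2 g)) = - inner f (cscale \<i> g)"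
proof -
  have "ell2_inner X (fun_l2 f) (fun_l2 g) = (\<Sum>\<^sub>\<infinity>x. cnj (fun_l2 f x) * fun_l2 g x)" for g
    unfolding ell2_inner_def using assms by (intro infsum_cong_neutral) (auto simp: l2_on_def)
  then have Re: "Re (ell2_inner X (fun_l2 f) (fun_l2 g)) = inner f g" for g
    unfolding inner_l2_def by (simp only: infsum_Re[OF summable_cnj_mult[OF summable_fun_l2 summable_fun_l2]])
  have "ell2_inner X (fun_l2 f) (fun_l2 (cscale \<i> g)) = \<i> * ell2_inner X (fun_l2 f) (fun_l2 g)"
    unfolding ell2_inner_def by (simp add: infsum_cmult_right'[symmetric] algebra_simps)
  then show "Re (ell2_inner X (fun_l2 f) (fun_l2 g)) = inner f g"
    "Im (ell2_inner X (fun_l2 f) (fun_l2 g)) = - inner f (cscale \<i> g)"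
    using Re[of g] Re[of "cscale \<i> g"] by simp_all
qed

definition restrict_l2 :: "'x set \<Rightarrow> 'x l2 \<Rightarrow> 'x \<Rightarrow> complex" where
  "restrict_l2 X f = (\<lambda>x. if x \<in> X then fun_l2 f x else 0)"

lemma restrict_l2_in: "restrict_l2 X f \<in> ell2 X"
proof -
  have "(\<lambda>x. (cmod (restrict_l2 X f x))\<^sup>2) summable_on UNIV"
    by (rule summable_on_comparison_test[OF summable_fun_l2[of f]]) (auto simp: restrict_l2_def)
  then show ?thesis by (auto simp: ell2_iff restrict_l2_def)
qed

lemma restrict_l2_eq: "f \<in> l2_on X \<Longrightarrow> restrict_l2 X f = fun_l2 f"
  by (auto simp: restrict_l2_def l2_on_def)

lemma norm_restrict_l2: "norm (Abs_l2 (restrict_l2 X f)) \<le> norm f"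
proof (rule norm_l2_le)
  fix F :: "'a set" assume "finite F"
  have "(\<Sum>x\<in>F. (cmod (fun_l2 (Abs_l2 (restrict_l2 X f)) x))\<^sup>2) \<le> (\<Sum>x\<in>F. (cmod (fun_l2 f x))\<^sup>2)"
    unfolding fun_l2_Abs[OF restrict_l2_in] by (intro sum_mono) (auto simp: restrict_l2_def)
  then show "(\<Sum>x\<in>F. (cmod (fun_l2 (Abs_l2 (restrict_l2 X f)) x))\<^sup>2) \<le> (norm f)\<^sup>2"
    using sum_le_norm_l2_sq[OF \<open>finite F\<close>, of f] by linarith
qed simp

text \<open>Composition with the orthogonal projection onto \<open>l2_on X\<close> makes this a
  bounded linear map on the whole type. On \<open>l2_on X\<close> it agrees with \<open>T\<close>,
  and \<open>op_of\<close> translates back.\<close>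

definition lift_op :: "'x set \<Rightarrow> 'x op \<Rightarrow> 'x l2 \<Rightarrow> 'x l2" where
  "lift_op X T f = Abs_l2 (T (restrict_l2 X f))"

definition bounded_clinear_on :: "'x set \<Rightarrow> ('x l2 \<Rightarrow> 'x l2) \<Rightarrow> bool" where
  "bounded_clinear_on X L \<longleftrightarrow> (\<forall>f\<in>l2_on X. L f \<in> l2_on X) \<and>
     (\<forall>f\<in>l2_on X. \<forall>g\<in>l2_on X. L (f + g) = L f + L g) \<and>
     (\<forall>c. \<forall>f\<in>l2_on X. L (cscale c f) = cscale c (L f)) \<and>
     (\<exists>C. \<forall>f\<in>l2_on X. norm (L f) \<le> C * norm f)"

definition op_of :: "'x set \<Rightarrow> ('x l2 \<Rightarrow> 'x l2) \<Rightarrow> 'x op" where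
  "op_of X L = (\<lambda>f. if f \<in> ell2 X then fun_l2 (L (Abs_l2 f)) else (\<lambda>x. 0))"

lemma op_of_fun_l2: "f \<in> l2_on X \<Longrightarrow> op_of X L (fun_l2 f) = fun_l2 (L f)"
  by (simp add: op_of_def fun_l2_in)

lemma op_of_in_bounded_ops:
  assumes "bounded_clinear_on X L"
  shows "op_of X L \<in> bounded_ops X"
proof -
  have L: "\<And>f. f \<in> l2_on X \<Longrightarrow> L f \<in> l2_on X"
    "\<And>f g. f \<in> l2_on X \<Longrightarrow> g \<in> l2_on X \<Longrightarrow> L (f + g) = L f + L g"
    "\<And>c f. f \<in> l2_on X \<Longrightarrow> L (cscale c f) = cscale c (L f)"
    using assms by (auto simp: bounded_clinear_on_def)
  obtain C where C: "\<And>f. f \<in> l2_on X \<Longrightarrow> norm (L f) \<le> C * norm f"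
    using assms unfolding bounded_clinear_on_def by blast
  have ex: "\<exists>F. F \<in> l2_on X \<and> f = fun_l2 F" if "f \<in> ell2 X" for f
    using that by (metis Abs_l2_in fun_l2_Abs)
  have add: "(\<lambda>x. fun_l2 F x + fun_l2 H x) = fun_l2 (F + H)" and mult: "(\<lambda>x. c * fun_l2 F x) = fun_l2 (cscale c F)"
    for F H :: "'a l2" and c by auto
  show ?thesis
    unfolding bounded_ops_def
  proof (safe)
    fix f assume "f \<in> ell2 X"
    then obtain F where F: "F \<in> l2_on X" "f = fun_l2 F" using ex by blast
    show "op_of X L f \<in> ell2 X" by (simp add: F op_of_fun_l2 fun_l2_in L)
    show "op_of X L (\<lambda>x. c * f x) = (\<lambda>x. c * op_of X L f x)" for c
      by (simp add: F op_of_fun_l2 mult cscale_l2_on L)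
    fix h assume "h \<in> ell2 X"
    then obtain H where H: "H \<in> l2_on X" "h = fun_l2 H" using ex by blast
    show "op_of X L (\<lambda>x. f x + h x) = (\<lambda>x. op_of X L f x + op_of X L h x)"
      by (simp add: F H op_of_fun_l2 add subspace_add[OF subspace_l2_on] L)
  next
    fix f assume "f \<notin> ell2 X"
    then show "op_of X L f = (\<lambda>x. 0)" by (simp add: op_of_def)
  next
    show "\<exists>C. \<forall>f\<in>ell2 X. ell2_norm X (op_of X L f) \<le> C * ell2_norm X f"
    proof (intro exI ballI)
      fix f assume "f \<in> ell2 X"
      then obtain F where F: "F \<in> l2_on X" "f = fun_l2 F" using ex by blast
      show "ell2_norm X (op_of X L f) \<le> C * ell2_norm X f"
        by (simp add: F op_of_fun_l2 ell2_norm_fun_l2 L C)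
    qed
  qed
qed

text \<open>\<open>op_norm\<close> is a supremum of reals, meaningful only for a set bounded above;
  the constant \<open>C\<close> supplies that bound, and the zero vector shows that the set is not
  empty.\<close>

lemma op_norm_op_of:
  assumes "\<And>f. f \<in> l2_on X \<Longrightarrow> L f \<in> l2_on X" "\<And>f. f \<in> l2_on X \<Longrightarrow> norm (L f) \<le> C * norm f" "C \<ge> 0"
  shows "0 \<le> op_norm X (op_of X L)" "op_norm X (op_of X L) \<le> C"
    "bounded_clinear_on X L \<Longrightarrow> f \<in> l2_on X \<Longrightarrow> norm (L f) \<le> op_norm X (op_of X L) * norm f"
proof -
  let ?B = "{f \<in> ell2 X. ell2_norm X f \<le> 1}"
  have B: "ell2_norm X (op_of X L f) \<le> C" if "f \<in> ?B" for f
  proof -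
    obtain F where F: "F \<in> l2_on X" "f = fun_l2 F" using \<open>f \<in> ?B\<close> Abs_l2_in fun_l2_Abs by (metis (no_types, lifting) mem_Collect_eq)
    have "norm F \<le> 1" using that by (simp add: F(2) ell2_norm_fun_l2[OF F(1)])
    then have "C * norm F \<le> C * 1" using assms(3) by (intro mult_left_mono)
    then show ?thesis
      using assms(2)[OF F(1)] F by (simp add: op_of_fun_l2 ell2_norm_fun_l2 assms(1))
  qed
  have bdd: "bdd_above ((\<lambda>f. ell2_norm X (op_of X L f)) ` ?B)"
    using B by (rule bdd_aboveI2)
  have up: "ell2_norm X (op_of X L f) \<le> op_norm X (op_of X L)" if "f \<in> ?B" for f
    unfolding op_norm_def by (rule cSUP_upper[OF that bdd])
  have zero: "fun_l2 0 \<in> ?B"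
    using fun_l2_in[of 0 X] ell2_norm_fun_l2[of 0 X] subspace_0[OF subspace_l2_on[of X]] by simp
  have "0 \<le> ell2_norm X (op_of X L (fun_l2 0))"
    by (simp add: ell2_norm_def infsum_nonneg)
  then show "0 \<le> op_norm X (op_of X L)" using up[OF zero] by linarith
  show "op_norm X (op_of X L) \<le> C"
    unfolding op_norm_def using zero B by (intro cSUP_least) auto
  show "norm (L f) \<le> op_norm X (op_of X L) * norm f" if L: "bounded_clinear_on X L" and f: "f \<in> l2_on X"
  proof (cases "f = 0")
    case True
    have "L (0 + 0) = L 0 + L 0"
      using L subspace_0[OF subspace_l2_on] unfolding bounded_clinear_on_def by blast
    then show ?thesis using True by simp
  next
    case False
    let ?g = "(1 / norm f) *\<^sub>R f"
    have g: "?g \<in> l2_on X" "norm ?g = 1" using f False by (auto simp: subspace_scale[OF subspace_l2_on])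
    have "norm (L ?g) \<le> op_norm X (op_of X L)"
      using up[of "fun_l2 ?g"] g by (simp add: op_of_fun_l2 ell2_norm_fun_l2 fun_l2_in assms(1))
    moreover have "L ?g = (1 / norm f) *\<^sub>R L f"
      using L f unfolding scaleR_conv_cscale bounded_clinear_on_def by blast
    ultimately show ?thesis using False by (simp add: field_simps)
  qed
qed

context
  fixes X :: "'x set" and T :: "'x op"
  assumes T: "T \<in> bounded_ops X"
begin

lemma T_in: "f \<in> ell2 X \<Longrightarrow> T f \<in> ell2 X"
  using T by (auto simp: bounded_ops_def)

lemma fun_l2_lift_op: "fun_l2 (lift_op X T f) = T (restrict_l2 X f)"
  by (simp add: lift_op_def fun_l2_Abs[OF T_in[OF restrict_l2_in]])

lemma fun_l2_lift_op_on: "f \<in> l2_on X \<Longrightarrow> fun_l2 (lift_op X T f) = T (fun_l2 f)"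
  by (simp add: fun_l2_lift_op restrict_l2_eq)

lemma lift_op_in: "lift_op X T f \<in> l2_on X"
  by (simp add: lift_op_def Abs_l2_in T_in restrict_l2_in)

lemma lift_op_add: "lift_op X T (f + g) = lift_op X T f + lift_op X T g"
proof (rule fun_l2_eqI)
  have "restrict_l2 X (f + g) = (\<lambda>x. restrict_l2 X f x + restrict_l2 X g x)"
    by (auto simp: restrict_l2_def)
  moreover have "T (\<lambda>x. restrict_l2 X f x + restrict_l2 X g x) =
      (\<lambda>x. T (restrict_l2 X f) x + T (restrict_l2 X g) x)"
    using T restrict_l2_in unfolding bounded_ops_def by blast
  ultimately show "fun_l2 (lift_op X T (f + g)) x = fun_l2 (lift_op X T f + lift_op X T g) x" for x
    by (simp add: fun_l2_lift_op)
qed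

lemma lift_op_cscale: "lift_op X T (cscale c f) = cscale c (lift_op X T f)"
proof (rule fun_l2_eqI)
  have "restrict_l2 X (cscale c f) = (\<lambda>x. c * restrict_l2 X f x)"
    by (auto simp: restrict_l2_def)
  moreover have "T (\<lambda>x. c * restrict_l2 X f x) = (\<lambda>x. c * T (restrict_l2 X f) x)"
    using T restrict_l2_in unfolding bounded_ops_def by blast
  ultimately show "fun_l2 (lift_op X T (cscale c f)) x = fun_l2 (cscale c (lift_op X T f)) x" for x
    by (simp add: fun_l2_lift_op)
qed

lemma lift_op_bounded: "\<exists>C. \<forall>f. norm (lift_op X T f) \<le> C * norm f"
proof -
  obtain C where C: "\<And>f. f \<in> ell2 X \<Longrightarrow> ell2_norm X (T f) \<le> C * ell2_norm X f"
    using T unfolding bounded_ops_def by blast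
  have "norm (lift_op X T f) \<le> max C 0 * norm f" for f
  proof -
    let ?g = "Abs_l2 (restrict_l2 X f)"
    have g: "?g \<in> l2_on X" by (rule Abs_l2_in[OF restrict_l2_in])
    have "norm (lift_op X T f) = ell2_norm X (T (restrict_l2 X f))"
      using ell2_norm_fun_l2[OF lift_op_in, of f] by (simp add: fun_l2_lift_op)
    also have "\<dots> \<le> C * ell2_norm X (restrict_l2 X f)" by (rule C[OF restrict_l2_in])
    also have "ell2_norm X (restrict_l2 X f) = norm ?g"
      using ell2_norm_fun_l2[OF g] by (simp add: fun_l2_Abs[OF restrict_l2_in])
    also have "C * norm ?g \<le> max C 0 * norm ?g" by (intro mult_right_mono) auto
    also have "\<dots> \<le> max C 0 * norm f" by (intro mult_left_mono norm_restrict_l2) auto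
    finally show ?thesis .
  qed
  then show ?thesis by blast
qed

lemma bounded_linear_lift_op: "bounded_linear (lift_op X T)"
proof -
  obtain C where "\<And>f. norm (lift_op X T f) \<le> C * norm f" using lift_op_bounded by blast
  then show ?thesis
    by (intro bounded_linear_intro[where K = C])
      (auto simp: lift_op_add scaleR_conv_cscale lift_op_cscale mult.commute)
qed

lemma bounded_clinear_on_lift_op: "bounded_clinear_on X (lift_op X T)"
  unfolding bounded_clinear_on_def
  using lift_op_in lift_op_add lift_op_cscale lift_op_bounded by blast

lemma papp_lift_op:
  assumes f: "f \<in> l2_on X"
  shows "papp p (lift_op X T) f \<in> l2_on X"
    and "fun_l2 (papp p (lift_op X T) f) = op_poly X p T (fun_l2 f)"
proof -
  have pow: "(lift_op X T ^^ i) f \<in> l2_on X" "fun_l2 ((lift_op X T ^^ i) f) = (T ^^ i) (fun_l2 f)" for i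
    using f by (induction i) (auto simp: lift_op_in fun_l2_lift_op_on)
  show "papp p (lift_op X T) f \<in> l2_on X"
    unfolding papp_def using pow by (intro subspace_sum subspace_scale subspace_l2_on) auto
  have "fun_l2 (\<Sum>i\<in>I. g i) x = (\<Sum>i\<in>I. fun_l2 (g i) x)" if "finite I" for I :: "nat set" and g :: "nat \<Rightarrow> 'x l2" and x
    using that by (induction I) auto
  then show "fun_l2 (papp p (lift_op X T) f) = op_poly X p T (fun_l2 f)"
    using f by (simp add: fun_eq_iff papp_def op_poly_def fun_l2_in pow(2))
qed

lemma papp_lift_op_cscale: "papp p (lift_op X T) (cscale c f) = cscale c (papp p (lift_op X T) f)"
  by (induction p)
    (auto simp: papp_pCons[OF bounded_linear.linear[OF bounded_linear_lift_op]] cscale_add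
      cscale_scaleR lift_op_cscale)

text \<open>Coercivity gives surjectivity by the Lax-Milgram argument, and injectivity together with
  a bounded inverse by the lower bound. The sign of \<open>s\<close> allows t to lie on either side
  of the spectrum.\<close>

lemma not_in_op_spectrumI:
  assumes "s \<noteq> 0" "\<epsilon> > 0" and coercive:
    "\<And>f. f \<in> l2_on X \<Longrightarrow> \<epsilon> * (norm f)\<^sup>2 \<le> inner f (s *\<^sub>R (lift_op X T f - t *\<^sub>R f))"
  shows "complex_of_real t \<notin> op_spectrum X T"
proof -
  interpret T: bounded_linear "lift_op X T" by (rule bounded_linear_lift_op)
  define R where "R f = lift_op X T f - t *\<^sub>R f" for f
  have R_in: "R f \<in> l2_on X" if "f \<in> l2_on X" for f
    unfolding R_def using that by (intro subspace_diff subspace_scale subspace_l2_on lift_op_in)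
  have R_diff: "R (f - g) = R f - R g" for f g by (simp add: R_def T.diff algebra_simps)
  have R_add: "R (f + g) = R f + R g" for f g by (simp add: R_def T.add algebra_simps)
  have R_cscale: "R (cscale c f) = cscale c (R f)" for c f
    by (simp add: R_def cscale_diff cscale_scaleR lift_op_cscale)
  have surj: "\<exists>f\<in>l2_on X. R f = g" if "g \<in> l2_on X" for g
  proof -
    have "\<exists>f\<in>l2_on X. s *\<^sub>R R f = s *\<^sub>R g"
    proof (rule coercive_surj[OF subspace_l2_on closed_l2_on])
      show "bounded_linear (\<lambda>f. s *\<^sub>R R f)"
        unfolding R_def
        by (intro bounded_linear_const_scaleR bounded_linear_sub bounded_linear_scaleR_right
            bounded_linear_lift_op)
    qed (use assms R_in that in \<open>auto simp: R_def intro: subspace_scale[OF subspace_l2_on]\<close>)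
    then show ?thesis using assms(1) by auto
  qed
  have "bdd_below_on (l2_on X) (\<lambda>f. s *\<^sub>R R f)"
    by (rule bdd_below_on_coercive[OF assms(2)]) (use coercive in \<open>simp add: R_def\<close>)
  then obtain e where e: "e > 0" "\<And>f. f \<in> l2_on X \<Longrightarrow> e * norm f \<le> norm (s *\<^sub>R R f)"
    unfolding bdd_below_on_def by blast
  have inj: "f = g" if "f \<in> l2_on X" "g \<in> l2_on X" "R f = R g" for f g
  proof -
    have "e * norm (f - g) \<le> norm (s *\<^sub>R R (f - g))"
      by (rule e) (use that in \<open>simp add: subspace_diff[OF subspace_l2_on]\<close>)
    then show ?thesis using that(3) e(1) by (simp add: R_diff mult_le_0_iff)
  qed
  define L where "L g = (SOME f. f \<in> l2_on X \<and> R f = g)" for g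
  have L: "L g \<in> l2_on X" "R (L g) = g" if "g \<in> l2_on X" for g
    using someI_ex[of "\<lambda>f. f \<in> l2_on X \<and> R f = g"] surj[OF that] unfolding L_def by blast+
  have L_eq: "L g = f" if "f \<in> l2_on X" "R f = g" for f g
    using that L[of g] R_in[of f] inj[of "L g" f] by auto
  have "bounded_clinear_on X L"
    unfolding bounded_clinear_on_def
  proof (intro conjI ballI allI)
    fix f assume f: "f \<in> l2_on X"
    show "L f \<in> l2_on X" using L f by blast
    show "L (cscale c f) = cscale c (L f)" for c
      by (rule L_eq) (use L f in \<open>auto simp: cscale_l2_on R_cscale\<close>)
    fix g assume g: "g \<in> l2_on X"
    show "L (f + g) = L f + L g"
      by (rule L_eq) (use L f g in \<open>auto simp: subspace_add[OF subspace_l2_on] R_add\<close>)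
  next
    show "\<exists>C. \<forall>f\<in>l2_on X. norm (L f) \<le> C * norm f"
    proof (intro exI ballI)
      fix f assume f: "f \<in> l2_on X"
      have "e * norm (L f) \<le> norm (s *\<^sub>R R (L f))" using e L f by blast
      then show "norm (L f) \<le> (\<bar>s\<bar> / e) * norm f"
        using e(1) L f by (simp add: field_simps)
    qed
  qed
  then have "op_of X L \<in> bounded_ops X" by (rule op_of_in_bounded_ops)
  moreover have "op_of X L (\<lambda>x. T f x - complex_of_real t * f x) = f \<and>
      (\<lambda>x. T (op_of X L f) x - complex_of_real t * op_of X L f x) = f" if "f \<in> ell2 X" for f
  proof -
    define F where "F = Abs_l2 f"
    have F: "F \<in> l2_on X" "f = fun_l2 F" using that by (simp_all add: F_def Abs_l2_in fun_l2_Abs)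
    have RF: "(\<lambda>x. T (fun_l2 F) x - complex_of_real t * fun_l2 F x) = fun_l2 (R F)" if "F \<in> l2_on X" for F
      using that by (auto simp: R_def fun_l2_lift_op_on)
    show ?thesis
      using F RF[of F] RF[of "L F"] L[of F] L_eq[of F "R F"] R_in[of F]
      by (simp add: op_of_fun_l2)
  qed
  ultimately show ?thesis unfolding op_spectrum_def by blast
qed

lemma bdd_below_if_not_in_op_spectrum:
  assumes "complex_of_real t \<notin> op_spectrum X T"
  shows "bdd_below_on (l2_on X) (\<lambda>f. lift_op X T f - t *\<^sub>R f)"
proof -
  obtain S where S: "S \<in> bounded_ops X"
    "\<And>f. f \<in> ell2 X \<Longrightarrow> S (\<lambda>x. T f x - complex_of_real t * f x) = f"
    using assms unfolding op_spectrum_def by blast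
  obtain C where C: "\<And>f. f \<in> ell2 X \<Longrightarrow> ell2_norm X (S f) \<le> C * ell2_norm X f"
    using S(1) unfolding bounded_ops_def by blast
  show ?thesis
    unfolding bdd_below_on_def
  proof (intro exI conjI ballI)
    show "1 / max C 1 > 0" by simp
    fix f assume f: "f \<in> l2_on X"
    let ?h = "lift_op X T f - t *\<^sub>R f"
    have h: "?h \<in> l2_on X" using f by (intro subspace_diff subspace_scale subspace_l2_on lift_op_in)
    have hx: "fun_l2 ?h = (\<lambda>x. T (fun_l2 f) x - complex_of_real t * fun_l2 f x)"
      using f by (auto simp: fun_l2_lift_op_on)
    have "norm f = ell2_norm X (S (fun_l2 ?h))"
      unfolding hx using S(2)[OF fun_l2_in[OF f]] f by (simp add: ell2_norm_fun_l2)
    also have "\<dots> \<le> C * norm ?h"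
      using C[OF fun_l2_in[OF h]] by (simp only: ell2_norm_fun_l2[OF h])
    also have "\<dots> \<le> max C 1 * norm ?h" by (intro mult_right_mono) auto
    finally show "1 / max C 1 * norm f \<le> norm ?h" by (simp add: field_simps)
  qed
qed

end

lemma op_of_lift_op:
  assumes "S \<in> bounded_ops X"
  shows "S = op_of X (lift_op X S)"
proof
  fix f
  show "S f = op_of X (lift_op X S) f"
  proof (cases "f \<in> ell2 X")
    case True
    then show ?thesis
      by (simp add: op_of_def fun_l2_lift_op_on[OF assms Abs_l2_in[OF True]] fun_l2_Abs)
  next
    case False
    then show ?thesis using assms by (simp add: op_of_def bounded_ops_def)
  qed
qed

text \<open>Symmetry does not follow from positivity over the reals; it comes from the complex
  structure. The form of \<open>T\<close> is real, so the imaginary parts vanish, and polarising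
  this at f and i g gives the symmetry of the real inner product.\<close>

lemma positive_op_lift_op:
  assumes T: "positive_op X T"
  shows "f \<in> l2_on X \<Longrightarrow> inner f (lift_op X T f) \<ge> 0"
    and "f \<in> l2_on X \<Longrightarrow> g \<in> l2_on X \<Longrightarrow> inner f (lift_op X T g) = inner (lift_op X T f) g"
proof -
  have TB: "T \<in> bounded_ops X" using T by (simp add: positive_op_def)
  interpret T: bounded_linear "lift_op X T" by (rule bounded_linear_lift_op[OF TB])
  have pos: "inner f (lift_op X T f) \<ge> 0" "inner f (cscale \<i> (lift_op X T f)) = 0" if "f \<in> l2_on X" for f
  proof -
    have "ell2_inner X (fun_l2 f) (T (fun_l2 f)) \<in> \<real>\<^sub>\<ge>\<^sub>0"
      using T fun_l2_in[OF that] by (auto simp: positive_op_def)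
    then show "inner f (lift_op X T f) \<ge> 0" "inner f (cscale \<i> (lift_op X T f)) = 0"
      using ell2_inner_fun_l2[OF that, of "lift_op X T f"]
      by (auto simp: fun_l2_lift_op_on[OF TB that] complex_nonneg_Reals_iff)
  qed
  show "f \<in> l2_on X \<Longrightarrow> inner f (lift_op X T f) \<ge> 0" by (rule pos)
  have polar: "inner f (cscale \<i> (lift_op X T g)) + inner g (cscale \<i> (lift_op X T f)) = 0"
    if "f \<in> l2_on X" "g \<in> l2_on X" for f g
    using pos(2)[of "f + g"] pos(2)[of f] pos(2)[of g] that
    by (simp add: subspace_add[OF subspace_l2_on] T.add cscale_add inner_add_left inner_add_right)
  assume f: "f \<in> l2_on X" and g: "g \<in> l2_on X"
  have "cscale \<i> (lift_op X T (cscale \<i> g)) = - lift_op X T g"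
    by (rule fun_l2_eqI) (simp add: lift_op_cscale[OF TB])
  then show "inner f (lift_op X T g) = inner (lift_op X T f) g"
    using polar[OF f cscale_l2_on[OF g, of \<i>]] by (simp add: inner_cscale_i inner_commute)
qed

section \<open>Continuous functional calculus of positive operators\<close>

lemma uniform_limit_poly_exists:
  fixes \<phi> :: "real \<Rightarrow> real"
  assumes "continuous_on {a..b} \<phi>"
  obtains p where "uniform_limit {a..b} (\<lambda>n. poly (p n)) \<phi> sequentially"
proof -
  have "\<exists>p. \<forall>t\<in>{a..b}. \<bar>\<phi> t - poly p t\<bar> < 1 / real (Suc n)" for n
  proof -
    obtain g where g: "real_polynomial_function g" "\<And>t. t \<in> {a..b} \<Longrightarrow> \<bar>\<phi> t - g t\<bar> < 1 / real (Suc n)"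
      using Stone_Weierstrass_real_polynomial_function[OF compact_Icc assms, of "1 / real (Suc n)"] by auto
    obtain c m where "g = (\<lambda>x. \<Sum>i\<le>m. c i * x ^ i)"
      using g(1) unfolding real_polynomial_function_iff_sum by blast
    then have "g t = poly (\<Sum>i\<le>m. monom (c i) i) t" for t
      by (simp add: poly_sum poly_monom)
    then show ?thesis using g(2) by metis
  qed
  then obtain p where p: "\<And>n t. t \<in> {a..b} \<Longrightarrow> \<bar>\<phi> t - poly (p n) t\<bar> < 1 / real (Suc n)"
    by metis
  have "uniform_limit {a..b} (\<lambda>n. poly (p n)) \<phi> sequentially"
  proof (rule uniform_limitI)
    fix e :: real assume "e > 0"
    then obtain N where N: "1 / real (Suc N) < e" using nat_approx_posE by blast
    have "dist (poly (p n) t) (\<phi> t) < e" if "n \<ge> N" "t \<in> {a..b}" for n t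
    proof -
      have "1 / real (Suc n) \<le> 1 / real (Suc N)" using that by (simp add: frac_le)
      then show ?thesis using p[OF that(2), of n] N by (simp add: dist_real_def abs_minus_commute)
    qed
    then show "\<forall>\<^sub>F n in sequentially. \<forall>t\<in>{a..b}. dist (poly (p n) t) (\<phi> t) < e"
      unfolding eventually_sequentially by blast
  qed
  then show thesis by (rule that)
qed

lemma finite_support_in_ell2:
  assumes "finite F" "F \<subseteq> X" "\<And>x. x \<notin> F \<Longrightarrow> f x = 0"
  shows "f \<in> ell2 X"
proof -
  have "(\<lambda>x. (cmod (f x))\<^sup>2) summable_on UNIV \<longleftrightarrow> (\<lambda>x. (cmod (f x))\<^sup>2) summable_on F"
    using assms(3) by (intro summable_on_cong_neutral) auto
  then show ?thesis using assms by (auto simp: ell2_iff)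
qed

lemma delta_in_ell2: "x \<in> X \<Longrightarrow> delta x \<in> ell2 X"
  by (rule finite_support_in_ell2[of "{x}"]) (auto simp: delta_def)

locale positive_operator =
  fixes X :: "'x set" and T :: "'x op" and K :: real
  assumes positive: "positive_op X T" and nonempty: "X \<noteq> {}"
    and norm_le: "\<And>f. f \<in> l2_on X \<Longrightarrow> norm (lift_op X T f) \<le> K * norm f"
begin

lemma bounded_op: "T \<in> bounded_ops X"
  using positive by (simp add: positive_op_def)

abbreviation "V \<equiv> l2_on X"
abbreviation "T' \<equiv> lift_op X T"

sublocale selfadjoint_op V T'
proof (rule selfadjoint_op.intro)
  obtain x where x: "x \<in> X" using nonempty by blast
  have "fun_l2 (Abs_l2 (delta x)) x = 1"
    unfolding fun_l2_Abs[OF delta_in_ell2[OF x]] by (simp add: delta_def)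
  then have "Abs_l2 (delta x) \<noteq> 0" by auto
  then show "V \<noteq> {0}" using Abs_l2_in[OF delta_in_ell2[OF x]] by blast
qed (simp_all add: subspace_l2_on closed_l2_on bounded_linear_lift_op bounded_op lift_op_in
    positive_op_lift_op[OF positive])

lemma K_nonneg: "K \<ge> 0"
proof -
  obtain f where "f \<in> V" "f \<noteq> 0" using nontrivial subspace_0[OF subspace_V] by blast
  then show ?thesis using norm_le[of f] norm_ge_zero[of "T' f"] by (smt (verit) norm_eq_zero mult_neg_pos zero_less_norm_iff)
qed

text \<open>For t < 0, positivity makes T - t coercive with constant -t; for t > K, the norm bound
  makes t - T coercive with constant t - K.\<close>

lemma op_spectrum_bounds:
  assumes "complex_of_real t \<in> op_spectrum X T"
  shows "t \<in> {0..K}"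
proof (rule ccontr)
  assume "t \<notin> {0..K}"
  then consider "t < 0" | "t > K" by fastforce
  then have "complex_of_real t \<notin> op_spectrum X T"
  proof cases
    case 1
    show ?thesis
    proof (rule not_in_op_spectrumI[OF bounded_op, of 1 "-t"])
      fix f assume f: "f \<in> V"
      show "- t * (norm f)\<^sup>2 \<le> inner f (1 *\<^sub>R (T' f - t *\<^sub>R f))"
        using positive_op_lift_op(1)[OF positive f] by (simp add: inner_diff_right dot_square_norm)
    qed (use 1 in auto)
  next
    case 2
    show ?thesis
    proof (rule not_in_op_spectrumI[OF bounded_op, of "-1" "t - K"])
      fix f assume f: "f \<in> V"
      have "inner f (T' f) \<le> norm f * (K * norm f)"
        using norm_cauchy_schwarz[of f "T' f"] mult_left_mono[OF norm_le[OF f], of "norm f"] by simp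
      then show "(t - K) * (norm f)\<^sup>2 \<le> inner f (-1 *\<^sub>R (T' f - t *\<^sub>R f))"
        by (simp add: inner_diff_right dot_square_norm algebra_simps power2_eq_square)
    qed (use 2 in auto)
  qed
  then show False using assms by blast
qed

lemma approx_spectrum_subset_op_spectrum:
  "t \<in> approx_spectrum \<Longrightarrow> complex_of_real t \<in> op_spectrum X T"
  using bdd_below_if_not_in_op_spectrum[OF bounded_op] unfolding approx_spectrum_def by blast

lemma approx_spectrum_bounds: "t \<in> approx_spectrum \<Longrightarrow> t \<in> {0..K}"
  using approx_spectrum_subset_op_spectrum op_spectrum_bounds by blast

lemma bounded_clinear_on_papp: "bounded_clinear_on X (papp p T')"
proof -
  obtain C where "\<And>f. norm (papp p T' f) \<le> C * norm f" using papp_bounded by blast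
  then show ?thesis
    unfolding bounded_clinear_on_def
    using papp_in linear_add[OF linear_papp[OF linear]] papp_lift_op_cscale[OF bounded_op] by blast
qed

lemma bounded_clinear_on_diff:
  assumes "bounded_clinear_on X L" "bounded_clinear_on X M"
  shows "bounded_clinear_on X (\<lambda>f. L f - M f)"
proof -
  obtain C where C: "\<And>f. f \<in> V \<Longrightarrow> norm (L f) \<le> C * norm f"
    using assms(1) unfolding bounded_clinear_on_def by blast
  obtain D where D: "\<And>f. f \<in> V \<Longrightarrow> norm (M f) \<le> D * norm f"
    using assms(2) unfolding bounded_clinear_on_def by blast
  have "norm (L f - M f) \<le> (C + D) * norm f" if "f \<in> V" for f
    using C[OF that] D[OF that] norm_triangle_ineq4[of "L f" "M f"] by (simp add: distrib_right)
  then show ?thesis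
    using assms unfolding bounded_clinear_on_def
    by (auto simp: cscale_diff intro!: subspace_diff[OF subspace_V])
qed

text \<open>
  The norm of \<open>p(T)\<close> is controlled by the supremum of \<open>p\<close> on the spectrum, so \<open>p\<^sub>n(T)\<close> converges
  as soon as \<open>p\<^sub>n\<close> converges uniformly there, and the limit does not depend on \<open>p\<^sub>n\<close>.
\<close>

theorem op_fun_tendsto:
  assumes p: "uniform_limit {0..K} (\<lambda>n. poly (p n)) \<phi> sequentially" and f: "f \<in> V"
  shows "op_fun X \<phi> T (fun_l2 f) \<in> ell2 X"
    and "(\<lambda>n. papp (p n) T' f) \<longlonglongrightarrow> Abs_l2 (op_fun X \<phi> T (fun_l2 f))"
proof -
  let ?\<sigma> = "{t. complex_of_real t \<in> op_spectrum X T}"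
  define L where "L f = lim (\<lambda>n. papp (p n) T' f)" for f
  have pe: "\<exists>N. \<forall>n\<ge>N. \<forall>t\<in>{0..K}. \<bar>poly (p n) t - \<phi> t\<bar> < e" if "e > 0" for e
    using p that unfolding uniform_limit_sequentially_iff dist_real_def by blast
  have diff: "norm (papp q T' f - papp r T' f) \<le> e * norm f"
    if "f \<in> V" "\<And>t. t \<in> approx_spectrum \<Longrightarrow> \<bar>poly q t - poly r t\<bar> \<le> e" for q r e f
    using papp_norm_le[of "q - r" e f] that by (simp add: papp_minus)
  have L: "(\<lambda>n. papp (p n) T' f) \<longlonglongrightarrow> L f" if f: "f \<in> V" for f
  proof -
    have "Cauchy (\<lambda>n. papp (p n) T' f)"
    proof (rule CauchyI)
      fix e :: real assume e: "e > 0"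
      define d where "d = e / (2 * (norm f + 1))"
      have d: "d > 0" "2 * d * norm f < e"
        using e norm_ge_zero[of f] by (auto simp: d_def field_simps add_pos_nonneg)
      obtain N where N: "\<And>n t. n \<ge> N \<Longrightarrow> t \<in> {0..K} \<Longrightarrow> \<bar>poly (p n) t - \<phi> t\<bar> < d"
        using pe[OF d(1)] by blast
      have "norm (papp (p m) T' f - papp (p n) T' f) < e" if "m \<ge> N" "n \<ge> N" for m n
      proof -
        have "norm (papp (p m) T' f - papp (p n) T' f) \<le> 2 * d * norm f"
        proof (rule diff[OF f])
          fix t assume "t \<in> approx_spectrum"
          then have "t \<in> {0..K}" by (rule approx_spectrum_bounds)
          then show "\<bar>poly (p m) t - poly (p n) t\<bar> \<le> 2 * d"
            using N[OF that(1)] N[OF that(2)] by (smt (verit))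
        qed
        then show ?thesis using d(2) by linarith
      qed
      then show "\<exists>N. \<forall>m\<ge>N. \<forall>n\<ge>N. norm (papp (p m) T' f - papp (p n) T' f) < e" by blast
    qed
    then show ?thesis
      unfolding L_def using Cauchy_convergent convergent_LIMSEQ_iff by blast
  qed
  \<comment> \<open>Here \<open>q\<close> is controlled on the spectrum only, and \<open>p n\<close>
    on all of \<open>{0..K}\<close>. The norm bound evaluates both on the approximate spectrum,
    which is contained in either set.\<close>
  have close: "norm (papp q T' f - L f) \<le> e * norm f"
    if f: "f \<in> V" and q: "\<And>t. t \<in> ?\<sigma> \<Longrightarrow> \<bar>poly q t - \<phi> t\<bar> \<le> e" for q e f
  proof (rule field_le_epsilon)
    fix c :: real assume c: "c > 0"
    define d where "d = c / (norm f + 1)"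
    have d: "d > 0" "d * norm f \<le> c"
      using c norm_ge_zero[of f] by (auto simp: d_def field_simps add_pos_nonneg)
    obtain N where N: "\<And>n t. n \<ge> N \<Longrightarrow> t \<in> {0..K} \<Longrightarrow> \<bar>poly (p n) t - \<phi> t\<bar> < d"
      using pe[OF d(1)] by blast
    have "norm (papp q T' f - papp (p n) T' f) \<le> e * norm f + c" if "n \<ge> N" for n
    proof -
      have "norm (papp q T' f - papp (p n) T' f) \<le> (e + d) * norm f"
      proof (rule diff[OF f])
        fix t assume t: "t \<in> approx_spectrum"
        have "\<bar>poly q t - \<phi> t\<bar> \<le> e" "\<bar>poly (p n) t - \<phi> t\<bar> < d"
          using q N[OF that] approx_spectrum_subset_op_spectrum[OF t] approx_spectrum_bounds[OF t] by auto
        then show "\<bar>poly q t - poly (p n) t\<bar> \<le> e + d" by linarith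
      qed
      then show ?thesis using d(2) by (simp add: distrib_right)
    qed
    moreover have "(\<lambda>n. norm (papp q T' f - papp (p n) T' f)) \<longlonglongrightarrow> norm (papp q T' f - L f)"
      by (intro tendsto_intros L f)
    ultimately show "norm (papp q T' f - L f) \<le> e * norm f + c"
      by (intro LIMSEQ_le_const2) auto
  qed
  have bL: "bounded_clinear_on X L"
    unfolding bounded_clinear_on_def
  proof (intro conjI ballI allI)
    fix f assume f: "f \<in> V"
    show "L f \<in> V" by (rule closed_sequentially[OF closed_V _ L[OF f]]) (rule papp_in[OF f])
    show "L (cscale c f) = cscale c (L f)" for c
    proof (rule LIMSEQ_unique[OF L])
      have "(\<lambda>n. cscale c (papp (p n) T' f)) \<longlonglongrightarrow> cscale c (L f)"
        by (rule bounded_linear.tendsto[OF bounded_linear_cscale L[OF f]])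
      then show "(\<lambda>n. papp (p n) T' (cscale c f)) \<longlonglongrightarrow> cscale c (L f)"
        by (simp add: papp_lift_op_cscale[OF bounded_op])
    qed (rule cscale_l2_on[OF f])
    fix g assume g: "g \<in> V"
    show "L (f + g) = L f + L g"
    proof (rule LIMSEQ_unique[OF L])
      show "(\<lambda>n. papp (p n) T' (f + g)) \<longlonglongrightarrow> L f + L g"
        unfolding linear_add[OF linear_papp[OF linear]] by (intro tendsto_add L f g)
    qed (rule subspace_add[OF subspace_V f g])
  next
    obtain N where N: "\<And>t. t \<in> {0..K} \<Longrightarrow> \<bar>poly (p N) t - \<phi> t\<bar> < 1"
      using pe[OF zero_less_one] by blast
    obtain C where C: "\<And>f. norm (papp (p N) T' f) \<le> C * norm f" using papp_bounded by blast
    have "norm (L f) \<le> (C + 1) * norm f" if f: "f \<in> V" for f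
    proof -
      have "norm (papp (p N) T' f - L f) \<le> 1 * norm f"
        by (rule close[OF f]) (use N op_spectrum_bounds in \<open>auto intro: less_imp_le\<close>)
      then show ?thesis
        using C[of f] norm_triangle_sub[of "L f" "papp (p N) T' f"]
        by (simp add: norm_minus_commute distrib_right)
    qed
    then show "\<exists>C. \<forall>f\<in>V. norm (L f) \<le> C * norm f" by blast
  qed
  have op_poly: "op_poly X q T = op_of X (papp q T')" for q
  proof
    fix f
    show "op_poly X q T f = op_of X (papp q T') f"
    proof (cases "f \<in> ell2 X")
      case True
      then show ?thesis
        using papp_lift_op(2)[OF bounded_op Abs_l2_in[OF True], of q] by (simp add: op_of_def fun_l2_Abs)
    qed (simp add: op_of_def op_poly_def)
  qed
  have diff_op: "(\<lambda>f x. op_poly X q T f x - op_of X M f x) = op_of X (\<lambda>f. papp q T' f - M f)" for q M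
    by (auto simp: op_poly op_of_def fun_eq_iff)
  define P where "P S \<longleftrightarrow> S \<in> bounded_ops X \<and>
     (\<forall>q. uniform_limit ?\<sigma> (\<lambda>n. poly (q n)) \<phi> sequentially
        \<longrightarrow> (\<lambda>n. op_norm X (\<lambda>f x. op_poly X (q n) T f x - S f x)) \<longlonglongrightarrow> 0)" for S
  have "P (op_of X L)"
    unfolding P_def
  proof (intro conjI allI impI)
    show "op_of X L \<in> bounded_ops X" by (rule op_of_in_bounded_ops[OF bL])
    fix q :: "nat \<Rightarrow> real poly" assume q: "uniform_limit ?\<sigma> (\<lambda>n. poly (q n)) \<phi> sequentially"
    show "(\<lambda>n. op_norm X (\<lambda>f x. op_poly X (q n) T f x - op_of X L f x)) \<longlonglongrightarrow> 0"
    proof (rule LIMSEQ_I)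
      fix e :: real assume e: "e > 0"
      have "e / 2 > 0" using e by simp
      then obtain N where N: "\<And>n t. n \<ge> N \<Longrightarrow> t \<in> ?\<sigma> \<Longrightarrow> \<bar>poly (q n) t - \<phi> t\<bar> < e / 2"
        using q unfolding uniform_limit_sequentially_iff dist_real_def by blast
      have "norm (op_norm X (\<lambda>f x. op_poly X (q n) T f x - op_of X L f x) - 0) < e" if "n \<ge> N" for n
      proof -
        have 1: "norm (papp (q n) T' f - L f) \<le> e / 2 * norm f" if "f \<in> V" for f
          by (rule close[OF that less_imp_le[OF N[OF \<open>n \<ge> N\<close>]]])
        have 2: "papp (q n) T' f - L f \<in> V" if "f \<in> V" for f
          using bounded_clinear_on_diff[OF bounded_clinear_on_papp bL] that
          unfolding bounded_clinear_on_def by blast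
        show ?thesis
          unfolding diff_op using op_norm_op_of(1,2)[OF 2 1] e by simp
      qed
      then show "\<exists>N. \<forall>n\<ge>N. norm (op_norm X (\<lambda>f x. op_poly X (q n) T f x - op_of X L f x) - 0) < e" by blast
    qed
  qed
  \<comment> \<open>The given \<open>p\<close> converges uniformly on the spectrum too, so the
    condition in \<open>P\<close> is not vacuous: every candidate is the limit of the same
    \<open>papp (p n)\<close>.\<close>
  moreover have "S = op_of X L" if S: "P S" for S
  proof -
    have SB: "S \<in> bounded_ops X" using S by (simp add: P_def)
    have S_eq: "S = op_of X (lift_op X S)" by (rule op_of_lift_op[OF SB])
    have bcl: "bounded_clinear_on X (\<lambda>f. papp (p n) T' f - lift_op X S f)" for n
      by (intro bounded_clinear_on_diff bounded_clinear_on_papp bounded_clinear_on_lift_op SB)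
    have "uniform_limit ?\<sigma> (\<lambda>n. poly (p n)) \<phi> sequentially"
      by (rule uniform_limit_on_subset[OF p]) (use op_spectrum_bounds in blast)
    then have "(\<lambda>n. op_norm X (\<lambda>f x. op_poly X (p n) T f x - S f x)) \<longlonglongrightarrow> 0"
      using S by (simp add: P_def)
    then have lim0: "(\<lambda>n. op_norm X (op_of X (\<lambda>f. papp (p n) T' f - lift_op X S f))) \<longlonglongrightarrow> 0"
      by (subst (asm) S_eq) (simp only: diff_op)
    have "lift_op X S f = L f" if f: "f \<in> V" for f
    proof -
      have le: "norm (papp (p n) T' f - lift_op X S f) \<le>
          op_norm X (op_of X (\<lambda>f. papp (p n) T' f - lift_op X S f)) * norm f" for n
      proof -
        obtain C where C: "\<And>f. f \<in> V \<Longrightarrow> norm (papp (p n) T' f - lift_op X S f) \<le> C * norm f"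
          and in_V: "\<And>f. f \<in> V \<Longrightarrow> papp (p n) T' f - lift_op X S f \<in> V"
          using bcl[of n] unfolding bounded_clinear_on_def by blast
        have "norm (papp (p n) T' f - lift_op X S f) \<le> max C 0 * norm f" if "f \<in> V" for f
          using C[OF that] mult_right_mono[of C "max C 0" "norm f"] by simp
        from op_norm_op_of(3)[OF in_V this _ bcl f] show ?thesis by simp
      qed
      have "(\<lambda>n. op_norm X (op_of X (\<lambda>f. papp (p n) T' f - lift_op X S f)) * norm f) \<longlonglongrightarrow> 0"
        using tendsto_mult_left_zero[OF lim0] .
      then have "(\<lambda>n. papp (p n) T' f - lift_op X S f) \<longlonglongrightarrow> 0"
        by (rule Lim_null_comparison[rotated]) (use le in simp)
      then have "(\<lambda>n. papp (p n) T' f) \<longlonglongrightarrow> lift_op X S f" by (simp add: LIM_zero_iff)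
      then show ?thesis using L[OF f] LIMSEQ_unique by blast
    qed
    then show ?thesis
      by (subst S_eq) (auto simp: op_of_def Abs_l2_in fun_eq_iff)
  qed
  ultimately have "op_fun X \<phi> T = op_of X L"
    unfolding op_fun_def P_def[symmetric] by (rule the_equality)
  moreover have "L f \<in> V" using bL f unfolding bounded_clinear_on_def by blast
  ultimately show "op_fun X \<phi> T (fun_l2 f) \<in> ell2 X"
    and "(\<lambda>n. papp (p n) T' f) \<longlonglongrightarrow> Abs_l2 (op_fun X \<phi> T (fun_l2 f))"
    using L[OF f] f by (simp_all add: op_of_fun_l2 fun_l2_in)
qed

end

section \<open>The entropy of the square of a positive operator\<close>

lemma inner_cscale_i_self: "inner f (cscale \<i> f) = 0"
  by (simp add: inner_l2_def algebra_simps)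

lemma lift_op_comp:
  assumes "S \<in> bounded_ops X" "T \<in> bounded_ops X"
  shows "lift_op X (S \<circ> T) f = lift_op X S (lift_op X T f)"
  using fun_l2_lift_op_on[OF assms(1) lift_op_in[OF assms(2)], of f]
  by (intro fun_l2_eqI) (simp add: lift_op_def[of X "S \<circ> T"] fun_l2_Abs[OF T_in[OF assms(1) T_in[OF assms(2) restrict_l2_in]]]
      fun_l2_lift_op[OF assms(2)])

lemma bounded_ops_comp:
  assumes S: "S \<in> bounded_ops X" and T: "T \<in> bounded_ops X"
  shows "S \<circ> T \<in> bounded_ops X"
proof -
  obtain C where C: "\<And>f. norm (lift_op X S f) \<le> C * norm f" using lift_op_bounded[OF S] by blast
  obtain D where D: "\<And>f. norm (lift_op X T f) \<le> D * norm f" using lift_op_bounded[OF T] by blast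
  have "norm (lift_op X S (lift_op X T f)) \<le> (max C 0 * D) * norm f" for f
  proof -
    have "norm (lift_op X S (lift_op X T f)) \<le> C * norm (lift_op X T f)" by (rule C)
    also have "\<dots> \<le> max C 0 * norm (lift_op X T f)" by (intro mult_right_mono) auto
    also have "\<dots> \<le> max C 0 * (D * norm f)" by (intro mult_left_mono D) auto
    finally show ?thesis by (simp add: mult.assoc)
  qed
  then have "bounded_clinear_on X (\<lambda>f. lift_op X S (lift_op X T f))"
    unfolding bounded_clinear_on_def
    using lift_op_in[OF S] lift_op_add[OF S] lift_op_add[OF T] lift_op_cscale[OF S] lift_op_cscale[OF T]
    by auto
  then have "op_of X (\<lambda>f. lift_op X S (lift_op X T f)) \<in> bounded_ops X" by (rule op_of_in_bounded_ops)
  moreover have "S \<circ> T = op_of X (\<lambda>f. lift_op X S (lift_op X T f))"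
  proof
    fix f
    show "(S \<circ> T) f = op_of X (\<lambda>f. lift_op X S (lift_op X T f)) f"
    proof (cases "f \<in> ell2 X")
      case True
      then show ?thesis
        by (simp add: op_of_def fun_l2_lift_op_on[OF S lift_op_in[OF T]]
            fun_l2_lift_op_on[OF T Abs_l2_in[OF True]] fun_l2_Abs)
    next
      case False
      have "S (fun_l2 0) = fun_l2 (lift_op X S 0)"
        by (rule fun_l2_lift_op_on[OF S, symmetric]) (rule subspace_0[OF subspace_l2_on])
      also have "lift_op X S 0 = 0" by (rule linear_0[OF bounded_linear.linear[OF bounded_linear_lift_op[OF S]]])
      finally have "S (\<lambda>x. 0) = (\<lambda>x. 0)" by (simp add: fun_eq_iff zero_l2.rep_eq)
      then show ?thesis using False T by (simp add: op_of_def bounded_ops_def)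
    qed
  qed
  ultimately show ?thesis by simp
qed

lemma positive_op_square:
  assumes "positive_op X x"
  shows "positive_op X (x \<circ> x)"
  unfolding positive_op_def
proof (intro conjI ballI)
  have x: "x \<in> bounded_ops X" using assms by (simp add: positive_op_def)
  show "x \<circ> x \<in> bounded_ops X" by (rule bounded_ops_comp[OF x x])
  fix f assume f: "f \<in> ell2 X"
  let ?F = "Abs_l2 f" and ?x = "lift_op X x"
  have F: "?F \<in> l2_on X" "f = fun_l2 ?F" using f by (simp_all add: Abs_l2_in fun_l2_Abs)
  have xx: "(x \<circ> x) f = fun_l2 (?x (?x ?F))"
    using F by (simp add: fun_l2_lift_op_on[OF x] lift_op_in[OF x])
  have "inner ?F (?x (?x ?F)) = inner (?x ?F) (?x ?F)"
    by (rule positive_op_lift_op(2)[OF assms F(1) lift_op_in[OF x]])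
  moreover have "inner ?F (cscale \<i> (?x (?x ?F))) = inner (?x ?F) (cscale \<i> (?x ?F))"
    unfolding lift_op_cscale[OF x, symmetric]
    by (rule positive_op_lift_op(2)[OF assms F(1) lift_op_in[OF x]])
  ultimately show "ell2_inner X f ((x \<circ> x) f) \<in> \<real>\<^sub>\<ge>\<^sub>0"
    unfolding xx complex_nonneg_Reals_iff
    using ell2_inner_fun_l2[OF F(1), of "?x (?x ?F)"] F(2) by (simp add: inner_cscale_i_self)
qed

context positive_operator
begin

lemma positive_operator_square: "positive_operator X (T \<circ> T) (K\<^sup>2)"
proof
  show "positive_op X (T \<circ> T)" by (rule positive_op_square[OF positive])
  show "norm (lift_op X (T \<circ> T) f) \<le> K\<^sup>2 * norm f" if "f \<in> V" for f
  proof -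
    have "norm (T' (T' f)) \<le> K * norm (T' f)" by (rule norm_le[OF invariant[OF that]])
    also have "\<dots> \<le> K * (K * norm f)" using K_nonneg norm_le[OF that] by (rule mult_left_mono[rotated])
    finally show ?thesis by (simp add: lift_op_comp[OF bounded_op bounded_op] power2_eq_square)
  qed
qed (rule nonempty)

text \<open>Positivity is tested on the spectrum of \<open>T\<close> and not of its square, since
  \<open>Q\<close> may contain odd powers. There \<open>d + Q(s) - p n (s^2)\<close> is non-negative
  as soon as \<open>p n\<close> is within \<open>d\<close> of \<open>\<phi>\<close>, and
  \<open>d\<close> is chosen so that it costs at most e in the quadratic form.\<close>

theorem inner_op_fun_square_le:
  assumes \<phi>: "continuous_on {0..K\<^sup>2} \<phi>" and Q: "\<And>s. 0 \<le> s \<Longrightarrow> \<phi> (s\<^sup>2) \<le> poly Q s" and f: "f \<in> V"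
  shows "op_fun X \<phi> (T \<circ> T) (fun_l2 f) \<in> ell2 X"
    and "inner f (Abs_l2 (op_fun X \<phi> (T \<circ> T) (fun_l2 f))) \<le> inner f (papp Q T' f)"
proof -
  interpret S: positive_operator X "T \<circ> T" "K\<^sup>2" by (rule positive_operator_square)
  obtain p where p: "uniform_limit {0..K\<^sup>2} (\<lambda>n. poly (p n)) \<phi> sequentially"
    using uniform_limit_poly_exists[OF \<phi>] .
  show "op_fun X \<phi> (T \<circ> T) (fun_l2 f) \<in> ell2 X" by (rule S.op_fun_tendsto(1)[OF p f])
  have "(\<lambda>n. papp (p n) (lift_op X (T \<circ> T)) f) \<longlonglongrightarrow> Abs_l2 (op_fun X \<phi> (T \<circ> T) (fun_l2 f))"
    by (rule S.op_fun_tendsto(2)[OF p f])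
  then have lim: "(\<lambda>n. inner f (papp (p n) (lift_op X (T \<circ> T)) f)) \<longlonglongrightarrow>
      inner f (Abs_l2 (op_fun X \<phi> (T \<circ> T) (fun_l2 f)))"
    by (intro tendsto_inner tendsto_const)
  have sq: "lift_op X (T \<circ> T) = (\<lambda>f. T' (T' f))"
    by (rule ext) (rule lift_op_comp[OF bounded_op bounded_op])
  show "inner f (Abs_l2 (op_fun X \<phi> (T \<circ> T) (fun_l2 f))) \<le> inner f (papp Q T' f)"
  proof (rule field_le_epsilon)
    fix e :: real assume e: "e > 0"
    define d where "d = e / ((norm f)\<^sup>2 + 1)"
    have pos: "(norm f)\<^sup>2 + 1 > 0" by (simp add: add_nonneg_pos)
    have d: "d > 0" "d * (norm f)\<^sup>2 \<le> e"
      unfolding d_def using e pos by (simp_all add: pos_divide_le_eq algebra_simps)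
    obtain N where N: "\<And>n t. n \<ge> N \<Longrightarrow> t \<in> {0..K\<^sup>2} \<Longrightarrow> \<bar>poly (p n) t - \<phi> t\<bar> < d"
      using p d(1) unfolding uniform_limit_sequentially_iff dist_real_def by blast
    have "inner f (papp (p n) (lift_op X (T \<circ> T)) f) \<le> inner f (papp Q T' f) + e" if n: "n \<ge> N" for n
    proof -
      have "0 \<le> inner f (papp ([:d:] + Q - pcompose (p n) [:0, 0, 1:]) T' f)"
      proof (rule papp_nonneg[OF _ f])
        fix s assume "s \<in> approx_spectrum"
        then have s: "0 \<le> s" "s \<le> K" using approx_spectrum_bounds by auto
        then have "s\<^sup>2 \<in> {0..K\<^sup>2}" by (simp add: power_mono)
        from N[OF n this] have "poly (p n) (s\<^sup>2) \<le> \<phi> (s\<^sup>2) + d" by linarith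
        then show "0 \<le> poly ([:d:] + Q - pcompose (p n) [:0, 0, 1:]) s"
          using Q[OF s(1)] by (simp add: poly_pcompose power2_eq_square)
      qed
      also have "papp ([:d:] + Q - pcompose (p n) [:0, 0, 1:]) T' f =
          d *\<^sub>R f + papp Q T' f - papp (p n) (lift_op X (T \<circ> T)) f"
        by (simp add: papp_minus papp_add papp_pcompose_square[OF linear] sq)
      finally show ?thesis using d(2) by (simp add: inner_add_right inner_diff_right dot_square_norm)
    qed
    then show "inner f (Abs_l2 (op_fun X \<phi> (T \<circ> T) (fun_l2 f))) \<le> inner f (papp Q T' f) + e"
      by (intro LIMSEQ_le_const2[OF lim]) blast
  qed
qed

end

section \<open>Scalar inequalities\<close>

lemma continuous_on_mult_ln: "continuous_on {0..b} (\<lambda>t :: real. t * ln t)"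
  unfolding continuous_on_eq_continuous_within
proof
  fix t :: real assume t: "t \<in> {0..b}"
  show "continuous (at t within {0..b}) (\<lambda>t. t * ln t)"
  proof (cases "t = 0")
    case True
    have "((\<lambda>t :: real. t * ln t) \<longlongrightarrow> 0) (at_right 0)" by real_asymp
    moreover have "at (0 :: real) within {0..b} \<le> at_right 0"
      using at_le[of "{0..b}" "{0..b + 1}" 0] at_within_Icc_at_right[of 0 "b + 1"] t by simp
    ultimately show ?thesis unfolding continuous_within True by (auto intro: tendsto_mono)
  next
    case False
    then show ?thesis using t by (intro continuous_intros) auto
  qed
qed

text \<open>The difference h of the two sides has derivative (u - 1)^3 / (3 u^3), so its minimum is
  h(1) = 0. Multiplied by 2 t^2, the right-hand side is the third-order Taylor polynomial of t^2 ln
  t^2 at 1; putting t = s / c moves the point to c.\<close>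

lemma ln_le_taylor:
  fixes t :: real
  assumes "t > 0"
  shows "ln t \<le> t / 3 + 1 / 2 - 1 / t + 1 / (6 * t\<^sup>2)"
proof -
  define h where "h t = t / 3 + 1 / 2 - 1 / t + 1 / (6 * t\<^sup>2) - ln t" for t :: real
  have der: "(h has_real_derivative (u - 1) ^ 3 / (3 * u ^ 3)) (at u)" if "u > 0" for u
    unfolding h_def using that
    by (auto intro!: derivative_eq_intros simp: field_simps power2_eq_square power3_eq_cube eval_nat_numeral)
  have h1: "h 1 = 0" by (simp add: h_def)
  have "h 1 \<le> h t"
  proof (cases "t \<ge> 1")
    case True
    then show ?thesis
    proof (rule DERIV_nonneg_imp_nondecreasing)
      fix u assume "1 \<le> u" "u \<le> t"
      then show "\<exists>y. (h has_real_derivative y) (at u) \<and> y \<ge> 0"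
        by (intro exI[of _ "(u - 1) ^ 3 / (3 * u ^ 3)"] conjI der) auto
    qed
  next
    case False
    then have "t \<le> 1" by simp
    then show ?thesis
    proof (rule DERIV_nonpos_imp_nonincreasing)
      fix u assume u: "t \<le> u" "u \<le> 1"
      then have "(u - 1) ^ 3 \<le> 0" by (simp add: power_le_zero_eq)
      then have "(u - 1) ^ 3 / (3 * u ^ 3) \<le> 0"
        using assms u by (intro divide_nonpos_pos) auto
      then show "\<exists>y. (h has_real_derivative y) (at u) \<and> y \<le> 0"
        using der[of u] assms u by auto
    qed
  qed
  then show ?thesis using h1 by (simp add: h_def)
qed

text \<open>The right-hand side is the third-order Taylor polynomial of \<open>s\<^sup>2 ln s\<^sup>2\<close> at \<open>c\<close>.\<close>

lemma square_ln_le_cubic: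
  fixes s c :: real
  assumes "c > 0" "s \<ge> 0"
  shows "s\<^sup>2 * ln (s\<^sup>2) \<le> poly [:c\<^sup>2 / 3, - 2 * c, 2 * ln c + 1, 2 / (3 * c):] s"
proof (cases "s = 0")
  case False
  then have s: "s > 0" using assms by simp
  have "ln (s / c) = ln s - ln c" using s assms by (simp add: ln_div)
  then have "ln s - ln c \<le> (s / c) / 3 + 1 / 2 - 1 / (s / c) + 1 / (6 * (s / c)\<^sup>2)"
    using ln_le_taylor[of "s / c"] s assms by simp
  then have "2 * s\<^sup>2 * (ln s - ln c) \<le> 2 * s\<^sup>2 * ((s / c) / 3 + 1 / 2 - 1 / (s / c) + 1 / (6 * (s / c)\<^sup>2))"
    by (intro mult_left_mono) auto
  also have "\<dots> = 2 / (3 * c) * s ^ 3 + s\<^sup>2 - 2 * c * s + c\<^sup>2 / 3"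
    using s assms by (simp add: field_simps power2_eq_square power3_eq_cube)
  finally have "s\<^sup>2 * (2 * ln s) \<le> 2 * s\<^sup>2 * ln c + 2 / (3 * c) * s ^ 3 + s\<^sup>2 - 2 * c * s + c\<^sup>2 / 3"
    by (simp add: algebra_simps)
  also have "2 * ln s = ln (s\<^sup>2)" using s by (simp add: ln_realpow)
  also have "2 * s\<^sup>2 * ln c + 2 / (3 * c) * s ^ 3 + s\<^sup>2 - 2 * c * s + c\<^sup>2 / 3 =
      poly [:c\<^sup>2 / 3, - 2 * c, 2 * ln c + 1, 2 / (3 * c):] s"
    by (simp add: algebra_simps power2_eq_square power3_eq_cube)
  finally show ?thesis .
qed simp

text \<open>Were the claim false, d^2 could be put halfway between D and E / 2 - a. The bound on
  \<open>S\<close> survives the replacement of sqrt D by the larger d, while the conclusion becomes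
  E \<le> 2 (a + d^2), which contradicts the choice of d.\<close>

lemma entropy_bound:
  fixes m a D S N E :: real
  assumes nonneg: "m \<ge> 0" "a \<ge> 0" "D \<ge> 0" and N: "N = m\<^sup>2 + a"
    and S: "S \<le> m ^ 3 + 3 * m * a + 3 * a * sqrt D + sqrt D ^ 3"
    and E: "\<And>c. c > 0 \<Longrightarrow> E \<le> c\<^sup>2 / 3 - 2 * c * m + (2 * ln c + 1) * N + 2 / (3 * c) * S - N * ln N"
  shows "E \<le> 2 * (a + D)"
proof (rule ccontr)
  assume "\<not> ?thesis"
  then have *: "D < E / 2 - a" by simp
  define d where "d = sqrt ((D + (E / 2 - a)) / 2)"
  have d: "sqrt D < d" "d\<^sup>2 < E / 2 - a" "d > 0"
    using * nonneg by (auto simp: d_def)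
  \<comment> \<open>The optimal \<open>c\<close> is \<open>m + sqrt D\<close>; a slightly larger \<open>d\<close> keeps \<open>c\<close> positive.\<close>
  define c where "c = m + d"
  have c: "c > 0" using nonneg d by (simp add: c_def)
  have "sqrt D ^ 3 \<le> d ^ 3" using d nonneg by (intro power_mono) auto
  moreover have "3 * a * sqrt D \<le> 3 * a * d" using d nonneg by (intro mult_left_mono) auto
  ultimately have "S \<le> m ^ 3 + 3 * m * a + 3 * a * d + d ^ 3" using S by linarith
  \<comment> \<open>The sum of cubes m^3 + d^3 and the terms 3 a m + 3 a d share the factor m + d;
    this is what singles out c.\<close>
  also have "\<dots> = c * (m\<^sup>2 - m * d + d\<^sup>2 + 3 * a)"
    by (simp add: c_def power2_eq_square power3_eq_cube algebra_simps)
  finally have "2 / (3 * c) * S \<le> 2 / (3 * c) * (c * (m\<^sup>2 - m * d + d\<^sup>2 + 3 * a))"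
    using c by (intro mult_left_mono) auto
  also have "\<dots> = 2 / 3 * (m\<^sup>2 - m * d + d\<^sup>2 + 3 * a)" using c by simp
  finally have 1: "2 / (3 * c) * S \<le> 2 / 3 * (m\<^sup>2 - m * d + d\<^sup>2 + 3 * a)" .
  have N0: "N \<ge> 0" using N nonneg by simp
  have 2: "N * (2 * ln c) - N * ln N \<le> c\<^sup>2 - N"
  proof (cases "N = 0")
    case False
    then have "N > 0" using N0 by simp
    have "ln (c\<^sup>2 / N) \<le> c\<^sup>2 / N - 1" using \<open>N > 0\<close> c by (intro ln_le_minus_one) simp
    then have "N * ln (c\<^sup>2 / N) \<le> N * (c\<^sup>2 / N - 1)" using N0 by (rule mult_left_mono)
    also have "ln (c\<^sup>2 / N) = 2 * ln c - ln N" using \<open>N > 0\<close> c by (simp add: ln_div ln_realpow)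
    finally show ?thesis using \<open>N > 0\<close> by (simp add: right_diff_distrib)
  qed simp
  have "E \<le> c\<^sup>2 / 3 - 2 * c * m + c\<^sup>2 + 2 / 3 * (m\<^sup>2 - m * d + d\<^sup>2 + 3 * a)"
    using E[OF c] 1 2 by (simp add: algebra_simps)
  also have "\<dots> = 2 * a + 2 * d\<^sup>2"
    by (simp add: c_def power2_eq_square field_simps)
  finally show False using d(2) by simp
qed

section \<open>The logarithmic Sobolev inequality\<close>

lemma inner_l2_finite:
  assumes "finite F" "\<And>x. x \<notin> F \<Longrightarrow> fun_l2 f x = 0"
  shows "inner f g = (\<Sum>x\<in>F. Re (cnj (fun_l2 f x) * fun_l2 g x))"
proof -
  have "inner f g = (\<Sum>\<^sub>\<infinity>x\<in>F. Re (cnj (fun_l2 f x) * fun_l2 g x))"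
    unfolding inner_l2_def using assms(2) by (intro infsum_cong_neutral) auto
  then show ?thesis using assms(1) by simp
qed

lemma (in group) lin_comb_delta_one:
  assumes "finite F" "F \<subseteq> carrier G"
  shows "lin_comb G F c (delta \<one>) = (\<lambda>h. if h \<in> F then c h else 0)"
proof
  fix h
  have "left_regular G g (delta \<one>) h = (if h = g then 1 else 0)" if "g \<in> F" for g
  proof -
    have g: "g \<in> carrier G" using that assms(2) by blast
    have "inv g \<otimes> h = \<one> \<longleftrightarrow> h = g" if "h \<in> carrier G"
      using g that by (metis inv_closed inv_inv inv_equality l_inv r_inv inv_comm)
    then show ?thesis using g delta_in_ell2[of \<one> "carrier G"] by (auto simp: left_regular_def delta_def)
  qed
  then have "lin_comb G F c (delta \<one>) h = (\<Sum>g\<in>F. if h = g then c g else 0)"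
    unfolding lin_comb_def by (intro sum.cong) auto
  then show "lin_comb G F c (delta \<one>) h = (if h \<in> F then c h else 0)"
    using assms(1) by simp
qed

locale positive_group_algebra_element = tree_group +
  fixes x :: "'a op" and F :: "'a set" and c :: "'a \<Rightarrow> complex" and K :: real
  assumes F: "finite F" "F \<subseteq> carrier G" and x_def: "x = lin_comb G F c"
    and positive_x: "positive_op (carrier G) x"
    and norm_x: "\<And>f. f \<in> l2_on (carrier G) \<Longrightarrow> norm (lift_op (carrier G) x f) \<le> K * norm f"
begin

sublocale positive_operator "carrier G" x K
  by (rule positive_operator.intro) (use positive_x norm_x in auto)

text \<open>In contrast to \<open>c\<close>, which is arbitrary outside \<open>F\<close>, this
  function depends on \<open>x\<close> alone; it is also the one that \<open>multiplier\<close>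
  reads off.\<close>

definition coef :: "'a \<Rightarrow> complex" where "coef = x (delta \<one>)"

definition supp :: "'a set" where "supp = {g \<in> carrier G. coef g \<noteq> 0}"

definition vec :: "'a \<Rightarrow> 'a l2" where "vec g = Abs_l2 (delta g)"

lemma coef_eq: "coef = (\<lambda>h. if h \<in> F then c h else 0)"
  using lin_comb_delta_one[OF F, of c] by (simp only: coef_def x_def[symmetric])

lemma supp_subset: "supp \<subseteq> F"
  by (auto simp: supp_def coef_eq)

lemma supp_carrier: "supp \<subseteq> carrier G"
  by (auto simp: supp_def)

lemma finite_supp: "finite supp"
  using supp_subset F(1) by (rule finite_subset)

lemma coef_outside: "g \<notin> supp \<Longrightarrow> coef g = 0"
  using F(2) by (auto simp: supp_def coef_eq)

lemma vec_in: "g \<in> carrier G \<Longrightarrow> vec g \<in> V"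
  unfolding vec_def by (rule Abs_l2_in[OF delta_in_ell2])

lemma fun_l2_vec: "g \<in> carrier G \<Longrightarrow> fun_l2 (vec g) = delta g"
  unfolding vec_def by (rule fun_l2_Abs[OF delta_in_ell2])

lemma inner_vec: "g \<in> carrier G \<Longrightarrow> inner (vec g) f = Re (fun_l2 f g)"
  by (subst inner_l2_finite[of "{g}"]) (auto simp: fun_l2_vec delta_def)

lemma inner_i_vec: "g \<in> carrier G \<Longrightarrow> inner (cscale \<i> (vec g)) f = Im (fun_l2 f g)"
  by (subst inner_l2_finite[of "{g}"]) (auto simp: fun_l2_vec delta_def)

lemma x_apply:
  assumes "f \<in> ell2 (carrier G)" "h \<in> carrier G"
  shows "x f h = (\<Sum>g\<in>supp. coef g * f (inv g \<otimes> h))"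
proof -
  have "x f h = (\<Sum>g\<in>F. c g * left_regular G g f h)"
    by (subst x_def) (rule lin_comb_def[THEN fun_cong, THEN fun_cong])
  also have "\<dots> = (\<Sum>g\<in>F. coef g * f (inv g \<otimes> h))"
    by (intro sum.cong refl) (simp add: left_regular_def coef_eq assms)
  also have "\<dots> = (\<Sum>g\<in>supp. coef g * f (inv g \<otimes> h))"
    using F(1) supp_subset coef_outside by (intro sum.mono_neutral_right) auto
  finally show ?thesis .
qed

lemma fun_l2_x_vec_one: "fun_l2 (T' (vec \<one>)) = coef"
  by (simp add: fun_l2_lift_op_on[OF bounded_op vec_in] fun_l2_vec coef_def)

text \<open>Self-adjointness tested on the basis vectors at the identity and at \<open>g\<close>. As
  the inner product is real, the imaginary part needs a second test, with the first vector
  multiplied by i.\<close>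

lemma coef_inv:
  assumes g: "g \<in> carrier G"
  shows "coef (inv g) = cnj (coef g)"
proof -
  have "x (delta g) \<one> = (\<Sum>k\<in>supp. coef k * (if k = inv g then 1 else 0))"
  proof (subst x_apply[OF delta_in_ell2[OF g] one_closed], intro sum.cong refl)
    fix k assume "k \<in> supp"
    then have "k \<in> carrier G" by (simp add: supp_def)
    then have "inv k \<otimes> \<one> = g \<longleftrightarrow> k = inv g" using g by (metis inv_closed inv_inv r_one)
    then show "coef k * delta g (inv k \<otimes> \<one>) = coef k * (if k = inv g then 1 else 0)"
      by (simp add: delta_def)
  qed
  also have "\<dots> = coef (inv g)"
    using finite_supp coef_outside[of "inv g"] by (auto simp: if_distrib[of "(*) _"] sum.delta cong: if_cong)
  finally have x: "fun_l2 (T' (vec g)) \<one> = coef (inv g)"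
    by (simp add: fun_l2_lift_op_on[OF bounded_op vec_in[OF g]] fun_l2_vec g)
  have "Re (coef (inv g)) = inner (vec \<one>) (T' (vec g))"
    by (simp add: inner_vec x)
  also have "\<dots> = inner (T' (vec \<one>)) (vec g)"
    by (rule selfadjoint) (simp_all add: vec_in g)
  also have "\<dots> = inner (vec g) (T' (vec \<one>))" by (rule inner_commute)
  also have "\<dots> = Re (coef g)" by (simp add: inner_vec g fun_l2_x_vec_one)
  finally have Re: "Re (coef (inv g)) = Re (coef g)" .
  have "Im (coef (inv g)) = inner (cscale \<i> (vec \<one>)) (T' (vec g))"
    by (simp add: inner_i_vec x)
  also have "\<dots> = inner (T' (cscale \<i> (vec \<one>))) (vec g)"
    by (rule selfadjoint) (simp_all add: vec_in g cscale_l2_on)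
  also have "\<dots> = inner (vec g) (cscale \<i> (T' (vec \<one>)))"
    unfolding lift_op_cscale[OF bounded_op] by (rule inner_commute)
  also have "\<dots> = - Im (coef g)" by (simp add: inner_vec g fun_l2_x_vec_one)
  finally show ?thesis using Re by (simp add: complex_eq_iff)
qed

lemma coef_one: "coef \<one> = of_real (cmod (coef \<one>))"
proof -
  have "0 \<le> inner (vec \<one>) (T' (vec \<one>))"
    using positive_op_lift_op(1)[OF positive_x vec_in] by simp
  then have "0 \<le> Re (coef \<one>)" by (simp add: inner_vec fun_l2_x_vec_one)
  moreover have "Im (coef \<one>) = 0" using coef_inv[of \<one>] by (simp add: complex_eq_iff)
  ultimately show ?thesis by (simp add: complex_eq_iff cmod_eq_Re)
qed

lemma canonical_trace_eq:
  assumes "W (delta \<one>) \<in> ell2 (carrier G)"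
  shows "Re (canonical_trace G W) = inner (vec \<one>) (Abs_l2 (W (delta \<one>)))"
  using ell2_inner_fun_l2(1)[OF vec_in[OF one_closed], of "Abs_l2 (W (delta \<one>))"]
  by (simp add: canonical_trace_def fun_l2_Abs[OF assms] fun_l2_vec)

abbreviation "b \<equiv> \<lambda>g. cmod (coef g)"
abbreviation "N \<equiv> \<Sum>g\<in>supp. (b g)\<^sup>2"

lemma norm_x_vec_sq: "inner (T' (vec \<one>)) (T' (vec \<one>)) = N"
proof -
  have "inner (T' (vec \<one>)) (T' (vec \<one>)) = (\<Sum>g\<in>supp. Re (cnj (coef g) * coef g))"
    unfolding fun_l2_x_vec_one[symmetric]
    by (rule inner_l2_finite[OF finite_supp]) (simp add: fun_l2_x_vec_one coef_outside)
  then show ?thesis by (simp only: Re_cnj_mult_self)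
qed

lemma trace_square: "Re (canonical_trace G (x \<circ> x)) = N"
proof -
  have "(x \<circ> x) (delta \<one>) = fun_l2 (T' (T' (vec \<one>)))"
    by (simp add: fun_l2_lift_op_on[OF bounded_op] lift_op_in[OF bounded_op] vec_in fun_l2_vec)
  moreover have "fun_l2 (T' (T' (vec \<one>))) \<in> ell2 (carrier G)"
    by (rule fun_l2_in[OF lift_op_in[OF bounded_op]])
  ultimately have "Re (canonical_trace G (x \<circ> x)) = inner (vec \<one>) (T' (T' (vec \<one>)))"
    using canonical_trace_eq[of "x \<circ> x"] by simp
  also have "\<dots> = N"
    using selfadjoint[of "vec \<one>" "T' (vec \<one>)"] by (simp add: vec_in lift_op_in[OF bounded_op] norm_x_vec_sq)
  finally show ?thesis .
qed

text \<open>The third moment is the pairing of \<open>coef\<close> with its convolution square.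
  Passing to absolute values loses the phases but leaves a non-negative symmetric function, as the
  tripod estimate requires.\<close>

lemma trace_cube_le:
  "inner (T' (vec \<one>)) (T' (T' (vec \<one>))) \<le> (\<Sum>g\<in>supp. \<Sum>h\<in>supp. b g * b h * b (g \<otimes> h))"
proof -
  have c: "coef \<in> ell2 (carrier G)"
    by (rule finite_support_in_ell2[OF finite_supp supp_carrier coef_outside])
  have "inner (T' (vec \<one>)) (T' (T' (vec \<one>))) = (\<Sum>h\<in>supp. Re (cnj (coef h) * x coef h))"
    using fun_l2_lift_op_on[OF bounded_op lift_op_in[OF bounded_op]]
    by (subst inner_l2_finite[OF finite_supp]) (simp_all add: fun_l2_x_vec_one coef_outside)
  also have "\<dots> \<le> (\<Sum>h\<in>supp. \<Sum>g\<in>supp. b h * (b g * b (inv g \<otimes> h)))"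
  proof (rule sum_mono)
    fix h assume "h \<in> supp"
    then have h: "h \<in> carrier G" by (simp add: supp_def)
    have "Re (cnj (coef h) * x coef h) \<le> b h * cmod (x coef h)"
      using complex_Re_le_cmod[of "cnj (coef h) * x coef h"] by (simp add: norm_mult)
    also have "cmod (x coef h) \<le> (\<Sum>g\<in>supp. b g * b (inv g \<otimes> h))"
      unfolding x_apply[OF c h] by (rule order_trans[OF norm_sum]) (simp add: norm_mult)
    finally show "Re (cnj (coef h) * x coef h) \<le> (\<Sum>g\<in>supp. b h * (b g * b (inv g \<otimes> h)))"
      by (simp add: mult_left_mono sum_distrib_left)
  qed
  also have "\<dots> = (\<Sum>g\<in>supp. \<Sum>h\<in>supp. b h * (b g * b (inv g \<otimes> h)))"
    by (rule sum.swap)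
  \<comment> \<open>Replacing g by its inverse changes neither \<open>supp\<close> nor the modulus
    of the coefficient.\<close>
  also have "\<dots> = (\<Sum>g\<in>supp. \<Sum>h\<in>supp. b g * b h * b (g \<otimes> h))"
    by (rule sum.reindex_bij_witness[of _ "\<lambda>g. inv g" "\<lambda>g. inv g"])
      (auto simp: supp_def coef_inv mult_ac)
  finally show ?thesis .
qed

text \<open>The left-hand side is the sum of \<open>len g\<close> times \<open>(b g)\<^sup>2\<close>
  off the identity, and \<open>len\<close> is at most the word length.\<close>

lemma energy_ge:
  "(\<Sum>g\<in>supp - {\<one>}. (b g)\<^sup>2) + (\<Sum>g\<in>supp - {\<one>}. (real (len g) - 1) * (b g)\<^sup>2) \<le>
     Re (canonical_trace G (x \<circ> length_generator G S x))"
proof -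
  let ?\<psi> = "\<lambda>g. of_nat (word_length G S g) :: complex"
  let ?y = "\<lambda>h. ?\<psi> h * coef h"
  have "length_generator G S x (delta \<one>) = (\<lambda>h. if h \<in> supp then ?y h else 0)"
    unfolding length_generator_def multiplier_def Let_def coef_def[symmetric] supp_def[symmetric]
    by (rule lin_comb_delta_one[OF finite_supp supp_carrier])
  also have "\<dots> = ?y" using coef_outside by auto
  finally have Lx: "length_generator G S x (delta \<one>) = ?y" .
  have y: "?y \<in> ell2 (carrier G)"
    by (rule finite_support_in_ell2[OF finite_supp supp_carrier]) (simp add: coef_outside)
  define Y where "Y = Abs_l2 ?y"
  have Y: "Y \<in> V" "fun_l2 Y = ?y" using y by (simp_all add: Y_def Abs_l2_in fun_l2_Abs)
  have xy: "(x \<circ> length_generator G S x) (delta \<one>) = fun_l2 (T' Y)"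
    by (simp add: fun_l2_lift_op_on[OF bounded_op Y(1)] Y(2) Lx)
  have "Re (canonical_trace G (x \<circ> length_generator G S x)) = inner (vec \<one>) (T' Y)"
    by (subst canonical_trace_eq) (simp_all only: xy fun_l2_in[OF lift_op_in[OF bounded_op]] Abs_fun_l2)
  also have "\<dots> = inner (T' (vec \<one>)) Y" by (simp add: selfadjoint vec_in Y(1))
  also have "\<dots> = (\<Sum>g\<in>supp. Re (cnj (coef g) * ?y g))"
    by (subst inner_l2_finite[OF finite_supp]) (simp_all add: fun_l2_x_vec_one coef_outside Y(2))
  also have "\<dots> = (\<Sum>g\<in>supp. real (word_length G S g) * (b g)\<^sup>2)"
    by (intro sum.cong refl) (simp only: Re_cnj_mult_self[symmetric], simp add: algebra_simps)
  also have "\<dots> \<ge> (\<Sum>g\<in>supp - {\<one>}. real (len g) * (b g)\<^sup>2)"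
  proof (rule order_trans[OF sum_mono])
    show "real (len g) * (b g)\<^sup>2 \<le> real (word_length G S g) * (b g)\<^sup>2" if "g \<in> supp - {\<one>}" for g
      using len_le_word_length[of g] that by (intro mult_right_mono) (auto simp: supp_def)
    show "(\<Sum>g\<in>supp - {\<one>}. real (word_length G S g) * (b g)\<^sup>2) \<le> (\<Sum>g\<in>supp. real (word_length G S g) * (b g)\<^sup>2)"
      by (rule sum_mono2[OF finite_supp]) auto
  qed
  finally show ?thesis by (simp add: sum.distrib[symmetric] algebra_simps)
qed

theorem log_sobolev: "Ent G (x \<circ> x) \<le> 2 * Re (canonical_trace G (x \<circ> length_generator G S x))"
proof -
  let ?\<phi> = "\<lambda>t :: real. t * ln t"
  define a where "a = (\<Sum>g\<in>supp - {\<one>}. (b g)\<^sup>2)"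
  define D where "D = (\<Sum>g\<in>supp - {\<one>}. (real (len g) - 1) * (b g)\<^sup>2)"
  define S3 where "S3 = inner (T' (vec \<one>)) (T' (T' (vec \<one>)))"
  have "Ent G (x \<circ> x) \<le> 2 * (a + D)"
  proof (rule entropy_bound[where m = "b \<one>" and N = N and S = S3])
    show "a \<ge> 0" by (simp add: a_def sum_nonneg)
    show "D \<ge> 0"
      unfolding D_def
    proof (intro sum_nonneg mult_nonneg_nonneg)
      \<comment> \<open>The weight \<open>len g - 1\<close> would be -1 at the identity, so its
        removal matters here.\<close>
      fix g assume "g \<in> supp - {\<one>}"
      then have "len g \<noteq> 0" using len_eq_0_iff[of g] by (auto simp: supp_def)
      then show "0 \<le> real (len g) - 1" by simp
    qed simp
    show "N = (b \<one>)\<^sup>2 + a"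
      unfolding a_def using sum.remove[OF finite_supp, of \<one> "\<lambda>g. (b g)\<^sup>2"] coef_outside[of \<one>]
      by (cases "\<one> \<in> supp") auto
    show "S3 \<le> (b \<one>) ^ 3 + 3 * b \<one> * a + 3 * a * sqrt D + sqrt D ^ 3"
    proof -
      have eq: "{g \<in> carrier G. b g \<noteq> 0} = supp" by (simp add: supp_def)
      have "(\<Sum>g\<in>supp. \<Sum>h\<in>supp. b g * b h * b (g \<otimes> h)) \<le>
          (b \<one>) ^ 3 + 3 * b \<one> * a + 3 * a * sqrt D + sqrt D ^ 3"
        unfolding a_def D_def
        by (rule sum_mult_le[of b, unfolded eq]) (simp_all add: coef_inv finite_supp)
      then show ?thesis unfolding S3_def using trace_cube_le by linarith
    qed
    fix c :: real assume c: "c > 0"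
    let ?Q = "[:c\<^sup>2 / 3, - 2 * c, 2 * ln c + 1, 2 / (3 * c):]"
    have f: "op_fun (carrier G) ?\<phi> (x \<circ> x) (delta \<one>) \<in> ell2 (carrier G)"
      "inner (vec \<one>) (Abs_l2 (op_fun (carrier G) ?\<phi> (x \<circ> x) (delta \<one>))) \<le> inner (vec \<one>) (papp ?Q T' (vec \<one>))"
      using inner_op_fun_square_le[OF continuous_on_mult_ln square_ln_le_cubic[OF c] vec_in[OF one_closed]]
      by (simp_all only: fun_l2_vec[OF one_closed])
    \<comment> \<open>The trace is the vector state at \<open>vec \<one>\<close>, so the
      coefficients of the cubic multiply the moments of \<open>x\<close> of order 0 to 3, which are
      1, \<open>b \<one>\<close>, \<open>N\<close> and \<open>S3\<close>.\<close>
    have "inner (vec \<one>) (papp ?Q T' (vec \<one>)) =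
        c\<^sup>2 / 3 - 2 * c * b \<one> + (2 * ln c + 1) * N + 2 / (3 * c) * S3"
    proof -
      have "papp ?Q T' (vec \<one>) = (c\<^sup>2 / 3) *\<^sub>R vec \<one> - (2 * c) *\<^sub>R T' (vec \<one>) +
          (2 * ln c + 1) *\<^sub>R T' (T' (vec \<one>)) + (2 / (3 * c)) *\<^sub>R T' (T' (T' (vec \<one>)))"
        by (simp only: papp_pCons[OF linear] papp_0 T.zero T.add T.scaleR) (simp add: add.assoc)
      moreover have "inner (vec \<one>) (vec \<one>) = 1" by (simp add: inner_vec fun_l2_vec delta_def)
      moreover have "inner (vec \<one>) (T' (vec \<one>)) = b \<one>"
        using coef_one by (simp add: inner_vec fun_l2_x_vec_one complex_eq_iff)
      moreover have "inner (vec \<one>) (T' (T' (vec \<one>))) = N"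
        using selfadjoint[of "vec \<one>" "T' (vec \<one>)"] by (simp add: vec_in invariant norm_x_vec_sq)
      moreover have "inner (vec \<one>) (T' (T' (T' (vec \<one>)))) = S3"
        using selfadjoint[of "vec \<one>" "T' (T' (vec \<one>))"] by (simp add: vec_in invariant S3_def)
      ultimately show ?thesis
        by (simp only: inner_add_right inner_diff_right inner_scaleR_right)
    qed
    then show "Ent G (x \<circ> x) \<le>
        c\<^sup>2 / 3 - 2 * c * b \<one> + (2 * ln c + 1) * N + 2 / (3 * c) * S3 - N * ln N"
      unfolding Ent_def trace_square
        canonical_trace_eq[of "op_fun (carrier G) ?\<phi> (x \<circ> x)", OF f(1)]
      using f(2) by linarith
  qed simp
  also have "\<dots> \<le> 2 * Re (canonical_trace G (x \<circ> length_generator G S x))"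
    using energy_ge by (simp add: a_def D_def)
  finally show ?thesis .
qed

end

theorem mainTheorem3:
  fixes A :: "'a set" and B :: "'b set"
    and x :: "(('a + 'b) \<times> int) list op"
  defines "G \<equiv> free_product_Z_Z2 A B"
  defines "L \<equiv> length_generator G (generators_Z_Z2 A B)"
  assumes "x \<in> group_algebra G"
    and "positive_op (carrier G) x"
  shows "Ent G (x \<circ> x) \<le> 2 * Re (canonical_trace G (x \<circ> L x))"
proof -
  interpret tree_group G "generators_Z_Z2 A B" syllables_len
    unfolding G_def by (rule tree_group_free_product)
  obtain F c where F: "finite F" "F \<subseteq> carrier G" "x = lin_comb G F c"
    using assms(3) unfolding group_algebra_def by blast
  have "x \<in> bounded_ops (carrier G)" using assms(4) by (simp add: positive_op_def)
  then obtain K where "\<And>f. norm (lift_op (carrier G) x f) \<le> K * norm f"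
    using lift_op_bounded by blast
  then interpret positive_group_algebra_element G "generators_Z_Z2 A B" syllables_len x F c K
    by unfold_locales (use F assms(4) in auto)
  show ?thesis unfolding L_def by (rule log_sobolev)
qed

end
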